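(* Let $\Delta(x,\hat x)=(x-\hat x)^2$, $\mu_X,\mu_{\hat X}\in\mathbb R$, $\sigma_X,\sigma_{\hat X}>0$, and $R,R_c\ge0$. Then $$D\big(R,R_c\,\big|\,\mathcal N(\mu_X,\sigma_X^2),\mathcal N(\mu_{\hat X},\sigma_{\hat X}^2)\big)=(\mu_X-\mu_{\hat X})^2+\sigma_X^2+\sigma_{\hat X}^2-2\sigma_X\sigma_{\hat X}\,\xi(R,R_c),$$ where $\xi(R,R_c):=\sqrt{(1-e^{-2R})(1-e^{-2(R+R_c)})}$.
   Context: All logarithms are natural. $D(R,R_c|p_X,p_{\hat X})$ is the output-constrained distortion-rate function: for a block length $n\ge1$, a code consists of finite sets $\mathcal J,\mathcal K$, a random seed $K$ uniform on $\mathcal K$ and independent of the source sequence $X^n=(X_1,\dots,X_n)$ (i.i.d. with marginal $p_X$), a stochastic encoder $p_{J|X^nK}$ producing $J\in\mathcal J$, and a stochastic decoder $p_{\hat X^n|JK}$ producing $\hat X^n\in\mathbb R^n$. A level $D$ is achievable with respect to $p_{\hat X}$ subject to $(R,R_c)$ if for some $n$ there is such a code with $\frac1n\log|\mathcal J|\le R$, $\frac1n\log|\mathcal K|\le R_c$, $\frac1n\sum_{t=1}^n\mathbb E[\Delta(X_t,\hat X_t)]\le D$, and $\hat X_1,\dots,\hat X_n$ i.i.d. with marginal $p_{\hat X}$; $D(R,R_c|p_X,p_{\hat X})$ is the infimum of achievable $D$. *)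

theory Defs
  imports "HOL-Probability.Probability"
begin

text \<open>Codes of block length n with message set J = {..<M}, seed set K = {..<L}
 (finite sets, WLOG labelled by natural numbers).
 Stochastic encoder: enc k x j = probability that the encoder outputs j given
 source sequence x and seed k (measurable in x).
 Stochastic decoder: dec j k = conditional distribution of the reconstruction
 sequence given message j and seed k (a probability measure on R^n).
 Sequences in R^n are functions nat => real on the index set {..<n}.\<close>

definition seq_space :: "nat \<Rightarrow> (nat \<Rightarrow> real) measure" where
  "seq_space n = PiM {..<n} (\<lambda>_. borel)"

definition iid :: "nat \<Rightarrow> real measure \<Rightarrow> (nat \<Rightarrow> real) measure" where
  "iid n p = PiM {..<n} (\<lambda>_. p)"

definition valid_code ::
  "nat \<Rightarrow> nat \<Rightarrow> nat \<Rightarrow> (nat \<Rightarrow> (nat \<Rightarrow> real) \<Rightarrow> nat \<Rightarrow> real)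
   \<Rightarrow> (nat \<Rightarrow> nat \<Rightarrow> (nat \<Rightarrow> real) measure) \<Rightarrow> bool" where
  "valid_code n M L enc dec \<longleftrightarrow>
     n \<ge> 1 \<and> M \<ge> 1 \<and> L \<ge> 1 \<and>
     (\<forall>k<L. \<forall>j<M. (\<lambda>x. enc k x j) \<in> borel_measurable (seq_space n)) \<and>
     (\<forall>k<L. \<forall>x. \<forall>j<M. enc k x j \<ge> 0) \<and>
     (\<forall>k<L. \<forall>x. (\<Sum>j<M. enc k x j) = 1) \<and>
     (\<forall>j<M. \<forall>k<L. prob_space (dec j k) \<and> sets (dec j k) = sets (seq_space n))"

text \<open>Expected total distortion (sum over t<n of E[Delta(X_t, Xhat_t)]), with the seed
 uniform on {..<L} and independent of the i.i.d. source X^n ~ pX^n.\<close>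
definition code_distortion ::
  "(real \<Rightarrow> real \<Rightarrow> real) \<Rightarrow> real measure \<Rightarrow> nat \<Rightarrow> nat \<Rightarrow> nat
   \<Rightarrow> (nat \<Rightarrow> (nat \<Rightarrow> real) \<Rightarrow> nat \<Rightarrow> real)
   \<Rightarrow> (nat \<Rightarrow> nat \<Rightarrow> (nat \<Rightarrow> real) measure) \<Rightarrow> ennreal" where
  "code_distortion \<Delta> pX n M L enc dec =
     (\<Sum>k<L. \<Sum>j<M. ennreal (1 / real L) *
        (\<integral>\<^sup>+ x. ennreal (enc k x j) *
            (\<integral>\<^sup>+ y. ennreal (\<Sum>t<n. \<Delta> (x t) (y t)) \<partial>(dec j k)) \<partial>(iid n pX)))"

definition code_output :: "real measure \<Rightarrow> nat \<Rightarrow> nat \<Rightarrow> nat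
   \<Rightarrow> (nat \<Rightarrow> (nat \<Rightarrow> real) \<Rightarrow> nat \<Rightarrow> real)
   \<Rightarrow> (nat \<Rightarrow> nat \<Rightarrow> (nat \<Rightarrow> real) measure) \<Rightarrow> (nat \<Rightarrow> real) set \<Rightarrow> ennreal" where
  "code_output pX n M L enc dec A =
     (\<Sum>k<L. \<Sum>j<M. ennreal (1 / real L) *
        (\<integral>\<^sup>+ x. ennreal (enc k x j) \<partial>(iid n pX)) * emeasure (dec j k) A)"

definition achievable ::
  "(real \<Rightarrow> real \<Rightarrow> real) \<Rightarrow> real \<Rightarrow> real \<Rightarrow> real \<Rightarrow> real measure \<Rightarrow> real measure \<Rightarrow> bool" where
  "achievable \<Delta> D R Rc pX pXh \<longleftrightarrow>
     (\<exists>n M L enc dec. valid_code n M L enc dec \<and>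
        ln (real M) / real n \<le> R \<and> ln (real L) / real n \<le> Rc \<and>
        code_distortion \<Delta> pX n M L enc dec \<le> ennreal (real n * D) \<and>
        (\<forall>A \<in> sets (seq_space n). code_output pX n M L enc dec A = emeasure (iid n pXh) A))"

definition DRF ::
  "(real \<Rightarrow> real \<Rightarrow> real) \<Rightarrow> real \<Rightarrow> real \<Rightarrow> real measure \<Rightarrow> real measure \<Rightarrow> real" where
  "DRF \<Delta> R Rc pX pXh = Inf {D. achievable \<Delta> D R Rc pX pXh}"

definition gaussian :: "real \<Rightarrow> real \<Rightarrow> real measure" where
  "gaussian \<mu> \<sigma> = density lborel (normal_density \<mu> \<sigma>)"

definition xi :: "real \<Rightarrow> real \<Rightarrow> real" where
  "xi R Rc = sqrt ((1 - exp (-2*R)) * (1 - exp (-2*(R+Rc))))"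

end

theory Submission
  imports Defs
begin

text \<open>Let A and B be the conditional means of the standardised source and output given
  message and seed. The distortion is determined by E<A, B>, because source and output are
  conditionally independent. If a Gaussian vector in n dimensions is split into q pieces, then the
  mean squared norm of the centroids is at most n (1 - q^(-2/n)), by comparing each
  piece with a Gaussian around its centroid. The message splits the source into at most e^(nR) pieces
  for every value of the seed, and the message together with the seed splits the output into at
  most e^(n(R + Rc)) pieces, so Cauchy-Schwarz yields the converse.

  For achievability, Gaussian codewords u(k, j) are needed such that the noisy codewords of
  every group k have almost the source law, and all of them together almost
  the output law. The second moment method (soft covering) provides them, and a small
  correction makes both laws, and the uniform law of the message, exact. Since such a code almost
  attains the bound on the centroids, A and B are almost proportional to the
  codeword, and therefore E<A, B> is almost maximal.\<close>

section \<open>Products of Gaussians\<close>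

text \<open>Two obstacles shape the construction. A random codebook covers a law only approximately,
  while the output law has to be exact; and the squared distance is unbounded, so a correction of
  small mass need not be cheap. The first is met by redistributing mass inside a partition of the
  Gaussian law itself, the second by controlling the fourth moments of the codewords together with
  the covering. The joint law of source and output is never analysed: the partition of the source
  (for each seed, channel parameter \<alpha>) and that of the output (over all pairs of seed and
  message, parameter \<beta>) are built separately from the same codewords, and only the
  near-equality in the centroid bounds ties them together. The parameters stay slightly below
  \<open>1 - exp (-2 * R)\<close> and \<open>1 - exp (-2 * (R + Rc))\<close>, so that the numbers of
  codewords exceed the relevant density ratios exponentially. The pieces need exactly equal weights
  because the message law, which the encoder fixes, weights the decoder's laws in the output
  mixture.\<close>

lemma square_diff_le:
  fixes x y :: real
  shows "(x - y)\<^sup>2 \<le> 2 * x\<^sup>2 + 2 * y\<^sup>2"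
  using zero_le_power2[of "x + y"] by (simp add: power2_sum power2_diff)

lemma sets_gaussian [simp, measurable_cong]: "sets (gaussian m s) = sets borel"
  by (simp add: gaussian_def)

lemma space_gaussian [simp]: "space (gaussian m s) = UNIV"
  by (simp add: gaussian_def)

lemma prob_space_gaussian: "s > 0 \<Longrightarrow> prob_space (gaussian m s)"
  unfolding gaussian_def by (rule prob_space_normal_density)

lemma gaussian_moment_even:
  assumes "s > 0"
  shows "has_bochner_integral (gaussian m s) (\<lambda>x. ((x - m) / s) ^ (2 * k)) (fact (2 * k) / (2 ^ k * fact k))"
proof -
  have "has_bochner_integral lborel (\<lambda>x. normal_density m s x * (x - m) ^ (2 * k) * inverse (s ^ (2 * k)))
     (fact (2 * k) / ((2 / s\<^sup>2) ^ k * fact k) * inverse (s ^ (2 * k)))"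
    by (rule has_bochner_integral_mult_left[OF normal_moment_even[OF assms]])
  also have "(\<lambda>x. normal_density m s x * (x - m) ^ (2 * k) * inverse (s ^ (2 * k)))
     = (\<lambda>x. normal_density m s x *\<^sub>R ((x - m) / s) ^ (2 * k))"
    by (simp add: power_divide field_simps)
  also have "fact (2 * k) / ((2 / s\<^sup>2) ^ k * fact k) * inverse (s ^ (2 * k)) = fact (2 * k) / (2 ^ k * fact k)"
    using assms by (simp add: power_divide field_simps flip: power_mult)
  finally show ?thesis
    unfolding gaussian_def by (intro has_bochner_integral_density) (auto simp: assms normal_density_nonneg)
qed

lemma gaussian_mean:
  assumes "s > 0"
  shows "has_bochner_integral (gaussian m s) (\<lambda>x. (x - m) / s) 0"
proof -
  have "has_bochner_integral lborel (\<lambda>x. normal_density m s x * (x - m) ^ (2 * 0 + 1) * inverse s) (0 * inverse s)"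
    by (rule has_bochner_integral_mult_left[OF normal_moment_odd[OF assms]])
  then have "has_bochner_integral lborel (\<lambda>x. normal_density m s x *\<^sub>R ((x - m) / s)) 0"
    by (simp add: field_simps)
  then show ?thesis
    unfolding gaussian_def by (intro has_bochner_integral_density) (auto simp: assms normal_density_nonneg)
qed

lemma has_bochner_integral_PiM_component:
  fixes f :: "_ \<Rightarrow> real"
  assumes "finite I" "i \<in> I" "\<And>i. prob_space (M i)" "has_bochner_integral (M i) f v"
  shows "has_bochner_integral (PiM I M) (\<lambda>x. f (x i)) v"
proof -
  have *: "distr (PiM I M) (M i) (\<lambda>x. x i) = M i"
    using assms by (intro distr_PiM_component) auto
  have "has_bochner_integral (distr (PiM I M) (M i) (\<lambda>x. x i)) f v"
    using assms unfolding * by simp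
  moreover have "f \<in> borel_measurable (M i)" using assms by (auto dest: borel_measurable_has_bochner_integral)
  moreover have "(\<lambda>x. x i) \<in> measurable (PiM I M) (M i)" using assms by measurable
  ultimately show ?thesis
    by (auto simp: has_bochner_integral_iff integrable_distr_eq integral_distr)
qed

text \<open>Independence and centring kill the cross terms, so variances add.\<close>

lemma has_bochner_integral_PiM_square_sum:
  fixes f :: "'i \<Rightarrow> 'a \<Rightarrow> real"
  assumes I: "finite I" and M: "\<And>i. prob_space (M i)"
    and f1: "\<And>i. i \<in> I \<Longrightarrow> has_bochner_integral (M i) (f i) 0"
    and f2: "\<And>i. i \<in> I \<Longrightarrow> has_bochner_integral (M i) (\<lambda>x. (f i x)\<^sup>2) (v i)"
  shows "has_bochner_integral (PiM I M) (\<lambda>x. (\<Sum>i\<in>I. f i (x i))\<^sup>2) (\<Sum>i\<in>I. v i)"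
proof -
  interpret product_prob_space M I
    by (intro product_prob_spaceI M)
  have "has_bochner_integral (PiM I M) (\<lambda>x. f i (x i) * f j (x j)) (if i = j then v i else 0)"
    if ij: "i \<in> I" "j \<in> I" for i j
  proof (cases "i = j")
    case True
    then show ?thesis
      using has_bochner_integral_PiM_component[of I i M "\<lambda>x. (f i x)\<^sup>2"] I M f2[of i] ij by (simp add: power2_eq_square)
  next
    case False
    \<comment> \<open>Padding with the constant 1 turns a product of two coordinates into one over
      all of \<open>I\<close>; its integral factorises, and the centred factor at \<open>i\<close>
      makes it vanish.\<close>
    define g where "g k = (if k = i then f i else if k = j then f j else (\<lambda>_. 1))" for k
    have g: "integrable (M k) (g k)" if "k \<in> I" for k
      using f1[of i] f1[of j] ij by (auto simp: g_def has_bochner_integral_iff M prob_space.finite_measure)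
    have eq: "(\<Prod>k\<in>I. g k (x k)) = f i (x i) * f j (x j)" for x
    proof -
      have "(\<Prod>k\<in>I. g k (x k)) = (\<Prod>k\<in>{i, j}. g k (x k))"
        using I ij by (intro prod.mono_neutral_right) (auto simp: g_def)
      then show ?thesis using False by (simp add: g_def)
    qed
    have "(\<Prod>k\<in>I. integral\<^sup>L (M k) (g k)) = 0"
      using f1[of i] ij I by (intro prod_zero bexI[of _ i]) (auto simp: g_def has_bochner_integral_iff)
    then show ?thesis
      using product_integral_prod[OF I g] product_integrable_prod[OF I g] False
      by (simp add: has_bochner_integral_iff eq)
  qed
  then have "has_bochner_integral (PiM I M) (\<lambda>x. \<Sum>i\<in>I. \<Sum>j\<in>I. f i (x i) * f j (x j))
     (\<Sum>i\<in>I. \<Sum>j\<in>I. if i = j then v i else 0)"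
    by (intro has_bochner_integral_sum) auto
  then show ?thesis using I by (simp add: power2_eq_square sum_product)
qed

text \<open>The means may vary with the coordinate because the law of the source given a codeword is
  such a product; the i.i.d. law is the case of constant means.\<close>

definition gprod :: "nat \<Rightarrow> (nat \<Rightarrow> real) \<Rightarrow> real \<Rightarrow> (nat \<Rightarrow> real) measure" where
  "gprod n m s = PiM {..<n} (\<lambda>t. gaussian (m t) s)"

lemma iid_gaussian: "iid n (gaussian m s) = gprod n (\<lambda>_. m) s"
  by (simp add: iid_def gprod_def)

lemma sets_gprod [simp, measurable_cong]: "sets (gprod n m s) = sets (seq_space n)"
  unfolding gprod_def seq_space_def by (intro sets_PiM_cong) auto

lemma space_gprod [simp]: "space (gprod n m s) = space (seq_space n)"
  by (rule sets_eq_imp_space_eq) simp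

lemma measurable_component_seq_space [measurable]: "t < n \<Longrightarrow> (\<lambda>x. x t) \<in> borel_measurable (seq_space n)"
  unfolding seq_space_def by (rule measurable_component_singleton) auto

lemma prob_space_gprod: "s > 0 \<Longrightarrow> prob_space (gprod n m s)"
  unfolding gprod_def by (intro prob_space_PiM prob_space_gaussian)

text \<open>Distances are measured in the coordinates in which the Gaussian N(m, s) is standard.\<close>

definition sqdist :: "nat \<Rightarrow> real \<Rightarrow> real \<Rightarrow> (nat \<Rightarrow> real) \<Rightarrow> (nat \<Rightarrow> real) \<Rightarrow> real" where
  "sqdist n m s b x = (\<Sum>t<n. ((x t - m) / s - b t)\<^sup>2)"

lemma sqdist_nonneg [simp]: "0 \<le> sqdist n m s b x"
  by (simp add: sqdist_def sum_nonneg)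

lemma measurable_sqdist [measurable]: "sqdist n m s b \<in> borel_measurable (seq_space n)"
  unfolding sqdist_def by measurable

lemma gprod_sq:
  assumes "s > 0"
  shows "has_bochner_integral (gprod n m s) (\<lambda>x. \<Sum>t<n. ((x t - m t) / s)\<^sup>2) (real n)"
proof -
  have "has_bochner_integral (gprod n m s) (\<lambda>x. \<Sum>t<n. ((x t - m t) / s)\<^sup>2) (\<Sum>t<n. 1)"
    unfolding gprod_def
  proof (intro has_bochner_integral_sum has_bochner_integral_PiM_component[where f="\<lambda>y. ((y - m _) / s)\<^sup>2"])
    fix t show "has_bochner_integral (gaussian (m t) s) (\<lambda>y. ((y - m t) / s)\<^sup>2) 1"
      using gaussian_moment_even[OF assms, of "m t" 1] by simp
  qed (auto intro: prob_space_gaussian assms)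
  then show ?thesis by simp
qed

text \<open>This is the variance of a chi-square variable: fourth moment 3 and second moment 1 leave
  3 - 2 + 1 = 2 per coordinate. It feeds the Chebyshev estimate of the atypical mass.\<close>

lemma gprod_sq_dev:
  assumes "s > 0"
  shows "has_bochner_integral (gprod n m s) (\<lambda>x. ((\<Sum>t<n. ((x t - m t) / s)\<^sup>2) - real n)\<^sup>2) (2 * real n)"
proof -
  note f4 = gaussian_moment_even[OF assms, of _ 2]
  have f2: "has_bochner_integral (gaussian m s) (\<lambda>y. ((y - m) / s)\<^sup>2) 1" for m
    using gaussian_moment_even[OF assms, of m 1] by simp
  have f0: "has_bochner_integral (gaussian m s) (\<lambda>y. 1 :: real) 1" for m
    using gaussian_moment_even[OF assms, of m 0] by simp
  have "has_bochner_integral (gprod n m s) (\<lambda>x. (\<Sum>t<n. ((x t - m t) / s)\<^sup>2 - 1)\<^sup>2) (\<Sum>t<n. 2)"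
    unfolding gprod_def
  proof (intro has_bochner_integral_PiM_square_sum[where f="\<lambda>t y. ((y - m t) / s)\<^sup>2 - 1"])
    fix t
    show "has_bochner_integral (gaussian (m t) s) (\<lambda>y. ((y - m t) / s)\<^sup>2 - 1) 0"
      using has_bochner_integral_diff[OF f2 f0] by simp
    have "has_bochner_integral (gaussian (m t) s)
       (\<lambda>y. ((y - m t) / s) ^ 4 - 2 * ((y - m t) / s)\<^sup>2 + 1) (3 - 2 * 1 + 1)"
      using f4 by (intro has_bochner_integral_add has_bochner_integral_diff has_bochner_integral_mult_right f2 f0)
         (simp_all add: fact_numeral)
    also have "(\<lambda>y. ((y - m t) / s) ^ 4 - 2 * ((y - m t) / s)\<^sup>2 + 1) = (\<lambda>y. (((y - m t) / s)\<^sup>2 - 1)\<^sup>2)"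
      by (simp add: power2_diff fun_eq_iff flip: power_mult)
    finally show "has_bochner_integral (gaussian (m t) s) (\<lambda>y. (((y - m t) / s)\<^sup>2 - 1)\<^sup>2) 2"
      by simp
  qed (auto intro: prob_space_gaussian assms)
  then show ?thesis by (simp add: sum_subtractf mult.commute)
qed

lemma gprod_mean:
  assumes "s > 0" "t < n"
  shows "has_bochner_integral (gprod n m s) (\<lambda>x. (x t - m t) / s) 0"
  unfolding gprod_def
  using has_bochner_integral_PiM_component[of "{..<n}" t "\<lambda>t. gaussian (m t) s" "\<lambda>y. (y - m t) / s" 0]
    gaussian_mean[OF assms(1)] assms by (auto simp: prob_space_gaussian)

section \<open>Likelihood ratios of product Gaussians\<close>

definition gratio :: "nat \<Rightarrow> (nat \<Rightarrow> real) \<Rightarrow> real \<Rightarrow> real \<Rightarrow> real \<Rightarrow> (nat \<Rightarrow> real) \<Rightarrow> real" where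
  "gratio n m' s' m s x = (\<Prod>t<n. normal_density (m' t) s' (x t) / normal_density m s (x t))"

lemma measurable_gratio [measurable]: "gratio n m' s' m s \<in> borel_measurable (seq_space n)"
  unfolding gratio_def by measurable

lemma gratio_pos: "s > 0 \<Longrightarrow> s' > 0 \<Longrightarrow> 0 < gratio n m' s' m s x"
  unfolding gratio_def by (intro prod_pos) (auto simp: normal_density_pos)

text \<open>Finite products are determined by boxes, and on a box the integral of the ratio
  factorises into one-dimensional changes of density.\<close>

lemma density_gratio:
  assumes "s > 0" "s' > 0"
  shows "density (gprod n (\<lambda>_. m) s) (gratio n m' s' m s) = gprod n m' s'"
  unfolding gprod_def
proof (rule product_sigma_finite.PiM_eqI)
  interpret P: product_prob_space "\<lambda>t::nat. gaussian m s" "{..<n}"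
    by (intro product_prob_spaceI prob_space_gaussian assms)
  show "product_sigma_finite (\<lambda>t. gaussian (m' t) s')"
    using assms by (intro product_sigma_finite.intro prob_space_imp_sigma_finite prob_space_gaussian)
  show "sets (density (Pi\<^sub>M {..<n} (\<lambda>t. gaussian m s)) (\<lambda>x. ennreal (gratio n m' s' m s x)))
     = sets (Pi\<^sub>M {..<n} (\<lambda>t. gaussian (m' t) s'))"
    by (simp cong: sets_PiM_cong)
  have [measurable]: "gratio n m' s' m s \<in> borel_measurable (Pi\<^sub>M {..<n} (\<lambda>t. gaussian m s))"
    using measurable_gratio[of n m' s' m s] sets_gprod[of n "\<lambda>_. m" s] unfolding gprod_def
    by (simp cong: measurable_cong_sets)
  fix A :: "nat \<Rightarrow> real set" assume A': "\<And>i. i \<in> {..<n} \<Longrightarrow> A i \<in> sets (gaussian (m' i) s')"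
  then have [measurable]: "i < n \<Longrightarrow> A i \<in> sets borel" for i by auto
  have 1: "density (gaussian m s) (\<lambda>y. ennreal (normal_density (m' t) s' y / normal_density m s y))
      = gaussian (m' t) s'" for t
    unfolding gaussian_def using assms
    by (subst density_density_eq)
       (auto intro!: density_cong AE_I2 simp flip: ennreal_mult'' simp: normal_density_nonneg normal_density_pos less_imp_neq[symmetric] ennreal_mult'[symmetric])
  have "emeasure (density (Pi\<^sub>M {..<n} (\<lambda>t. gaussian m s)) (\<lambda>x. ennreal (gratio n m' s' m s x))) (Pi\<^sub>E {..<n} A)
     = (\<integral>\<^sup>+x. ennreal (gratio n m' s' m s x) * indicator (Pi\<^sub>E {..<n} A) x \<partial>Pi\<^sub>M {..<n} (\<lambda>t. gaussian m s))"
    by (intro emeasure_density) (auto simp: A' intro!: sets_PiM_I_finite)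
  also have "\<dots> = (\<integral>\<^sup>+x. (\<Prod>t<n. ennreal (normal_density (m' t) s' (x t) / normal_density m s (x t)) * indicator (A t) (x t)) \<partial>Pi\<^sub>M {..<n} (\<lambda>t. gaussian m s))"
    unfolding gratio_def
    by (intro nn_integral_cong)
       (auto simp: prod.distrib space_PiM PiE_def Pi_def indicator_def prod_ennreal normal_density_nonneg 
         split: if_splits)
  also have "\<dots> = (\<Prod>t<n. \<integral>\<^sup>+y. ennreal (normal_density (m' t) s' y / normal_density m s y) * indicator (A t) y \<partial>gaussian m s)"
    by (subst P.product_nn_integral_prod[where f="\<lambda>t y. ennreal (normal_density (m' t) s' y / normal_density m s y) * indicator (A t) y"])
       (auto simp: measurable_cong_sets[OF sets_gaussian refl])
  also have "\<dots> = (\<Prod>t<n. emeasure (gaussian (m' t) s') (A t))"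
    
    by (intro prod.cong refl, subst 1[symmetric], subst emeasure_density)
       (auto simp: measurable_cong_sets[OF sets_gaussian refl])
  finally show "emeasure (density (Pi\<^sub>M {..<n} (\<lambda>t. gaussian m s)) (\<lambda>x. ennreal (gratio n m' s' m s x))) (Pi\<^sub>E {..<n} A)
     = (\<Prod>t<n. emeasure (gaussian (m' t) s') (A t))" .
qed simp

lemma nn_integral_gratio:
  assumes "s > 0" "s' > 0" and [measurable]: "f \<in> borel_measurable (seq_space n)"
  shows "(\<integral>\<^sup>+x. ennreal (gratio n m' s' m s x) * f x \<partial>gprod n (\<lambda>_. m) s) = (\<integral>\<^sup>+x. f x \<partial>gprod n m' s')"
  unfolding density_gratio[OF assms(1,2), of n m m', symmetric]
  by (subst nn_integral_density) auto

text \<open>With mean \<open>b\<close> and standard deviation \<open>v\<close> measured in the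
  coordinates in which the reference Gaussian is standard, \<open>s\<close> cancels from the
  prefactor.\<close>

lemma normal_density_ratio:
  assumes "s > 0" "v > 0"
  shows "normal_density (m + s * b) (s * v) x / normal_density m s x
    = 1 / v * exp (((x - m) / s)\<^sup>2 / 2 - ((x - m) / s - b)\<^sup>2 / (2 * v\<^sup>2))"
proof -
  have "- (x - (m + s * b))\<^sup>2 / (2 * (s * v)\<^sup>2) = - (((x - m) / s - b)\<^sup>2 / (2 * v\<^sup>2))"
    using assms by (simp add: field_simps power2_eq_square)
  moreover have "- (x - m)\<^sup>2 / (2 * s\<^sup>2) = - (((x - m) / s)\<^sup>2 / 2)"
    using assms by (simp add: field_simps power2_eq_square)
  moreover have "sqrt (2 * pi * (s * v)\<^sup>2) = v * sqrt (2 * pi * s\<^sup>2)"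
    using assms by (simp add: real_sqrt_mult power_mult_distrib)
  moreover have "exp (((x - m) / s)\<^sup>2 / 2 - ((x - m) / s - b)\<^sup>2 / (2 * v\<^sup>2))
      = exp (- (((x - m) / s - b)\<^sup>2 / (2 * v\<^sup>2))) / exp (- (((x - m) / s)\<^sup>2 / 2))"
    by (simp flip: exp_diff)
  moreover have "sqrt (2 * pi * s\<^sup>2) > 0" using assms by simp
  ultimately show ?thesis
    using assms unfolding normal_density_def by simp
qed

lemma gratio_eq:
  assumes "s > 0" "v > 0"
  shows "gratio n (\<lambda>t. m + s * b t) (s * v) m s x
    = (1 / v) ^ n * exp ((\<Sum>t<n. ((x t - m) / s)\<^sup>2) / 2 - sqdist n m s b x / (2 * v\<^sup>2))"
  unfolding gratio_def normal_density_ratio[OF assms] prod.distrib sqdist_def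
  by (simp add: exp_sum sum_divide_distrib flip: sum_subtractf)

section \<open>Splittings of a Gaussian into finitely many pieces\<close>

text \<open>Pieces are measures and not sets, since encoder and decoder are stochastic. The source
  split by the message under a fixed seed and the output split by message and seed are both
  instances.\<close>

locale gaussian_splitting =
  fixes n :: nat and m s :: real and I :: "'i set" and \<nu> :: "'i \<Rightarrow> (nat \<Rightarrow> real) measure"
  assumes n: "n \<ge> 1" and s: "s > 0" and finI: "finite I"
    and sets_\<nu>: "\<And>i. i \<in> I \<Longrightarrow> sets (\<nu> i) = sets (seq_space n)"
    and split: "\<And>A. A \<in> sets (seq_space n) \<Longrightarrow> (\<Sum>i\<in>I. emeasure (\<nu> i) A) = emeasure (gprod n (\<lambda>_. m) s) A"
begin

abbreviation N :: "(nat \<Rightarrow> real) measure" where "N \<equiv> gprod n (\<lambda>_. m) s"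

sublocale N: prob_space N
  by (rule prob_space_gprod[OF s])

lemma prob_seq_space [simp]: "measure N (space (seq_space n)) = 1"
  using N.prob_space by simp

lemma space_\<nu>: "i \<in> I \<Longrightarrow> space (\<nu> i) = space (seq_space n)"
  by (rule sets_eq_imp_space_eq) (simp add: sets_\<nu>)

lemma measurable_\<nu>: "i \<in> I \<Longrightarrow> measurable (\<nu> i) B = measurable (seq_space n) B"
  by (rule measurable_cong_sets) (auto simp: sets_\<nu>)

lemma nn_integral_split:
  assumes "f \<in> borel_measurable (seq_space n)"
  shows "(\<Sum>i\<in>I. \<integral>\<^sup>+x. f x \<partial>\<nu> i) = (\<integral>\<^sup>+x. f x \<partial>N)"
  using assms
proof (induction rule: borel_measurable_induct)
  case (cong f g)
  have "(\<Sum>i\<in>I. \<integral>\<^sup>+x. f x \<partial>\<nu> i) = (\<Sum>i\<in>I. \<integral>\<^sup>+x. g x \<partial>\<nu> i)"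
    using cong by (intro sum.cong nn_integral_cong) (auto simp: space_\<nu>)
  moreover have "(\<integral>\<^sup>+x. f x \<partial>N) = (\<integral>\<^sup>+x. g x \<partial>N)"
    using cong by (intro nn_integral_cong) auto
  ultimately show ?case using cong by simp
next
  case (set A)
  then show ?case using split[of A] by (simp add: sets_\<nu>)
next
  case (mult u c)
  then show ?case
    by (simp add: nn_integral_cmult measurable_\<nu> sum_distrib_left[symmetric])
next
  case (add u v)
  then show ?case
    by (simp add: nn_integral_add measurable_\<nu> sum.distrib)
next
  case (seq U)
  have "(\<Sum>i\<in>I. \<integral>\<^sup>+x. (SUP j. U j x) \<partial>\<nu> i) = (\<Sum>i\<in>I. SUP j. \<integral>\<^sup>+x. U j x \<partial>\<nu> i)"
    using seq by (intro sum.cong refl nn_integral_monotone_convergence_SUP) (auto simp: measurable_\<nu>)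
  also have "\<dots> = (SUP j. \<Sum>i\<in>I. \<integral>\<^sup>+x. U j x \<partial>\<nu> i)"
    using seq(3)
    by (intro ennreal_SUP_sum[symmetric]) (auto simp: incseq_def le_fun_def intro!: nn_integral_mono)
  also have "\<dots> = (SUP j. \<integral>\<^sup>+x. U j x \<partial>N)"
    using seq by simp
  also have "\<dots> = (\<integral>\<^sup>+x. (SUP j. U j x) \<partial>N)"
    using seq by (intro nn_integral_monotone_convergence_SUP[symmetric]) auto
  finally show ?case by (simp add: image_comp)
qed

lemma nn_integral_\<nu>_le:
  assumes "i \<in> I" "f \<in> borel_measurable (seq_space n)"
  shows "(\<integral>\<^sup>+x. f x \<partial>\<nu> i) \<le> (\<integral>\<^sup>+x. f x \<partial>N)"
  using nn_integral_split[OF assms(2)] member_le_sum[OF assms(1), of "\<lambda>i. \<integral>\<^sup>+x. f x \<partial>\<nu> i"] finI by auto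

lemma integrable_\<nu>:
  fixes f :: "_ \<Rightarrow> real"
  assumes "i \<in> I" "integrable N f"
  shows "integrable (\<nu> i) f"
proof -
  have [measurable]: "f \<in> borel_measurable (seq_space n)" using assms by auto
  have "(\<integral>\<^sup>+x. norm (f x) \<partial>\<nu> i) \<le> (\<integral>\<^sup>+x. norm (f x) \<partial>N)"
    by (rule nn_integral_\<nu>_le[OF assms(1)]) measurable
  also have "\<dots> < \<infinity>" using assms(2) by (simp add: integrable_iff_bounded)
  finally show ?thesis by (simp add: integrable_iff_bounded measurable_\<nu> assms)
qed

lemma integral_split:
  fixes f :: "_ \<Rightarrow> real"
  assumes f: "integrable N f"
  shows "(\<Sum>i\<in>I. \<integral>x. f x \<partial>\<nu> i) = (\<integral>x. f x \<partial>N)"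
proof -
  have [measurable]: "f \<in> borel_measurable (seq_space n)" using f by auto
  have *: "(\<Sum>i\<in>I. \<integral>x. g x \<partial>\<nu> i) = (\<integral>x. g x \<partial>N)" if g: "integrable N g" "\<And>x. 0 \<le> g x" for g :: "_ \<Rightarrow> real"
  proof -
    have [measurable]: "g \<in> borel_measurable (seq_space n)" using g by auto
    have "ennreal (\<Sum>i\<in>I. \<integral>x. g x \<partial>\<nu> i) = (\<Sum>i\<in>I. ennreal (\<integral>x. g x \<partial>\<nu> i))"
      using g by (simp add: sum_ennreal)
    also have "\<dots> = (\<Sum>i\<in>I. \<integral>\<^sup>+x. g x \<partial>\<nu> i)"
      using g by (intro sum.cong refl nn_integral_eq_integral[symmetric] integrable_\<nu>) auto
    also have "\<dots> = (\<integral>\<^sup>+x. g x \<partial>N)" by (rule nn_integral_split) measurable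
    also have "\<dots> = ennreal (\<integral>x. g x \<partial>N)" using g by (intro nn_integral_eq_integral) auto
    finally show ?thesis using g by (simp add: sum_nonneg)
  qed
  have p: "integrable N (\<lambda>x. max 0 (f x))" "integrable N (\<lambda>x. max 0 (- f x))"
    using f by auto
  have "(\<Sum>i\<in>I. \<integral>x. f x \<partial>\<nu> i) = (\<Sum>i\<in>I. (\<integral>x. max 0 (f x) \<partial>\<nu> i) - (\<integral>x. max 0 (- f x) \<partial>\<nu> i))"
    using p by (intro sum.cong refl) 
      (auto simp flip: Bochner_Integration.integral_diff simp: integrable_\<nu> intro!: Bochner_Integration.integral_cong)
  also have "\<dots> = (\<integral>x. max 0 (f x) \<partial>N) - (\<integral>x. max 0 (- f x) \<partial>N)"
    using p by (simp add: sum_subtractf *)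
  also have "\<dots> = (\<integral>x. f x \<partial>N)"
    using p by (auto simp flip: Bochner_Integration.integral_diff intro!: Bochner_Integration.integral_cong)
  finally show ?thesis .
qed

section \<open>Masses, centroids and energies of the pieces\<close>

definition mass :: "'i \<Rightarrow> real" where "mass i = (\<integral>x. 1 \<partial>\<nu> i)"
definition moment :: "'i \<Rightarrow> nat \<Rightarrow> real" where "moment i t = (\<integral>x. (x t - m) / s \<partial>\<nu> i)"
definition energy :: "'i \<Rightarrow> real" where "energy i = (\<integral>x. (\<Sum>t<n. ((x t - m) / s)\<^sup>2) \<partial>\<nu> i)"
definition centroid :: "'i \<Rightarrow> nat \<Rightarrow> real" where "centroid i t = moment i t / mass i"

lemma integrable_N:
  "t < n \<Longrightarrow> integrable N (\<lambda>x. (x t - m) / s)"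
  "integrable N (\<lambda>x. \<Sum>t<n. ((x t - m) / s)\<^sup>2)"
  "integrable N (\<lambda>x. 1 :: real)"
  using gprod_mean[OF s, of t n "\<lambda>_. m"] gprod_sq[OF s, of n "\<lambda>_. m"]
  by (auto simp: has_bochner_integral_iff)

lemma mass_nonneg [simp]: "0 \<le> mass i"
  by (simp add: mass_def)

lemma sum_mass: "(\<Sum>i\<in>I. mass i) = 1"
  unfolding mass_def using integral_split[OF integrable_N(3)] using N.prob_space by simp

lemma sum_moment: "t < n \<Longrightarrow> (\<Sum>i\<in>I. moment i t) = 0"
  unfolding moment_def using integral_split[OF integrable_N(1)] gprod_mean[OF s, of t n "\<lambda>_. m"]
  by (simp add: has_bochner_integral_iff)

lemma sum_energy: "(\<Sum>i\<in>I. energy i) = real n"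
  unfolding energy_def using integral_split[OF integrable_N(2)] gprod_sq[OF s, of n "\<lambda>_. m"]
  by (simp add: has_bochner_integral_iff)

lemma mass_eq_0D:
  assumes "i \<in> I" "mass i = 0"
  shows "\<nu> i = null_measure (seq_space n)"
proof (rule measure_eqI)
  have "emeasure (\<nu> i) (space (\<nu> i)) = ennreal (mass i)"
    using integrable_\<nu>[OF assms(1) integrable_N(3)] nn_integral_eq_integral[of "\<nu> i" "\<lambda>_. 1"]
    by (simp add: mass_def)
  then have "emeasure (\<nu> i) (space (\<nu> i)) = 0" using assms by simp
  then show "emeasure (\<nu> i) A = emeasure (null_measure (seq_space n)) A" if "A \<in> sets (\<nu> i)" for A
    using emeasure_space[of "\<nu> i" A] by auto
qed (auto simp: sets_\<nu> assms)

text \<open>A piece of mass 0 is the null measure, so its moment vanishes too, and the centroid is 0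
  there by the convention for division.\<close>

lemma mass_centroid:
  assumes "i \<in> I"
  shows "mass i * centroid i t = moment i t"
  using mass_eq_0D[OF assms] by (cases "mass i = 0") (auto simp: centroid_def moment_def)

lemma has_bochner_integral_\<nu>:
  assumes "i \<in> I"
  shows "has_bochner_integral (\<nu> i) (\<lambda>x. \<Sum>t<n. ((x t - m) / s)\<^sup>2) (energy i)"
    and "has_bochner_integral (\<nu> i) (\<lambda>x. 1) (mass i)"
    and "t < n \<Longrightarrow> has_bochner_integral (\<nu> i) (\<lambda>x. (x t - m) / s) (moment i t)"
  using integrable_\<nu>[OF assms integrable_N(1)] integrable_\<nu>[OF assms integrable_N(2)]
    integrable_\<nu>[OF assms integrable_N(3)]
  unfolding has_bochner_integral_iff energy_def mass_def moment_def by blast+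

lemma integral_sqdist:
  assumes "i \<in> I"
  shows "integrable (\<nu> i) (sqdist n m s b)"
    and "(\<integral>x. sqdist n m s b x \<partial>\<nu> i) = energy i - 2 * (\<Sum>t<n. b t * moment i t) + mass i * (\<Sum>t<n. (b t)\<^sup>2)"
proof -
  have eq: "sqdist n m s b = (\<lambda>x. (\<Sum>t<n. ((x t - m) / s)\<^sup>2) - 2 * (\<Sum>t<n. b t * ((x t - m) / s)) + (\<Sum>t<n. (b t)\<^sup>2) * 1)"
    by (simp add: fun_eq_iff sqdist_def power2_diff sum.distrib sum_subtractf sum_distrib_left mult_ac)
  have "has_bochner_integral (\<nu> i) (sqdist n m s b)
     (energy i - 2 * (\<Sum>t<n. b t * moment i t) + (\<Sum>t<n. (b t)\<^sup>2) * mass i)"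
    unfolding eq by (intro has_bochner_integral_add has_bochner_integral_diff
      has_bochner_integral_mult_right has_bochner_integral_sum has_bochner_integral_\<nu> assms) auto
  then show "integrable (\<nu> i) (sqdist n m s b)"
    and "(\<integral>x. sqdist n m s b x \<partial>\<nu> i) = energy i - 2 * (\<Sum>t<n. b t * moment i t) + mass i * (\<Sum>t<n. (b t)\<^sup>2)"
    by (auto simp: has_bochner_integral_iff)
qed

text \<open>This is Steiner's parallel axis identity. With the centroids as reference points it
  turns a lower bound on cost into an upper bound on centroids; with scaled codewords it measures
  how far the centroids are from them.\<close>

lemma sum_integral_sqdist:
  "(\<Sum>i\<in>I. \<integral>x. sqdist n m s (b i) x \<partial>\<nu> i)
    = real n - (\<Sum>i\<in>I. mass i * (\<Sum>t<n. (centroid i t)\<^sup>2))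
      + (\<Sum>i\<in>I. mass i * (\<Sum>t<n. (centroid i t - b i t)\<^sup>2))"
proof -
  have "(\<integral>x. sqdist n m s (b i) x \<partial>\<nu> i) = energy i - mass i * (\<Sum>t<n. (centroid i t)\<^sup>2)
      + mass i * (\<Sum>t<n. (centroid i t - b i t)\<^sup>2)" if "i \<in> I" for i
    by (simp add: integral_sqdist(2)[OF that] power2_diff sum.distrib sum_subtractf sum_distrib_left algebra_simps
         flip: mass_centroid[OF that])
  then show ?thesis by (simp add: sum.distrib sum_subtractf sum_energy)
qed

text \<open>Jensen's inequality in the pointwise form 1 + l <= exp l, where exp l is
  the density ratio of N(b i, v) to N, divided by the number of pieces; the
  variance v is chosen such that the constants cancel.\<close>

lemma sum_integral_sqdist_ge:
  "real n * real (card I) powr (- 2 / real n) \<le> (\<Sum>i\<in>I. \<integral>x. sqdist n m s (b i) x \<partial>\<nu> i)"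
proof -
  define q where "q = real (card I)"
  have "I \<noteq> {}" using sum_mass by auto
  then have q: "q > 0" using finI by (auto simp: q_def card_gt_0_iff)
  define v where "v = q powr (- 1 / real n)"
  have v: "v > 0" using q by (simp add: v_def)
  have v2: "v\<^sup>2 = q powr (- 2 / real n)"
    using q by (simp add: v_def powr_powr flip: powr_realpow)
  have vn: "(1 / v) ^ n = q"
    using q n by (simp add: v_def powr_minus_divide powr_powr flip: powr_realpow powr_minus)
  let ?G = "\<lambda>i. gratio n (\<lambda>t. m + s * b i t) (s * v) m s"
  let ?E = "\<lambda>x. \<Sum>t<n. ((x t - m) / s)\<^sup>2"
  have pw: "?E x / 2 + 1 \<le> 1 / q * ?G i x + sqdist n m s (b i) x / (2 * v\<^sup>2)" for i x
    using exp_ge_add_one_self[of "?E x / 2 - sqdist n m s (b i) x / (2 * v\<^sup>2)"] q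
    unfolding gratio_eq[OF s v] vn by (simp add: algebra_simps del: exp_ge_add_one_self)
  have sv: "s * v > 0" using s v by simp
  have G: "(\<integral>\<^sup>+x. ennreal (?G i x) \<partial>N) = 1" for i
    using nn_integral_gratio[OF s sv, where f = "\<lambda>_. 1" and n = n and m' = "\<lambda>t. m + s * b i t" and m = m]
      prob_space.emeasure_space_1[OF prob_space_gprod[OF sv]] by simp
  have "ennreal (real n / 2 + 1) = (\<integral>\<^sup>+x. ennreal (?E x / 2 + 1) \<partial>N)"
    using gprod_sq[OF s, of n "\<lambda>_. m"]
    by (subst nn_integral_eq_integral) (auto simp: has_bochner_integral_iff N.prob_space sum_nonneg intro!: AE_I2 add_nonneg_nonneg)
  also have "\<dots> = (\<Sum>i\<in>I. \<integral>\<^sup>+x. ennreal (?E x / 2 + 1) \<partial>\<nu> i)"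
    by (rule nn_integral_split[symmetric]) measurable
  also have "\<dots> \<le> (\<Sum>i\<in>I. \<integral>\<^sup>+x. ennreal (1 / q) * ennreal (?G i x) + ennreal (sqdist n m s (b i) x / (2 * v\<^sup>2)) \<partial>\<nu> i)"
    using pw q v gratio_pos[OF s sv]
    by (intro sum_mono nn_integral_mono)
       (auto simp: less_imp_le simp flip: ennreal_plus ennreal_mult intro!: ennreal_leI)
  also have "\<dots> = (\<Sum>i\<in>I. ennreal (1 / q) * (\<integral>\<^sup>+x. ennreal (?G i x) \<partial>\<nu> i) + (\<integral>\<^sup>+x. ennreal (sqdist n m s (b i) x / (2 * v\<^sup>2)) \<partial>\<nu> i))"
    by (intro sum.cong refl, subst nn_integral_add) (auto simp: measurable_\<nu> nn_integral_cmult)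
  \<comment> \<open>Every piece is dominated by \<open>N\<close>, under which the ratio integrates
    to 1. The q terms 1/q then add up to 1 and cancel the 1 on the left.\<close>
  also have "\<dots> \<le> (\<Sum>i\<in>I. ennreal (1 / q) * 1 + (\<integral>\<^sup>+x. ennreal (sqdist n m s (b i) x / (2 * v\<^sup>2)) \<partial>\<nu> i))"
    using nn_integral_\<nu>_le[of _ "\<lambda>x. ennreal (?G _ x)"] G
    by (intro sum_mono add_right_mono mult_left_mono) (metis measurable_gratio measurable_compose measurable_ennreal, simp)
  also have "\<dots> = (\<Sum>i\<in>I. ennreal (1 / q) + ennreal ((\<integral>x. sqdist n m s (b i) x \<partial>\<nu> i) / (2 * v\<^sup>2)))"
    by (intro sum.cong refl, subst nn_integral_eq_integral) (auto simp: integral_sqdist)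
  also have "\<dots> = ennreal (\<Sum>i\<in>I. 1 / q + (\<integral>x. sqdist n m s (b i) x \<partial>\<nu> i) / (2 * v\<^sup>2))"
    using q by (subst sum_ennreal[symmetric]) (auto simp: ennreal_plus[symmetric] simp del: ennreal_plus)
  finally have "real n / 2 + 1 \<le> (\<Sum>i\<in>I. 1 / q + (\<integral>x. sqdist n m s (b i) x \<partial>\<nu> i) / (2 * v\<^sup>2))"
    using q by (subst (asm) ennreal_le_iff) (auto intro!: sum_nonneg)
  also have "\<dots> = 1 + (\<Sum>i\<in>I. \<integral>x. sqdist n m s (b i) x \<partial>\<nu> i) / (2 * v\<^sup>2)"
    using q by (simp add: sum.distrib sum_divide_distrib q_def)
  finally have "real n * v\<^sup>2 \<le> (\<Sum>i\<in>I. \<integral>x. sqdist n m s (b i) x \<partial>\<nu> i)"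
    using v by (simp add: field_simps)
  then show ?thesis unfolding v2 q_def .
qed

text \<open>For \<open>b = centroid\<close> the deviation term of the parallel axis identity is
  zero.\<close>

lemma sum_centroid_le:
  "(\<Sum>i\<in>I. mass i * (\<Sum>t<n. (centroid i t)\<^sup>2)) \<le> real n * (1 - real (card I) powr (- 2 / real n))"
  using sum_integral_sqdist_ge[of centroid] sum_integral_sqdist[of centroid] by (simp add: algebra_simps)

end

section \<open>Codes with Gaussian source and output\<close>

locale gaussian_code =
  fixes n M L :: nat and enc :: "nat \<Rightarrow> (nat \<Rightarrow> real) \<Rightarrow> nat \<Rightarrow> real"
    and dec :: "nat \<Rightarrow> nat \<Rightarrow> (nat \<Rightarrow> real) measure" and \<mu>X \<sigma>X \<mu>Y \<sigma>Y :: real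
  assumes valid: "valid_code n M L enc dec" and \<sigma>X: "\<sigma>X > 0" and \<sigma>Y: "\<sigma>Y > 0"
    and output_law: "\<And>A. A \<in> sets (seq_space n) \<Longrightarrow>
      code_output (gaussian \<mu>X \<sigma>X) n M L enc dec A = emeasure (iid n (gaussian \<mu>Y \<sigma>Y)) A"
begin

lemma nML: "n \<ge> 1" "M \<ge> 1" "L \<ge> 1"
  using valid by (auto simp: valid_code_def)

lemma measurable_enc [measurable]: "k < L \<Longrightarrow> j < M \<Longrightarrow> (\<lambda>x. enc k x j) \<in> borel_measurable (seq_space n)"
  using valid by (auto simp: valid_code_def)

lemma enc_nonneg: "k < L \<Longrightarrow> j < M \<Longrightarrow> enc k x j \<ge> 0"
  using valid by (auto simp: valid_code_def)

lemma enc_sum: "k < L \<Longrightarrow> (\<Sum>j<M. enc k x j) = 1"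
  using valid by (auto simp: valid_code_def)

lemma prob_space_dec: "k < L \<Longrightarrow> j < M \<Longrightarrow> prob_space (dec j k)"
  using valid by (auto simp: valid_code_def)

lemma sets_dec: "k < L \<Longrightarrow> j < M \<Longrightarrow> sets (dec j k) = sets (seq_space n)"
  using valid by (auto simp: valid_code_def)

abbreviation NX :: "(nat \<Rightarrow> real) measure" where "NX \<equiv> gprod n (\<lambda>_. \<mu>X) \<sigma>X"

definition \<nu>X :: "nat \<Rightarrow> nat \<Rightarrow> (nat \<Rightarrow> real) measure" where
  "\<nu>X k j = density NX (\<lambda>x. ennreal (enc k x j))"

lemma splitting_X:
  assumes k: "k < L"
  shows "gaussian_splitting n \<mu>X \<sigma>X {..<M} (\<nu>X k)"
proof
  fix A assume [measurable]: "A \<in> sets (seq_space n)"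
  have "(\<Sum>j<M. emeasure (\<nu>X k j) A) = (\<Sum>j<M. \<integral>\<^sup>+x. ennreal (enc k x j) * indicator A x \<partial>NX)"
    using k by (intro sum.cong refl) (simp add: \<nu>X_def emeasure_density)
  also have "\<dots> = (\<integral>\<^sup>+x. (\<Sum>j<M. ennreal (enc k x j) * indicator A x) \<partial>NX)"
    using k by (intro nn_integral_sum[symmetric]) auto
  also have "\<dots> = (\<integral>\<^sup>+x. indicator A x \<partial>NX)"
  proof (intro nn_integral_cong)
    fix x
    have "(\<Sum>j<M. ennreal (enc k x j)) = 1"
      using k by (subst sum_ennreal) (auto simp: enc_nonneg enc_sum)
    then show "(\<Sum>j<M. ennreal (enc k x j) * indicator A x) = indicator A x"
      by (simp flip: sum_distrib_right)
  qed
  finally show "(\<Sum>j<M. emeasure (\<nu>X k j) A) = emeasure NX A" by simp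
qed (use nML in \<open>auto simp: \<sigma>X \<nu>X_def\<close>)

abbreviation "wX k \<equiv> gaussian_splitting.mass (\<nu>X k)"
abbreviation "aX k \<equiv> gaussian_splitting.centroid \<mu>X \<sigma>X (\<nu>X k)"

text \<open>The joint probability of seed \<open>k\<close> and message \<open>j\<close>. It also
  weights the decoder's law in \<nu>Y, so that a piece of the source and the matching piece of the
  output can be compared.\<close>

definition p :: "nat \<Rightarrow> nat \<Rightarrow> real" where "p k j = wX k j / real L"

lemma wX_eq: "k < L \<Longrightarrow> j < M \<Longrightarrow> (\<integral>\<^sup>+x. ennreal (enc k x j) \<partial>NX) = ennreal (wX k j)"
proof -
  assume k: "k < L" and j: "j < M"
  interpret X: gaussian_splitting n \<mu>X \<sigma>X "{..<M}" "\<nu>X k" by (rule splitting_X[OF k])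
  have "(\<integral>\<^sup>+x. ennreal 1 \<partial>\<nu>X k j) = ennreal (X.mass j)"
    using X.has_bochner_integral_\<nu>(2)[of j] j
    by (subst nn_integral_eq_integral) (auto simp: has_bochner_integral_iff)
  also have "(\<integral>\<^sup>+x. ennreal 1 \<partial>\<nu>X k j) = (\<integral>\<^sup>+x. ennreal (enc k x j) * 1 \<partial>NX)"
    using k j unfolding \<nu>X_def by (subst nn_integral_density) auto
  finally show ?thesis by simp
qed

lemma p_nonneg: "k < L \<Longrightarrow> 0 \<le> p k j"
  using gaussian_splitting.mass_nonneg[OF splitting_X] by (simp add: p_def)

definition \<nu>Y :: "nat \<times> nat \<Rightarrow> (nat \<Rightarrow> real) measure" where
  "\<nu>Y = (\<lambda>(k, j). density (dec j k) (\<lambda>_. ennreal (p k j)))"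

text \<open>The output constraint enters the converse here: exactness of the law is what makes the
  weighted decoder laws add up to a Gaussian.\<close>

lemma splitting_Y: "gaussian_splitting n \<mu>Y \<sigma>Y ({..<L} \<times> {..<M}) \<nu>Y"
proof
  fix A assume [measurable]: "A \<in> sets (seq_space n)"
  have "(\<Sum>i\<in>{..<L} \<times> {..<M}. emeasure (\<nu>Y i) A) = (\<Sum>k<L. \<Sum>j<M. ennreal (p k j) * emeasure (dec j k) A)"
    unfolding sum.cartesian_product \<nu>Y_def
    by (intro sum.cong refl) (auto simp: sets_dec emeasure_density nn_integral_cmult_indicator)
  also have "\<dots> = code_output (gaussian \<mu>X \<sigma>X) n M L enc dec A"
    unfolding code_output_def p_def iid_gaussian
    by (intro sum.cong refl) (simp add: wX_eq flip: ennreal_mult'' ennreal_mult')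
  finally show "(\<Sum>i\<in>{..<L} \<times> {..<M}. emeasure (\<nu>Y i) A) = emeasure (gprod n (\<lambda>_. \<mu>Y) \<sigma>Y) A"
    by (simp add: output_law iid_gaussian)
qed (use nML in \<open>auto simp: \<sigma>Y \<nu>Y_def sets_dec\<close>)

sublocale Y: gaussian_splitting n \<mu>Y \<sigma>Y "{..<L} \<times> {..<M}" \<nu>Y
  by (rule splitting_Y)

lemma mass_Y: "k < L \<Longrightarrow> j < M \<Longrightarrow> Y.mass (k, j) = p k j"
proof -
  assume "k < L" "j < M"
  moreover have "Y.mass (k, j) = (\<integral>x. 1 \<partial>density (dec j k) (\<lambda>_. ennreal (p k j)))"
    unfolding Y.mass_def unfolding \<nu>Y_def by simp
  moreover have "(\<integral>x. (1 :: real) \<partial>density (dec j k) (\<lambda>_. ennreal (p k j))) = (\<integral>x. p k j *\<^sub>R 1 \<partial>dec j k)"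
    using p_nonneg[of k j] calculation by (subst integral_density[of _ _ "\<lambda>_. p k j"]) auto
  ultimately show ?thesis
    using prob_space.prob_space[OF prob_space_dec, of k j] by simp
qed

section \<open>Distortion through the correlation of the centroids\<close>

definition corr :: real where
  "corr = (\<Sum>k<L. \<Sum>j<M. p k j * (\<Sum>t<n. aX k j t * Y.centroid (k, j) t))"

lemma sum_p: "(\<Sum>k<L. \<Sum>j<M. p k j) = 1"
  using Y.sum_mass by (simp add: mass_Y sum.cartesian_product')

text \<open>The contribution of one pair of seed and message to the total distortion. It is kept in
  unnormalised moments and energies, whose sums over all pairs are known from the
  splittings.\<close>

definition summand :: "nat \<Rightarrow> nat \<Rightarrow> real" where
  "summand k j = p k j * real n * (\<mu>X - \<mu>Y)\<^sup>2
     + \<sigma>X\<^sup>2 * (gaussian_splitting.energy n \<mu>X \<sigma>X (\<nu>X k) j / real L) + \<sigma>Y\<^sup>2 * Y.energy (k, j)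
     + 2 * (\<mu>X - \<mu>Y) * \<sigma>X * (\<Sum>t<n. gaussian_splitting.moment \<mu>X \<sigma>X (\<nu>X k) j t / real L)
     - 2 * (\<mu>X - \<mu>Y) * \<sigma>Y * (\<Sum>t<n. Y.moment (k, j) t)
     - 2 * \<sigma>X * \<sigma>Y * (p k j * (\<Sum>t<n. aX k j t * Y.centroid (k, j) t))"

text \<open>Given seed and message, source and output are independent. The inner integral thus sees
  the output only through its mean \<open>b\<close> and energy \<open>e\<close>, and leaves a
  quadratic function \<open>A\<close> of the source, which is then integrated over the piece
  \<nu>X.\<close>

lemma distortion_summand:
  assumes k: "k < L" and j: "j < M"
  shows "0 \<le> summand k j"
    and "ennreal (1 / real L) * (\<integral>\<^sup>+ x. ennreal (enc k x j) *
            (\<integral>\<^sup>+ y. ennreal (\<Sum>t<n. (x t - y t)\<^sup>2) \<partial>(dec j k)) \<partial>NX) = ennreal (summand k j)"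
proof -
  interpret X: gaussian_splitting n \<mu>X \<sigma>X "{..<M}" "\<nu>X k" by (rule splitting_X[OF k])
  have L: "real L > 0" using nML by simp
  have "0 \<le> summand k j \<and> ennreal (1 / real L) * (\<integral>\<^sup>+ x. ennreal (enc k x j) *
            (\<integral>\<^sup>+ y. ennreal (\<Sum>t<n. (x t - y t)\<^sup>2) \<partial>(dec j k)) \<partial>NX) = ennreal (summand k j)"
  proof (cases "X.mass j = 0")
    case True
    have p0: "p k j = 0" using True by (simp add: p_def)
    have nX: "\<nu>X k j = null_measure (seq_space n)" using True j by (intro X.mass_eq_0D) auto
    have nY: "\<nu>Y (k, j) = null_measure (seq_space n)"
      using k j p0 by (intro Y.mass_eq_0D) (auto simp: mass_Y)
    have s0: "summand k j = 0"
      unfolding summand_def X.energy_def X.moment_def Y.energy_def Y.moment_def nX nY p0 by simp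
    \<comment> \<open>For a message that is never sent, the decoder may have infinite second moment.
      The inner integral can then be infinite, and the product vanishes only because 0 times
      infinity is 0 in \<open>ennreal\<close>.\<close>
    have "AE x in NX. ennreal (enc k x j) = 0"
      using wX_eq[OF k j] True k j by (subst nn_integral_0_iff_AE[symmetric]) auto
    then have "(\<integral>\<^sup>+ x. ennreal (enc k x j) *
            (\<integral>\<^sup>+ y. ennreal (\<Sum>t<n. (x t - y t)\<^sup>2) \<partial>(dec j k)) \<partial>NX) = (\<integral>\<^sup>+ x. 0 \<partial>NX)"
      by (intro nn_integral_cong_AE) auto
    then show ?thesis using s0 by simp
  next
    case False
    then have w: "X.mass j > 0" using X.mass_nonneg[of j] by linarith
    then have p: "p k j > 0" using L by (simp add: p_def)
    define b where "b = Y.centroid (k, j)"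
    define e where "e = Y.energy (k, j) / p k j"
    interpret D: prob_space "dec j k" by (rule prob_space_dec[OF k j])
    \<comment> \<open>Nothing is assumed about the moments of the decoder; they exist because
      \<open>p k j\<close> times its law is a piece of the Gaussian output law.\<close>
    have D: "has_bochner_integral (dec j k) f (v / p k j)"
      if f: "has_bochner_integral (\<nu>Y (k, j)) f v" for f :: "_ \<Rightarrow> real" and v
    proof -
      have [measurable]: "f \<in> borel_measurable (dec j k)"
        using f by (auto simp: \<nu>Y_def dest!: borel_measurable_has_bochner_integral)
      show ?thesis
        using f p unfolding has_bochner_integral_iff \<nu>Y_def
        by (auto simp: integrable_density integral_density)
    qed
    have Dm: "has_bochner_integral (dec j k) (\<lambda>y. (y t - \<mu>Y) / \<sigma>Y) (b t)" if "t < n" for t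
      using D[OF Y.has_bochner_integral_\<nu>(3)[of "(k, j)" t]] that k j by (simp add: b_def Y.centroid_def mass_Y)
    have De: "has_bochner_integral (dec j k) (\<lambda>y. \<Sum>t<n. ((y t - \<mu>Y) / \<sigma>Y)\<^sup>2) e"
      using D[OF Y.has_bochner_integral_\<nu>(1)[of "(k, j)"]] k j by (simp add: e_def)
    \<comment> \<open>\<open>c t x\<close> is \<open>x t - \<mu>Y\<close>, written through the
      standardised source coordinate.\<close>
    define c where "c t x = (\<mu>X - \<mu>Y) + \<sigma>X * ((x t - \<mu>X) / \<sigma>X)" for t and x :: "nat \<Rightarrow> real"
    define A where "A x = (\<Sum>t<n. (c t x)\<^sup>2) - 2 * \<sigma>Y * (\<Sum>t<n. c t x * b t) + \<sigma>Y\<^sup>2 * e" for x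
    have inner: "has_bochner_integral (dec j k) (\<lambda>y. \<Sum>t<n. (x t - y t)\<^sup>2) (A x)" for x
    proof -
      have "(\<lambda>y. \<Sum>t<n. (x t - y t)\<^sup>2) = (\<lambda>y. (\<Sum>t<n. (c t x)\<^sup>2)
           - 2 * \<sigma>Y * (\<Sum>t<n. c t x * ((y t - \<mu>Y) / \<sigma>Y)) + \<sigma>Y\<^sup>2 * (\<Sum>t<n. ((y t - \<mu>Y) / \<sigma>Y)\<^sup>2))"
      proof
        fix y
        have "x t - y t = c t x - \<sigma>Y * ((y t - \<mu>Y) / \<sigma>Y)" for t
          using \<sigma>X \<sigma>Y by (simp add: c_def)
        then show "(\<Sum>t<n. (x t - y t)\<^sup>2) = (\<Sum>t<n. (c t x)\<^sup>2)
           - 2 * \<sigma>Y * (\<Sum>t<n. c t x * ((y t - \<mu>Y) / \<sigma>Y)) + \<sigma>Y\<^sup>2 * (\<Sum>t<n. ((y t - \<mu>Y) / \<sigma>Y)\<^sup>2)"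
          by (simp only: power2_diff sum.distrib sum_subtractf sum_distrib_left power_mult_distrib mult.assoc mult.left_commute)
      qed
      moreover have hc: "has_bochner_integral (dec j k) (\<lambda>_. r) r" for r :: real
        using D.prob_space by (simp add: has_bochner_integral_iff)
      ultimately show ?thesis
        unfolding A_def
        by (simp only:) (intro has_bochner_integral_add has_bochner_integral_diff has_bochner_integral_mult_right
            has_bochner_integral_sum Dm De, simp_all add: hc)
    qed
    have A0: "0 \<le> A x" for x
    proof -
      have "0 \<le> (\<integral>y. (\<Sum>t<n. (x t - y t)\<^sup>2) \<partial>dec j k)"
        by (intro Bochner_Integration.integral_nonneg sum_nonneg) auto
      then show ?thesis using inner[of x] by (simp add: has_bochner_integral_iff)
    qed
    have nn: "(\<integral>\<^sup>+ y. ennreal (\<Sum>t<n. (x t - y t)\<^sup>2) \<partial>(dec j k)) = ennreal (A x)" for x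
      using inner[of x] by (subst nn_integral_eq_integral) (auto simp: has_bochner_integral_iff sum_nonneg)
    have jM: "j \<in> {..<M}" using j by simp
    have Aeq: "A = (\<lambda>x. (real n * (\<mu>X - \<mu>Y)\<^sup>2 - 2 * \<sigma>Y * (\<mu>X - \<mu>Y) * (\<Sum>t<n. b t) + \<sigma>Y\<^sup>2 * e) * 1
         + 2 * (\<mu>X - \<mu>Y) * \<sigma>X * (\<Sum>t<n. (x t - \<mu>X) / \<sigma>X) + \<sigma>X\<^sup>2 * (\<Sum>t<n. ((x t - \<mu>X) / \<sigma>X)\<^sup>2)
         - 2 * \<sigma>X * \<sigma>Y * (\<Sum>t<n. b t * ((x t - \<mu>X) / \<sigma>X)))"
    proof
      fix x :: "nat \<Rightarrow> real"
      define z where "z t = (x t - \<mu>X) / \<sigma>X" for t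
      define d where "d = \<mu>X - \<mu>Y"
      have "A x = (\<Sum>t<n. (d + \<sigma>X * z t)\<^sup>2) - 2 * \<sigma>Y * (\<Sum>t<n. (d + \<sigma>X * z t) * b t) + \<sigma>Y\<^sup>2 * e"
        unfolding A_def c_def z_def d_def ..
      also have "\<dots> = (real n * d\<^sup>2 - 2 * \<sigma>Y * d * (\<Sum>t<n. b t) + \<sigma>Y\<^sup>2 * e) * 1
         + 2 * d * \<sigma>X * (\<Sum>t<n. z t) + \<sigma>X\<^sup>2 * (\<Sum>t<n. (z t)\<^sup>2)
         - 2 * \<sigma>X * \<sigma>Y * (\<Sum>t<n. b t * z t)"
        by (simp add: power2_sum sum.distrib sum_distrib_left power_mult_distrib algebra_simps)
      finally show "A x = (real n * (\<mu>X - \<mu>Y)\<^sup>2 - 2 * \<sigma>Y * (\<mu>X - \<mu>Y) * (\<Sum>t<n. b t) + \<sigma>Y\<^sup>2 * e) * 1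
         + 2 * (\<mu>X - \<mu>Y) * \<sigma>X * (\<Sum>t<n. (x t - \<mu>X) / \<sigma>X) + \<sigma>X\<^sup>2 * (\<Sum>t<n. ((x t - \<mu>X) / \<sigma>X)\<^sup>2)
         - 2 * \<sigma>X * \<sigma>Y * (\<Sum>t<n. b t * ((x t - \<mu>X) / \<sigma>X))"
        unfolding z_def d_def .
    qed
    define V where "V = (real n * (\<mu>X - \<mu>Y)\<^sup>2 - 2 * \<sigma>Y * (\<mu>X - \<mu>Y) * (\<Sum>t<n. b t) + \<sigma>Y\<^sup>2 * e) * X.mass j
         + 2 * (\<mu>X - \<mu>Y) * \<sigma>X * (\<Sum>t<n. X.moment j t) + \<sigma>X\<^sup>2 * X.energy j
         - 2 * \<sigma>X * \<sigma>Y * (\<Sum>t<n. b t * X.moment j t)"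
    have outer: "has_bochner_integral (\<nu>X k j) A V"
      unfolding Aeq V_def
      by (intro has_bochner_integral_add has_bochner_integral_diff has_bochner_integral_mult_right
            has_bochner_integral_sum X.has_bochner_integral_\<nu>[OF jM]) auto
    have V0: "0 \<le> V" using outer A0 by (auto simp: has_bochner_integral_iff dest!: sym[of _ V])
    have [measurable]: "A \<in> borel_measurable (seq_space n)" unfolding A_def c_def by measurable
    have "(\<integral>\<^sup>+ x. ennreal (enc k x j) * (\<integral>\<^sup>+ y. ennreal (\<Sum>t<n. (x t - y t)\<^sup>2) \<partial>(dec j k)) \<partial>NX)
      = (\<integral>\<^sup>+ x. ennreal (A x) \<partial>\<nu>X k j)"
      using k j unfolding nn \<nu>X_def by (subst nn_integral_density) auto
    also have "\<dots> = ennreal V"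
      using outer A0 by (subst nn_integral_eq_integral) (auto simp: has_bochner_integral_iff)
    finally have eq: "ennreal (1 / real L) * (\<integral>\<^sup>+ x. ennreal (enc k x j) *
            (\<integral>\<^sup>+ y. ennreal (\<Sum>t<n. (x t - y t)\<^sup>2) \<partial>(dec j k)) \<partial>NX) = ennreal (V / real L)"
      by (simp flip: ennreal_mult')
    have bm: "(\<Sum>t<n. Y.moment (k, j) t) = p k j * (\<Sum>t<n. b t)"
      using Y.mass_centroid[of "(k, j)"] k j by (simp add: sum_distrib_left b_def mass_Y)
    have am: "(\<Sum>t<n. b t * X.moment j t) = X.mass j * (\<Sum>t<n. X.centroid j t * b t)"
      by (simp add: sum_distrib_left mult_ac flip: X.mass_centroid[OF jM])
    have "Y.energy (k, j) = p k j * e" using p by (simp add: e_def)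
    then have "V / real L = summand k j"
      unfolding V_def summand_def bm am b_def[symmetric] p_def using L
      by (simp add: field_simps sum_divide_distrib[symmetric])
    then show ?thesis using eq V0 L by (auto simp flip: \<open>V / real L = summand k j\<close>)
  qed
  then show "0 \<le> summand k j" and "ennreal (1 / real L) * (\<integral>\<^sup>+ x. ennreal (enc k x j) *
            (\<integral>\<^sup>+ y. ennreal (\<Sum>t<n. (x t - y t)\<^sup>2) \<partial>(dec j k)) \<partial>NX) = ennreal (summand k j)"
    by auto
qed

text \<open>The masses add up to 1, the energies to n and the first moments to 0, whatever the code
  is; the correlation is the only quantity left that depends on it.\<close>

lemma code_distortion_eq:
  "code_distortion (\<lambda>x y. (x - y)\<^sup>2) (gaussian \<mu>X \<sigma>X) n M L enc dec
    = ennreal (real n * ((\<mu>X - \<mu>Y)\<^sup>2 + \<sigma>X\<^sup>2 + \<sigma>Y\<^sup>2) - 2 * \<sigma>X * \<sigma>Y * corr)"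
proof -
  have L: "real L > 0" using nML by simp
  have "code_distortion (\<lambda>x y. (x - y)\<^sup>2) (gaussian \<mu>X \<sigma>X) n M L enc dec = ennreal (\<Sum>k<L. \<Sum>j<M. summand k j)"
    unfolding code_distortion_def iid_gaussian
    by (subst sum_ennreal[symmetric]; (intro sum_nonneg)?; simp add: distortion_summand)
       (intro sum.cong refl, subst sum_ennreal[symmetric], auto simp: distortion_summand)
  also have "(\<Sum>k<L. \<Sum>j<M. summand k j)
    = real n * (\<mu>X - \<mu>Y)\<^sup>2 + \<sigma>X\<^sup>2 * real n + \<sigma>Y\<^sup>2 * real n + 0 - 0 - 2 * \<sigma>X * \<sigma>Y * corr"
  proof -
    have "(\<Sum>k<L. \<Sum>j<M. p k j * real n * (\<mu>X - \<mu>Y)\<^sup>2) = real n * (\<mu>X - \<mu>Y)\<^sup>2"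
      using sum_p by (simp flip: sum_distrib_right)
    moreover have "(\<Sum>k<L. \<Sum>j<M. \<sigma>X\<^sup>2 * (gaussian_splitting.energy n \<mu>X \<sigma>X (\<nu>X k) j / real L)) = \<sigma>X\<^sup>2 * real n"
      using gaussian_splitting.sum_energy[OF splitting_X] L
      by (simp flip: sum_distrib_left sum_divide_distrib)
    moreover have "(\<Sum>k<L. \<Sum>j<M. \<sigma>Y\<^sup>2 * Y.energy (k, j)) = \<sigma>Y\<^sup>2 * real n"
      using Y.sum_energy by (simp add: sum.cartesian_product' flip: sum_distrib_left)
    moreover have "(\<Sum>k<L. \<Sum>j<M. 2 * (\<mu>X - \<mu>Y) * \<sigma>X * (\<Sum>t<n. gaussian_splitting.moment \<mu>X \<sigma>X (\<nu>X k) j t / real L)) = 0"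
    proof -
      have "(\<Sum>j<M. \<Sum>t<n. gaussian_splitting.moment \<mu>X \<sigma>X (\<nu>X k) j t / real L) = 0" if "k < L" for k
        using gaussian_splitting.sum_moment[OF splitting_X[OF that]]
        by (subst sum.swap) (simp flip: sum_divide_distrib)
      then show ?thesis by (simp flip: sum_distrib_left)
    qed
    moreover have "(\<Sum>k<L. \<Sum>j<M. 2 * (\<mu>X - \<mu>Y) * \<sigma>Y * (\<Sum>t<n. Y.moment (k, j) t)) = 0"
    proof -
      have "(\<Sum>i\<in>{..<L} \<times> {..<M}. \<Sum>t<n. Y.moment i t) = 0"
        using Y.sum_moment by (subst sum.swap) simp
      then show ?thesis by (simp add: sum.cartesian_product' flip: sum_distrib_left)
    qed
    moreover have "(\<Sum>k<L. \<Sum>j<M. 2 * \<sigma>X * \<sigma>Y * (p k j * (\<Sum>t<n. aX k j t * Y.centroid (k, j) t))) = 2 * \<sigma>X * \<sigma>Y * corr"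
      unfolding corr_def by (simp only: sum_distrib_left)
    ultimately show ?thesis
      unfolding summand_def by (simp only: sum.distrib sum_subtractf)
  qed
  finally show ?thesis using L by (simp add: algebra_simps)
qed

section \<open>Upper and lower bounds on the correlation\<close>

lemma exp_le_powr:
  assumes "q \<le> exp (r * real n)" "q > 0"
  shows "exp (- 2 * r) \<le> q powr (- 2 / real n)"
proof -
  have "exp (- 2 * r) = exp (r * real n) powr (- 2 / real n)"
    using nML by (simp add: powr_def)
  also have "\<dots> \<le> q powr (- 2 / real n)" using assms by (intro powr_mono2') auto
  finally show ?thesis .
qed

text \<open>The seed is independent of the source, so the source is still Gaussian under each seed
  and only the \<open>M\<close> messages count as pieces. The bound is uniform in the seed and
  survives averaging.\<close>

lemma sum_centroid_X_le:
  assumes M: "real M \<le> exp (R * real n)"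
  shows "(\<Sum>k<L. \<Sum>j<M. p k j * (\<Sum>t<n. (aX k j t)\<^sup>2)) \<le> real n * (1 - exp (- 2 * R))"
proof -
  have L0: "real L > 0" and M0: "real M > 0" and n: "real n > 0" using nML by auto
  have "(\<Sum>k<L. \<Sum>j<M. p k j * (\<Sum>t<n. (aX k j t)\<^sup>2)) \<le> (\<Sum>k<L. real n * (1 - exp (- 2 * R)) / real L)"
  proof (intro sum_mono)
    fix k assume "k \<in> {..<L}"
    then interpret X: gaussian_splitting n \<mu>X \<sigma>X "{..<M}" "\<nu>X k" by (intro splitting_X) simp
    have "(\<Sum>j<M. p k j * (\<Sum>t<n. (aX k j t)\<^sup>2)) = (\<Sum>j<M. X.mass j * (\<Sum>t<n. (X.centroid j t)\<^sup>2)) / real L"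
      by (simp add: p_def sum_divide_distrib)
    also have "\<dots> \<le> real n * (1 - exp (- 2 * R)) / real L"
      using X.sum_centroid_le exp_le_powr[OF M M0] L0 n
      by (intro divide_right_mono order_trans[OF X.sum_centroid_le] mult_left_mono) auto
    finally show "(\<Sum>j<M. p k j * (\<Sum>t<n. (aX k j t)\<^sup>2)) \<le> real n * (1 - exp (- 2 * R)) / real L" .
  qed
  then show ?thesis using L0 by simp
qed

lemma sum_centroid_Y_le:
  assumes M: "real M \<le> exp (R * real n)" and L: "real L \<le> exp (Rc * real n)"
  shows "(\<Sum>k<L. \<Sum>j<M. p k j * (\<Sum>t<n. (Y.centroid (k, j) t)\<^sup>2)) \<le> real n * (1 - exp (- 2 * (R + Rc)))"
proof -
  let ?I = "{..<L} \<times> {..<M}"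
  have L0: "real L > 0" and M0: "real M > 0" and n: "real n > 0" using nML by auto
  have "real (card ?I) \<le> exp ((R + Rc) * real n)"
    using mult_mono[OF L M] by (simp add: exp_add algebra_simps)
  then have "(\<Sum>i\<in>?I. Y.mass i * (\<Sum>t<n. (Y.centroid i t)\<^sup>2)) \<le> real n * (1 - exp (- 2 * (R + Rc)))"
    using exp_le_powr[of "real (card ?I)" "R + Rc"] L0 M0 n
    by (intro order_trans[OF Y.sum_centroid_le] mult_left_mono) auto
  then show ?thesis by (simp add: mass_Y sum.cartesian_product')
qed

lemma corr_le:
  assumes M: "real M \<le> exp (R * real n)" and L: "real L \<le> exp (Rc * real n)"
  shows "corr \<le> real n * sqrt ((1 - exp (- 2 * R)) * (1 - exp (- 2 * (R + Rc))))"
proof -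
  let ?I = "{..<L} \<times> {..<M}"
  have A: "(\<Sum>i\<in>?I \<times> {..<n}. case i of ((k, j), t) \<Rightarrow> (sqrt (p k j) * aX k j t)\<^sup>2) \<le> real n * (1 - exp (- 2 * R))"
    using sum_centroid_X_le[OF M] by (simp add: power_mult_distrib p_nonneg sum_distrib_left sum.cartesian_product')
  have B: "(\<Sum>i\<in>?I \<times> {..<n}. case i of ((k, j), t) \<Rightarrow> (sqrt (p k j) * Y.centroid (k, j) t)\<^sup>2) \<le> real n * (1 - exp (- 2 * (R + Rc)))"
    using sum_centroid_Y_le[OF M L] by (simp add: power_mult_distrib p_nonneg sum_distrib_left sum.cartesian_product')
  have A0: "0 \<le> real n * (1 - exp (- 2 * R))" and B0: "0 \<le> real n * (1 - exp (- 2 * (R + Rc)))"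
    by (rule order_trans[OF _ A] order_trans[OF _ B], simp add: case_prod_beta' sum_nonneg)+
  \<comment> \<open>The weight \<open>p k j\<close> is shared equally between the two factors as
    \<open>sqrt (p k j)\<close>, which makes this an ordinary inner product over triples of seed,
    message and coordinate.\<close>
  have "corr = (\<Sum>i\<in>?I \<times> {..<n}. (case i of ((k, j), t) \<Rightarrow> sqrt (p k j) * aX k j t) * (case i of ((k, j), t) \<Rightarrow> sqrt (p k j) * Y.centroid (k, j) t))"
    by (simp add: corr_def sum_distrib_left sum.cartesian_product' case_prod_beta p_nonneg algebra_simps)
       (intro sum.cong refl, simp add: p_nonneg flip: mult.assoc)
  also have "\<dots> \<le> L2_set (\<lambda>i. case i of ((k, j), t) \<Rightarrow> sqrt (p k j) * aX k j t) (?I \<times> {..<n})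
     * L2_set (\<lambda>i. case i of ((k, j), t) \<Rightarrow> sqrt (p k j) * Y.centroid (k, j) t) (?I \<times> {..<n})"
    by (rule order_trans[OF sum_mono L2_set_mult_ineq]) (simp add: abs_mult[symmetric])
  also have "\<dots> \<le> sqrt (real n * (1 - exp (- 2 * R))) * sqrt (real n * (1 - exp (- 2 * (R + Rc))))"
    using A B A0 B0 unfolding L2_set_def
    by (intro mult_mono real_sqrt_le_mono) (simp_all add: case_prod_beta' sum_nonneg)
  also have "\<dots> = real n * sqrt ((1 - exp (- 2 * R)) * (1 - exp (- 2 * (R + Rc))))"
    by (simp add: real_sqrt_mult)
  finally show ?thesis .
qed

text \<open>The centroid bounds act as a rigidity statement. By the parallel axis identity, a cost
  per coordinate close to \<open>1 - \<alpha>\<close> forces the squared norms of the centroids up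
  to about \<alpha>; as the converse caps these norms, at most \<delta> + \<kappa> per coordinate is
  left for the distance to the scaled codewords. The same holds for the output with \<beta>, and
  centroids that both follow the same codeword are almost parallel. Here \<delta> is the gap to the
  rate limits and \<kappa> the excess cost.\<close>

lemma corr_ge:
  fixes u :: "nat \<times> nat \<Rightarrow> nat \<Rightarrow> real"
  assumes M: "real M \<le> exp (R * real n)" and L: "real L \<le> exp (Rc * real n)"
    and ab: "0 < \<alpha>" "\<alpha> \<le> \<beta>"
    and \<delta>: "1 - exp (- 2 * R) - \<alpha> \<le> \<delta>" "1 - exp (- 2 * (R + Rc)) - \<beta> \<le> \<delta>" and \<kappa>: "0 \<le> \<delta> + \<kappa>" "0 \<le> \<kappa>"
    and X: "(\<Sum>k<L. \<Sum>j<M. \<integral>x. sqdist n \<mu>X \<sigma>X (\<lambda>t. sqrt \<alpha> * u (k, j) t) x \<partial>\<nu>X k j) \<le> real L * (real n * (1 - \<alpha> + \<kappa>))"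
    and Y: "(\<Sum>i\<in>{..<L} \<times> {..<M}. \<integral>y. sqdist n \<mu>Y \<sigma>Y (\<lambda>t. sqrt \<beta> * u i t) y \<partial>\<nu>Y i) \<le> real n * (1 - \<beta> + \<kappa>)"
  shows "real n * (sqrt (\<alpha> * \<beta>) - (3 * \<kappa> + 2 * \<delta>) * sqrt (\<beta> / \<alpha>)) \<le> corr"
proof -
  have L0: "real L > 0" using nML by simp
  let ?n = "real n"
  \<comment> \<open>This ratio makes the codeword cancel in \<open>a - c * b\<close>; expanding the
    square of that small difference isolates the correlation.\<close>
  define c where "c = sqrt (\<alpha> / \<beta>)"
  have c: "0 < c" "c \<le> 1" "c * sqrt \<beta> = sqrt \<alpha>" "c\<^sup>2 * \<beta> = \<alpha>" "1 / c = sqrt (\<beta> / \<alpha>)" "\<alpha> / c = sqrt (\<alpha> * \<beta>)"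
  proof -
    show "0 < c" "c \<le> 1" using ab by (auto simp: c_def)
    show "c\<^sup>2 * \<beta> = \<alpha>" using ab by (simp add: c_def)
    show "c * sqrt \<beta> = sqrt \<alpha>" "1 / c = sqrt (\<beta> / \<alpha>)"
      using ab by (auto simp: c_def real_sqrt_divide)
    have "sqrt (\<alpha> * \<beta>) * c = \<alpha>" using ab by (simp add: c_def flip: real_sqrt_mult)
    then show "\<alpha> / c = sqrt (\<alpha> * \<beta>)" using \<open>0 < c\<close> by (simp add: field_simps)
  qed
  define G where "G f = (\<Sum>k<L. \<Sum>j<M. p k j * (\<Sum>t<n. f k j t))" for f :: "nat \<Rightarrow> nat \<Rightarrow> nat \<Rightarrow> real"
  have G_lin: "G (\<lambda>k j t. r * f k j t) = r * G f" "G (\<lambda>k j t. f k j t + g k j t) = G f + G g" for r f g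
    unfolding G_def by (simp_all add: sum.distrib distrib_left mult.left_commute[of _ r] flip: sum_distrib_left)
  have G_mono: "G f \<le> G g" if "\<And>k j t. f k j t \<le> g k j t" for f g
    unfolding G_def by (intro sum_mono mult_left_mono that p_nonneg) auto
  define a b where "a = aX" and "b = (\<lambda>k j. Y.centroid (k, j))"
  define da db where "da = G (\<lambda>k j t. (a k j t - sqrt \<alpha> * u (k, j) t)\<^sup>2)" and "db = G (\<lambda>k j t. (b k j t - sqrt \<beta> * u (k, j) t)\<^sup>2)"
  define aa bb where "aa = G (\<lambda>k j t. (a k j t)\<^sup>2)" and "bb = G (\<lambda>k j t. (b k j t)\<^sup>2)"
  have "?n - aa + da \<le> ?n * (1 - \<alpha> + \<kappa>)"
  proof -
    have "(\<Sum>k<L. \<Sum>j<M. \<integral>x. sqdist n \<mu>X \<sigma>X (\<lambda>t. sqrt \<alpha> * u (k, j) t) x \<partial>\<nu>X k j)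
      = (\<Sum>k<L. ?n - (\<Sum>j<M. wX k j * (\<Sum>t<n. (a k j t)\<^sup>2)) + (\<Sum>j<M. wX k j * (\<Sum>t<n. (a k j t - sqrt \<alpha> * u (k, j) t)\<^sup>2)))"
      unfolding a_def by (intro sum.cong refl gaussian_splitting.sum_integral_sqdist[OF splitting_X]) auto
    also have "\<dots> = real L * (?n - aa + da)"
      using L0 unfolding aa_def da_def G_def p_def
      by (simp add: sum.distrib sum_subtractf algebra_simps flip: sum_divide_distrib)
    finally show ?thesis using X L0 by simp
  qed
  moreover have "?n - bb + db \<le> ?n * (1 - \<beta> + \<kappa>)"
    using Y unfolding Y.sum_integral_sqdist bb_def db_def G_def b_def
    by (simp add: mass_Y sum.cartesian_product')
  moreover have "aa \<le> ?n * (1 - exp (- 2 * R))"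
    using sum_centroid_X_le[OF M] unfolding aa_def a_def G_def .
  moreover have "bb \<le> ?n * (1 - exp (- 2 * (R + Rc)))"
    using sum_centroid_Y_le[OF M L] unfolding bb_def b_def G_def .
  moreover have "?n * (1 - exp (- 2 * R) - \<alpha>) \<le> ?n * \<delta>" "?n * (1 - exp (- 2 * (R + Rc)) - \<beta>) \<le> ?n * \<delta>"
    using \<delta> by (intro mult_left_mono; simp)+
  moreover have "da \<ge> 0" "db \<ge> 0"
    unfolding da_def db_def G_def by (auto intro!: sum_nonneg mult_nonneg_nonneg p_nonneg)
  ultimately have *: "aa \<ge> ?n * (\<alpha> - \<kappa>)" "da \<le> ?n * (\<delta> + \<kappa>)" "bb \<ge> ?n * (\<beta> - \<kappa>)" "db \<le> ?n * (\<delta> + \<kappa>)"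
    by (simp_all add: algebra_simps)
  have "G (\<lambda>k j t. (a k j t)\<^sup>2 + c\<^sup>2 * (b k j t)\<^sup>2)
     \<le> G (\<lambda>k j t. 2 * c * (a k j t * b k j t) + (2 * (a k j t - sqrt \<alpha> * u (k, j) t)\<^sup>2 + 2 * c\<^sup>2 * (b k j t - sqrt \<beta> * u (k, j) t)\<^sup>2))"
  proof (rule G_mono)
    fix k j t
    let ?x = "a k j t - sqrt \<alpha> * u (k, j) t" and ?y = "c * (b k j t - sqrt \<beta> * u (k, j) t)"
    have "a k j t - c * b k j t = ?x - ?y" using c(3) by (simp add: algebra_simps)
    then have "(a k j t - c * b k j t)\<^sup>2 \<le> 2 * ?x\<^sup>2 + 2 * ?y\<^sup>2"
      using square_diff_le[of ?x ?y] by (simp only:)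
    moreover have "(a k j t - c * b k j t)\<^sup>2 = (a k j t)\<^sup>2 + c\<^sup>2 * (b k j t)\<^sup>2 - 2 * c * (a k j t * b k j t)"
      by (simp add: power2_diff power_mult_distrib)
    moreover have "?y\<^sup>2 = c\<^sup>2 * (b k j t - sqrt \<beta> * u (k, j) t)\<^sup>2"
      by (rule power_mult_distrib)
    ultimately show "(a k j t)\<^sup>2 + c\<^sup>2 * (b k j t)\<^sup>2 \<le> 2 * c * (a k j t * b k j t) + (2 * ?x\<^sup>2 + 2 * c\<^sup>2 * (b k j t - sqrt \<beta> * u (k, j) t)\<^sup>2)"
      by linarith
  qed
  then have main: "aa + c\<^sup>2 * bb \<le> 2 * c * corr + (2 * da + 2 * c\<^sup>2 * db)"
    unfolding G_lin aa_def bb_def da_def db_def by (simp add: corr_def G_def a_def b_def)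
  have c2: "0 \<le> c\<^sup>2" "c\<^sup>2 \<le> 1" using c by (auto simp: power_le_one)
  have "c\<^sup>2 * (?n * (\<beta> - \<kappa>)) \<le> c\<^sup>2 * bb" "c\<^sup>2 * db \<le> c\<^sup>2 * (?n * (\<delta> + \<kappa>))"
    using c2 * by (auto intro: mult_left_mono)
  moreover have "c\<^sup>2 * (?n * (\<delta> + \<kappa>)) \<le> ?n * (\<delta> + \<kappa>)" "c\<^sup>2 * (?n * \<kappa>) \<le> ?n * \<kappa>"
    using c2 \<kappa> by (auto intro!: mult_left_le_one_le)
  moreover have "c\<^sup>2 * (?n * (\<beta> - \<kappa>)) = ?n * \<alpha> - c\<^sup>2 * (?n * \<kappa>)"
    unfolding c(4)[symmetric] by (simp add: algebra_simps)
  ultimately have "?n * \<alpha> - ?n * \<kappa> \<le> c\<^sup>2 * bb" "c\<^sup>2 * db \<le> ?n * \<delta> + ?n * \<kappa>"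
    by (linarith, simp add: distrib_left)
  moreover have "?n * \<alpha> - ?n * \<kappa> \<le> aa" "da \<le> ?n * \<delta> + ?n * \<kappa>"
    using *(1,2) by (simp_all add: algebra_simps)
  moreover have "2 * c\<^sup>2 * db = 2 * (c\<^sup>2 * db)" "2 * c * corr = 2 * (c * corr)" by simp_all
  \<comment> \<open>Before halving, the two energies lose \<kappa> each and the two deviations cost
    2 (\<delta> + \<kappa>) each, which makes 6 \<kappa> + 4 \<delta> per coordinate.\<close>
  ultimately have "?n * \<alpha> - 3 * (?n * \<kappa>) - 2 * (?n * \<delta>) \<le> c * corr"
    using main by linarith
  then have "?n * (\<alpha> - 3 * \<kappa> - 2 * \<delta>) \<le> c * corr" by (simp add: algebra_simps)
  then have "?n * (\<alpha> - 3 * \<kappa> - 2 * \<delta>) / c \<le> corr"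
    using c(1) by (simp add: pos_divide_le_eq mult.commute)
  also have "?n * (\<alpha> - 3 * \<kappa> - 2 * \<delta>) / c = ?n * (\<alpha> / c - (3 * \<kappa> + 2 * \<delta>) * (1 / c))"
    by (simp add: algebra_simps diff_divide_distrib add_divide_distrib)
  finally show ?thesis unfolding c(5,6) .
qed

end

section \<open>Random coding: soft covering with an exact output law\<close>

text \<open>A truncation at level \<open>c\<close> without indicator functions: first moments are
  traded for second moments, once to bound the defect and once for the cost of the
  correction.\<close>

lemma abs_le_add_square_divide:
  fixes a c :: real
  assumes "c > 0"
  shows "\<bar>a\<bar> \<le> c + a\<^sup>2 / c"
proof (cases "\<bar>a\<bar> \<le> c")
  case True
  then show ?thesis using assms by (simp add: add_increasing2)
next
  case False
  then have "\<bar>a\<bar> * c \<le> \<bar>a\<bar> * \<bar>a\<bar>" by (intro mult_left_mono) auto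
  then have "\<bar>a\<bar> \<le> a\<^sup>2 / c" using assms by (simp add: field_simps power2_eq_square)
  then show ?thesis using assms by simp
qed

lemma (in prob_space) ex_le_expectation:
  fixes f :: "'a \<Rightarrow> real"
  assumes "integrable M f"
  shows "\<exists>x\<in>space M. f x \<le> expectation f"
proof (rule ccontr)
  assume "\<not> (\<exists>x\<in>space M. f x \<le> expectation f)"
  then have "AE x in M. expectation f < f x" by (intro AE_I2) auto
  then have "expectation f < expectation f"
    using assms by (intro expectation_greater) (auto simp: prob_space)
  then show False by simp
qed

text \<open>A codebook with small energy is chosen greedily, one codeword after the other: the
  interaction with the codewords already chosen has mean zero.\<close>

lemma (in prob_space) exists_low_energy:
  fixes K :: "'i \<Rightarrow> 'i \<Rightarrow> 'a \<Rightarrow> 'a \<Rightarrow> real"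
  assumes "finite I"
    and d: "\<And>i. i \<in> I \<Longrightarrow> integrable M (d i)"
    and K: "\<And>i i' u. i \<in> I \<Longrightarrow> i' \<in> I \<Longrightarrow> i \<noteq> i' \<Longrightarrow> u \<in> space M \<Longrightarrow> has_bochner_integral M (K i i' u) 0"
    and sym: "\<And>i i' u v. K i i' u v = K i' i v u"
  shows "\<exists>u. (\<forall>i\<in>I. u i \<in> space M) \<and>
     (\<Sum>i\<in>I. d i (u i)) + (\<Sum>i\<in>I. \<Sum>i'\<in>I - {i}. K i i' (u i) (u i')) \<le> (\<Sum>i\<in>I. expectation (d i))"
  using assms(1-3)
proof (induction I rule: finite_induct)
  case empty
  then show ?case by simp
next
  case (insert a F)
  then obtain u where u: "\<forall>i\<in>F. u i \<in> space M"
    "(\<Sum>i\<in>F. d i (u i)) + (\<Sum>i\<in>F. \<Sum>i'\<in>F - {i}. K i i' (u i) (u i')) \<le> (\<Sum>i\<in>F. expectation (d i))"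
    by (auto)
  \<comment> \<open>Each new pair occurs in both orders in the double sum, hence the factor 2;
    \<open>sym\<close> makes the two occurrences equal.\<close>
  define h where "h v = d a v + 2 * (\<Sum>i\<in>F. K i a (u i) v)" for v
  have "has_bochner_integral M (\<lambda>v. 2 * (\<Sum>i\<in>F. K i a (u i) v)) (2 * (\<Sum>i\<in>F. 0))"
    using insert.hyps insert.prems(2) u(1) by (intro has_bochner_integral_mult_right has_bochner_integral_sum) auto
  then have h: "integrable M h" "expectation h = expectation (d a)"
    using insert.prems(1)[of a] unfolding h_def by (auto simp: has_bochner_integral_iff)
  obtain v where v: "v \<in> space M" "h v \<le> expectation (d a)"
    using ex_le_expectation[OF h(1)] h(2) by auto
  define u' where "u' = u(a := v)"
  have u': "u' a = v" "\<And>i. i \<in> F \<Longrightarrow> u' i = u i"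
    using insert.hyps by (auto simp: u'_def)
  have "(\<Sum>i\<in>insert a F. \<Sum>i'\<in>insert a F - {i}. K i i' (u' i) (u' i'))
     = (\<Sum>i'\<in>F. K a i' v (u i')) + (\<Sum>i\<in>F. \<Sum>i'\<in>insert a (F - {i}). K i i' (u' i) (u' i'))"
  proof -
    have "insert a F - {i} = insert a (F - {i})" if "i \<in> F" for i using insert.hyps that by auto
    moreover have "insert a F - {a} = F" using insert.hyps by auto
    ultimately show ?thesis using insert.hyps by (simp add: u')
  qed
  also have "(\<Sum>i\<in>F. \<Sum>i'\<in>insert a (F - {i}). K i i' (u' i) (u' i'))
     = (\<Sum>i\<in>F. K i a (u i) v + (\<Sum>i'\<in>F - {i}. K i i' (u i) (u i')))"
    using insert.hyps by (intro sum.cong refl) (simp add: u')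
  also have "(\<Sum>i'\<in>F. K a i' v (u i')) = (\<Sum>i\<in>F. K i a (u i) v)"
    by (intro sum.cong refl sym)
  finally have "(\<Sum>i\<in>insert a F. \<Sum>i'\<in>insert a F - {i}. K i i' (u' i) (u' i'))
     = 2 * (\<Sum>i\<in>F. K i a (u i) v) + (\<Sum>i\<in>F. \<Sum>i'\<in>F - {i}. K i i' (u i) (u i'))"
    by (simp add: sum.distrib)
  moreover have "(\<Sum>i\<in>insert a F. d i (u' i)) = d a v + (\<Sum>i\<in>F. d i (u i))"
    using insert.hyps by (simp add: u')
  moreover have "\<forall>i\<in>insert a F. u' i \<in> space M" using u(1) v(1) u' by auto
  ultimately show ?case
    using u(2) v(2) insert.hyps by (intro exI[of _ u']) (simp add: h_def)
qed

text \<open>A test channel with density r relative to the product of the source law N and the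
  codeword law V; r1 is r truncated to the typical pairs, and p bounds the atypical mass.\<close>

locale soft_covering = N: prob_space N + V: prob_space V
  for N :: "'a measure" and V :: "'b measure" +
  fixes r r1 :: "'a \<Rightarrow> 'b \<Rightarrow> real" and \<tau> p :: real
  assumes measurable_r [measurable]: "case_prod r \<in> borel_measurable (N \<Otimes>\<^sub>M V)"
    and measurable_r1 [measurable]: "case_prod r1 \<in> borel_measurable (N \<Otimes>\<^sub>M V)"
    and r1_nonneg: "\<And>x u. 0 \<le> r1 x u" and r1_le: "\<And>x u. r1 x u \<le> r x u" and r1_bound: "\<And>x u. r1 x u \<le> \<tau>"
    and r_V: "\<And>x. x \<in> space N \<Longrightarrow> (\<integral>\<^sup>+u. ennreal (r x u) \<partial>V) = 1"
    and r_N: "\<And>u. u \<in> space V \<Longrightarrow> (\<integral>\<^sup>+x. ennreal (r x u) \<partial>N) = 1"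
    and r1_mass: "ennreal (1 - p) \<le> (\<integral>\<^sup>+x. \<integral>\<^sup>+u. ennreal (r1 x u) \<partial>V \<partial>N)"
begin

sublocale P: pair_prob_space N V ..

lemma r_nonneg: "0 \<le> r x u"
  using r1_nonneg r1_le order_trans by blast

lemma \<tau>_nonneg: "0 \<le> \<tau>"
  using r1_nonneg r1_bound order_trans by blast

lemma measurable_r_u [measurable]: "u \<in> space V \<Longrightarrow> (\<lambda>x. r x u) \<in> borel_measurable N"
  using measurable_compose[OF measurable_Pair2'[of u V N], of "\<lambda>(x, u). r x u"] by simp

definition rbar :: "'a \<Rightarrow> real" where "rbar x = (\<integral>u. r1 x u \<partial>V)"

definition c :: "'a \<Rightarrow> 'b \<Rightarrow> real" where "c x u = r1 x u - rbar x"

text \<open>The inner product in L2 of \<open>N\<close> between the centred contributions of two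
  codewords, so the double sum over a codebook is a squared norm.\<close>

definition K :: "'b \<Rightarrow> 'b \<Rightarrow> real" where "K u v = (\<integral>x. c x u * c x v \<partial>N)"

lemma measurable_rbar [measurable]: "rbar \<in> borel_measurable N"
  unfolding rbar_def by measurable

lemma measurable_c [measurable]: "case_prod c \<in> borel_measurable (N \<Otimes>\<^sub>M V)"
  unfolding c_def by measurable

lemma integrable_r1: "x \<in> space N \<Longrightarrow> integrable V (r1 x)"
  using r1_nonneg r1_bound by (intro V.integrable_const_bound[of _ \<tau>]) auto

lemma rbar_eq: "x \<in> space N \<Longrightarrow> (\<integral>\<^sup>+u. ennreal (r1 x u) \<partial>V) = ennreal (rbar x)"
  unfolding rbar_def by (intro nn_integral_eq_integral integrable_r1) (auto simp: r1_nonneg)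

lemma rbar_nonneg: "0 \<le> rbar x"
  unfolding rbar_def by (intro Bochner_Integration.integral_nonneg r1_nonneg)

lemma rbar_le_1: "x \<in> space N \<Longrightarrow> rbar x \<le> 1"
proof -
  assume x: "x \<in> space N"
  have "ennreal (rbar x) \<le> (\<integral>\<^sup>+u. ennreal (r x u) \<partial>V)"
    unfolding rbar_eq[OF x, symmetric] by (intro nn_integral_mono ennreal_leI r1_le)
  then show ?thesis by (simp add: r_V[OF x] rbar_nonneg)
qed

lemma c_bound: "x \<in> space N \<Longrightarrow> \<bar>c x u\<bar> \<le> \<tau> + 1"
  using r1_nonneg[of x u] r1_bound[of x u] rbar_nonneg[of x] rbar_le_1[of x] by (simp add: c_def)

lemma cc_bound: "x \<in> space N \<Longrightarrow> \<bar>c x u * c x v\<bar> \<le> (\<tau> + 1) * (\<tau> + 1)"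
  unfolding abs_mult using c_bound by (intro mult_mono) (auto simp: \<tau>_nonneg)

lemma measurable_c_u [measurable]: "u \<in> space V \<Longrightarrow> (\<lambda>x. c x u) \<in> borel_measurable N"
  using measurable_compose[OF measurable_Pair2'[of u V N], of "\<lambda>(x, u). c x u"] by simp

lemma integrable_cc: "u \<in> space V \<Longrightarrow> v \<in> space V \<Longrightarrow> integrable N (\<lambda>x. c x u * c x v)"
  using cc_bound by (intro N.integrable_const_bound[of _ "(\<tau> + 1) * (\<tau> + 1)"]) auto

lemma K_sym: "K u v = K v u"
  by (simp add: K_def mult.commute)

lemma integral_c: "x \<in> space N \<Longrightarrow> (\<integral>v. c x v \<partial>V) = 0"
  unfolding c_def using integrable_r1[of x] by (simp add: V.prob_space rbar_def)

lemma integrable_bounded_pair: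
  assumes "case_prod f \<in> borel_measurable (N \<Otimes>\<^sub>M V)" "\<And>x u. x \<in> space N \<Longrightarrow> \<bar>f x u :: real\<bar> \<le> B"
  shows "integrable (N \<Otimes>\<^sub>M V) (case_prod f)"
  using assms by (intro P.integrable_const_bound[of _ B]) (auto simp: space_pair_measure)

text \<open>By Fubini, centring with \<open>rbar\<close> makes the interaction vanish on average
  over one codeword. This is the mean-zero hypothesis of \<open>exists_low_energy\<close>.\<close>

lemma K_integral:
  assumes u: "u \<in> space V"
  shows "has_bochner_integral V (K u) 0"
proof -
  have int: "integrable (N \<Otimes>\<^sub>M V) (\<lambda>(x, v). c x u * c x v)"
    using u cc_bound by (intro integrable_bounded_pair[where B = "(\<tau> + 1) * (\<tau> + 1)"]) auto
  have "integrable V (K u)"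
    unfolding K_def using P.integrable_snd[OF int] .
  moreover have "(\<integral>v. K u v \<partial>V) = (\<integral>x. (\<integral>v. c x u * c x v \<partial>V) \<partial>N)"
    unfolding K_def using P.Fubini_integral[OF int] .
  moreover have "\<dots> = (\<integral>x. 0 \<partial>N)"
    by (intro Bochner_Integration.integral_cong) (auto simp: integral_c)
  ultimately show ?thesis by (simp add: has_bochner_integral_iff)
qed

text \<open>A variance is at most a second moment, and the square of \<open>r1\<close> is at most
  \<tau> times \<open>r1\<close>. Truncation thus makes the price of a codeword linear in \<tau>,
  which is the quantity compared with the number of codewords.\<close>

lemma K_diag:
  shows "integrable V (\<lambda>u. K u u)" and "(\<integral>u. K u u \<partial>V) \<le> \<tau>"
proof -
  have int: "integrable (N \<Otimes>\<^sub>M V) (\<lambda>(x, v). c x v * c x v)"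
    by (rule integrable_bounded_pair[where B = "(\<tau> + 1) * (\<tau> + 1)"]) (measurable, rule cc_bound)
  show "integrable V (\<lambda>u. K u u)"
    unfolding K_def using P.integrable_snd[OF int] .
  have "(\<integral>v. K v v \<partial>V) = (\<integral>x. (\<integral>v. c x v * c x v \<partial>V) \<partial>N)"
    unfolding K_def using P.Fubini_integral[OF int] .
  also have "\<dots> \<le> (\<integral>x. \<tau> \<partial>N)"
  proof (intro integral_mono)
    show "integrable N (\<lambda>x. \<integral>v. c x v * c x v \<partial>V)" using P.integrable_fst[OF int] .
    fix x assume x: "x \<in> space N"
    have "(\<integral>v. c x v * c x v \<partial>V) \<le> (\<integral>v. \<tau> * r1 x v - 2 * rbar x * r1 x v + (rbar x)\<^sup>2 \<partial>V)"
    proof (intro integral_mono)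
      show "integrable V (\<lambda>v. c x v * c x v)"
      proof (rule V.integrable_const_bound)
        show "AE v in V. norm (c x v * c x v) \<le> (\<tau> + 1) * (\<tau> + 1)"
          unfolding real_norm_def by (intro AE_I2 cc_bound x)
      qed (use x in measurable)
      show "integrable V (\<lambda>v. \<tau> * r1 x v - 2 * rbar x * r1 x v + (rbar x)\<^sup>2)"
        using integrable_r1[OF x] by auto
      fix v
      have "r1 x v * r1 x v \<le> \<tau> * r1 x v"
        using r1_bound r1_nonneg by (intro mult_right_mono)
      then show "c x v * c x v \<le> \<tau> * r1 x v - 2 * rbar x * r1 x v + (rbar x)\<^sup>2"
        by (simp add: c_def power2_eq_square algebra_simps)
    qed
    also have "\<dots> = \<tau> * rbar x - (rbar x)\<^sup>2"
      using integrable_r1[OF x] by (simp add: V.prob_space power2_eq_square flip: rbar_def)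
    also have "\<dots> \<le> \<tau> * 1 - 0"
      using rbar_le_1[OF x] \<tau>_nonneg by (intro diff_mono mult_left_mono) auto
    finally show "(\<integral>v. c x v * c x v \<partial>V) \<le> \<tau>" by simp
  qed simp
  finally show "(\<integral>u. K u u \<partial>V) \<le> \<tau>" by (simp add: N.prob_space)
qed

definition Q :: "'j set \<Rightarrow> ('j \<Rightarrow> 'b) \<Rightarrow> 'a \<Rightarrow> real" where
  "Q J u x = (\<Sum>i\<in>J. r x (u i)) / real (card J)"

text \<open>For a nonempty finite codebook, \<open>Q J u\<close> is a probability density with
  respect to \<open>N\<close>, so this is the total variation distance between the law of a noisy
  random codeword and \<open>N\<close>.\<close>

definition defect :: "'j set \<Rightarrow> ('j \<Rightarrow> 'b) \<Rightarrow> real" where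
  "defect J u = (\<integral>x. max 0 (1 - Q J u x) \<partial>N)"

context
  fixes J :: "'j set" and u :: "'j \<Rightarrow> 'b"
  assumes J: "finite J" "J \<noteq> {}" and u: "\<And>i. i \<in> J \<Longrightarrow> u i \<in> space V"
begin

lemma card_J: "real (card J) > 0"
  using J by (simp add: card_gt_0_iff)

lemma Q_nonneg: "0 \<le> Q J u x"
  unfolding Q_def by (intro divide_nonneg_nonneg sum_nonneg r_nonneg) auto

lemma measurable_Q [measurable]: "Q J u \<in> borel_measurable N"
  unfolding Q_def using u by measurable

lemma square_sum_c:
  "has_bochner_integral N (\<lambda>x. (\<Sum>i\<in>J. c x (u i))\<^sup>2) (\<Sum>i\<in>J. \<Sum>i'\<in>J. K (u i) (u i'))"
  unfolding power2_eq_square sum_product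
  by (intro has_bochner_integral_sum) (auto simp: K_def has_bochner_integral_iff integrable_cc u)

lemma integrable_defect: "integrable N (\<lambda>x. max 0 (1 - Q J u x))"
  using Q_nonneg by (intro N.integrable_const_bound[of _ 1]) auto

lemma defect_nonneg: "0 \<le> defect J u"
  unfolding defect_def by (intro Bochner_Integration.integral_nonneg) auto

text \<open>Pointwise, \<open>1 - Q\<close> is at most the truncated mass \<open>1 - rbar\<close>
  minus the centred empirical mean \<open>S\<close>. The former integrates to at most
  \<open>p\<close>; the absolute value of the latter is at most \<theta> plus its square over
  \<theta>, whose integral is the double sum of \<open>K\<close>.\<close>

lemma defect_le:
  assumes \<theta>: "\<theta> > 0"
  shows "defect J u \<le> p + \<theta> + (\<Sum>i\<in>J. \<Sum>i'\<in>J. K (u i) (u i')) / (real (card J))\<^sup>2 / \<theta>"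
proof -
  define S where "S x = (\<Sum>i\<in>J. c x (u i)) / real (card J)" for x
  have S: "has_bochner_integral N (\<lambda>x. (S x)\<^sup>2) ((\<Sum>i\<in>J. \<Sum>i'\<in>J. K (u i) (u i')) / (real (card J))\<^sup>2)"
    unfolding S_def power_divide by (intro has_bochner_integral_divide_zero square_sum_c)
  have rb: "integrable N rbar"
    using rbar_nonneg rbar_le_1 by (intro N.integrable_const_bound[of _ 1]) auto
  have "1 - p \<le> (\<integral>x. rbar x \<partial>N)"
  proof -
    have "(\<integral>\<^sup>+x. \<integral>\<^sup>+u. ennreal (r1 x u) \<partial>V \<partial>N) = (\<integral>\<^sup>+x. ennreal (rbar x) \<partial>N)"
      by (intro nn_integral_cong rbar_eq)
    also have "\<dots> = ennreal (\<integral>x. rbar x \<partial>N)"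
      using rb rbar_nonneg by (intro nn_integral_eq_integral) auto
    finally show ?thesis
      using r1_mass by (simp add: ennreal_le_iff rbar_nonneg)
  qed
  have "defect J u \<le> (\<integral>x. (1 - rbar x) + \<theta> + (S x)\<^sup>2 / \<theta> \<partial>N)"
    unfolding defect_def
  proof (intro integral_mono integrable_defect)
    show "integrable N (\<lambda>x. (1 - rbar x) + \<theta> + (S x)\<^sup>2 / \<theta>)"
      using rb S by (auto simp: has_bochner_integral_iff)
    fix x assume x: "x \<in> space N"
    have "rbar x + S x = (\<Sum>i\<in>J. r1 x (u i)) / real (card J)"
      using card_J unfolding S_def c_def by (simp add: sum_subtractf diff_divide_distrib)
    also have "\<dots> \<le> Q J u x"
      unfolding Q_def by (intro divide_right_mono sum_mono r1_le) auto
    finally have 1: "1 - Q J u x \<le> (1 - rbar x) - S x" by simp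
    have 2: "\<bar>S x\<bar> \<le> \<theta> + (S x)\<^sup>2 / \<theta>"
      by (rule abs_le_add_square_divide[OF \<theta>])
    show "max 0 (1 - Q J u x) \<le> (1 - rbar x) + \<theta> + (S x)\<^sup>2 / \<theta>"
      using 1 2 rbar_le_1[OF x] by auto
  qed
  also have "\<dots> = 1 - (\<integral>x. rbar x \<partial>N) + \<theta> + (\<Sum>i\<in>J. \<Sum>i'\<in>J. K (u i) (u i')) / (real (card J))\<^sup>2 / \<theta>"
    using rb S by (simp add: has_bochner_integral_iff N.prob_space)
  finally show ?thesis using \<open>1 - p \<le> _\<close> by simp
qed

text \<open>The density ratios of the codewords are turned into an exact partition of unity with
  exactly equal weights: they are cut down where their mean Q exceeds 1, and the mass
  which is then missing is distributed over the region where Q is below 1.\<close>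

lemma exact_partition:
  obtains f :: "'j \<Rightarrow> 'a \<Rightarrow> real" and e :: "'j \<Rightarrow> real" where
    "\<And>i. i \<in> J \<Longrightarrow> f i \<in> borel_measurable N"
    "\<And>i x. 0 \<le> f i x"
    "\<And>x. (\<Sum>i\<in>J. f i x) = 1"
    "\<And>i. i \<in> J \<Longrightarrow> (\<integral>\<^sup>+x. ennreal (f i x) \<partial>N) = ennreal (1 / real (card J))"
    "\<And>i x. f i x \<le> (r x (u i) + e i * max 0 (1 - Q J u x)) / real (card J)"
    "\<And>i. 0 \<le> e i" "(\<Sum>i\<in>J. e i) = real (card J)" "\<And>i. i \<in> J \<Longrightarrow> e i * defect J u \<le> 1"
proof -
  \<comment> \<open>Where \<open>Q\<close> is 0 the factor is 0 by the convention for division.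
    Nothing is lost, since the ratios of all codewords in \<open>J\<close> vanish there.\<close>
  define g where "g i x = min 1 (1 / Q J u x) * r x (u i)" for i x
  have g0: "0 \<le> g i x" for i x
    unfolding g_def using Q_nonneg r_nonneg by auto
  have g_le: "g i x \<le> r x (u i)" for i x
    unfolding g_def using r_nonneg[of x "u i"] by (intro mult_left_le_one_le) (auto simp: Q_nonneg)
  have [measurable]: "g i \<in> borel_measurable N" if "i \<in> J" for i
    unfolding g_def using u that by measurable
  have int_r: "integrable N (\<lambda>x. r x (u i))" "(\<integral>x. r x (u i) \<partial>N) = 1" if "i \<in> J" for i
    using r_N[OF u[OF that]] u[OF that] r_nonneg
    by (auto simp: integrable_iff_bounded integral_eq_nn_integral abs_of_nonneg)
  have int_g: "integrable N (g i)" if "i \<in> J" for i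
    using g0 g_le that by (intro Bochner_Integration.integrable_bound[OF int_r(1)[OF that]]) (auto intro!: AE_I2 order_trans[OF g_le abs_ge_self])
  have g_sum: "(\<Sum>i\<in>J. g i x) + real (card J) * max 0 (1 - Q J u x) = real (card J)" for x
  proof -
    have "(\<Sum>i\<in>J. g i x) = min 1 (1 / Q J u x) * (real (card J) * Q J u x)"
      using card_J by (simp add: g_def Q_def flip: sum_distrib_left)
    also have "min 1 (1 / Q J u x) * (real (card J) * Q J u x) = real (card J) * min 1 (Q J u x)"
    proof (cases "Q J u x = 0")
      case False
      then have "Q J u x > 0" using Q_nonneg[of x] by linarith
      then show ?thesis by (auto simp: min_def field_simps)
    qed simp
    finally show ?thesis by (simp add: min_def max_def algebra_simps)
  qed
  define a where "a i = (\<integral>x. g i x \<partial>N)" for i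
  have a_le: "a i \<le> 1" if "i \<in> J" for i
    unfolding a_def int_r(2)[OF that, symmetric] using int_g int_r that g_le by (intro integral_mono) auto
  have a_sum: "(\<Sum>i\<in>J. 1 - a i) = real (card J) * defect J u"
  proof -
    have "(\<Sum>i\<in>J. a i) = (\<integral>x. (\<Sum>i\<in>J. g i x) \<partial>N)"
      unfolding a_def using int_g by simp
    also have "\<dots> = (\<integral>x. real (card J) - real (card J) * max 0 (1 - Q J u x) \<partial>N)"
      by (intro Bochner_Integration.integral_cong refl) (metis add_diff_cancel_right' g_sum)
    also have "\<dots> = real (card J) - real (card J) * defect J u"
      using integrable_defect by (simp add: defect_def N.prob_space)
    finally show ?thesis by (simp add: sum_subtractf)
  qed
  \<comment> \<open>\<open>1 - a i\<close> is the mass that piece \<open>i\<close> lacks, and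
    division by the defect makes the added mass restore it exactly. If the defect is 0, no piece
    lacks mass, and the value 1 keeps the sum of \<open>e\<close> equal to the number of
    codewords.\<close>
  define e where "e i = (if defect J u = 0 \<or> i \<notin> J then 1 else (1 - a i) / defect J u)" for i
  have e0: "0 \<le> e i" for i using a_le defect_nonneg by (auto simp: e_def)
  have e_defect: "e i * defect J u = 1 - a i" if "i \<in> J" for i
  proof (cases "defect J u = 0")
    case True
    then have "(\<Sum>i\<in>J. 1 - a i) = 0" using a_sum by simp
    then have "1 - a i = 0" using J a_le that by (subst (asm) sum_nonneg_eq_0_iff) auto
    then show ?thesis using True by simp
  qed (simp add: e_def that)
  have e_sum: "(\<Sum>i\<in>J. e i) = real (card J)"
  proof (cases "defect J u = 0")
    case False
    then have "(\<Sum>i\<in>J. e i) = (\<Sum>i\<in>J. 1 - a i) / defect J u"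
      by (simp add: e_def sum_divide_distrib)
    then show ?thesis using a_sum False by simp
  qed (simp add: e_def)
  define f where "f i x = (g i x + e i * max 0 (1 - Q J u x)) / real (card J)" for i x
  show thesis
  proof (rule that[of f e])
    show "f i \<in> borel_measurable N" if "i \<in> J" for i
      unfolding f_def using that by measurable
    show "0 \<le> f i x" for i x unfolding f_def using g0 e0 by (auto intro!: divide_nonneg_nonneg add_nonneg_nonneg)
    show "(\<Sum>i\<in>J. f i x) = 1" for x
      using g_sum[of x] card_J e_sum unfolding f_def
      by (simp add: sum.distrib flip: sum_divide_distrib sum_distrib_right)
    show "(\<integral>\<^sup>+x. ennreal (f i x) \<partial>N) = ennreal (1 / real (card J))" if "i \<in> J" for i
    proof -
      have "has_bochner_integral N (f i) ((a i + e i * defect J u) / real (card J))"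
        unfolding f_def using int_g[OF that] integrable_defect
        by (intro has_bochner_integral_divide_zero has_bochner_integral_add has_bochner_integral_mult_right)
           (auto simp: has_bochner_integral_iff a_def defect_def)
      then show ?thesis
        using \<open>\<And>i x. 0 \<le> f i x\<close> e_defect[OF that]
        by (subst nn_integral_eq_integral) (auto simp: has_bochner_integral_iff)
    qed
    show "f i x \<le> (r x (u i) + e i * max 0 (1 - Q J u x)) / real (card J)" for i x
      unfolding f_def using g_le by (intro divide_right_mono add_right_mono) auto
    show "e i * defect J u \<le> 1" if "i \<in> J" for i
      using e_defect[OF that] g0 by (simp add: a_def)
  qed (use e0 e_sum in auto)
qed

end

end

section \<open>The Gaussian test channel\<close>

lemma gprod_sq2:
  assumes "s > 0"
  shows "has_bochner_integral (gprod n m s) (\<lambda>x. (\<Sum>t<n. ((x t - m t) / s)\<^sup>2)\<^sup>2) ((real n)\<^sup>2 + 2 * real n)"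
proof -
  let ?E = "\<lambda>x. \<Sum>t<n. ((x t - m t) / s)\<^sup>2"
  interpret prob_space "gprod n m s" by (rule prob_space_gprod[OF assms])
  have 1: "has_bochner_integral (gprod n m s) (\<lambda>_. r) r" for r :: real
    using prob_space by (simp add: has_bochner_integral_iff)
  have "has_bochner_integral (gprod n m s) (\<lambda>x. (?E x - real n)\<^sup>2 + 2 * real n * ?E x - (real n)\<^sup>2)
     (2 * real n + 2 * real n * real n - (real n)\<^sup>2)"
    by (intro has_bochner_integral_add has_bochner_integral_diff has_bochner_integral_mult_right
        gprod_sq_dev gprod_sq assms 1)
  then show ?thesis by (simp add: power2_diff power2_eq_square algebra_simps)
qed

text \<open>The channel adds noise of variance 1 - \<alpha> to sqrt \<alpha> times a standard
  Gaussian codeword, so that the standardised source is again standard. Its mutual information per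
  coordinate is \<open>- ln (1 - \<alpha>) / 2\<close>.\<close>

locale gaussian_channel =
  fixes n :: nat and m s \<alpha> \<epsilon> :: real
  assumes n: "n \<ge> 1" and s: "s > 0" and \<alpha>: "0 < \<alpha>" "\<alpha> < 1" and \<epsilon>: "0 < \<epsilon>"
begin

abbreviation N :: "(nat \<Rightarrow> real) measure" where "N \<equiv> gprod n (\<lambda>_. m) s"
abbreviation V :: "(nat \<Rightarrow> real) measure" where "V \<equiv> gprod n (\<lambda>_. 0) 1"
abbreviation v :: real where "v \<equiv> sqrt (1 - \<alpha>)"
abbreviation E :: "(nat \<Rightarrow> real) \<Rightarrow> real" where "E x \<equiv> \<Sum>t<n. ((x t - m) / s)\<^sup>2"
abbreviation S :: "(nat \<Rightarrow> real) \<Rightarrow> (nat \<Rightarrow> real) \<Rightarrow> real" where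
  "S u \<equiv> sqdist n m s (\<lambda>t. sqrt \<alpha> * u t)"

definition r :: "(nat \<Rightarrow> real) \<Rightarrow> (nat \<Rightarrow> real) \<Rightarrow> real" where
  "r x u = gratio n (\<lambda>t. m + s * (sqrt \<alpha> * u t)) (s * v) m s x"

text \<open>Only the two one-sided deviations that enlarge the exponent of \<open>r\<close> are cut
  off: too much source energy and too little noise energy.\<close>

definition r1 :: "(nat \<Rightarrow> real) \<Rightarrow> (nat \<Rightarrow> real) \<Rightarrow> real" where
  "r1 x u = (if E x \<le> real n * (1 + \<epsilon>) \<and> (1 - \<alpha>) * real n * (1 - \<epsilon>) \<le> S u x then r x u else 0)"

definition \<tau> :: real where "\<tau> = (1 / v) ^ n * exp (real n * \<epsilon>)"
text \<open>Chebyshev for source energy and noise energy: each has variance 2n after standardisation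
  and deviates by n \<epsilon>, which gives twice 2n / (n \<epsilon>)^2.\<close>

definition p :: real where "p = 4 / (real n * \<epsilon>\<^sup>2)"

lemma v: "v > 0" "v\<^sup>2 = 1 - \<alpha>"
  using \<alpha> by auto

lemma sv: "s * v > 0" using s v by simp

lemma r_eq: "r x u = (1 / v) ^ n * exp (E x / 2 - S u x / (2 * (1 - \<alpha>)))"
  unfolding r_def gratio_eq[OF s v(1)] v(2) ..

lemma r_pos: "0 < r x u"
  unfolding r_eq using v by simp

lemma S_eq: "S u x = (1 - \<alpha>) * (\<Sum>t<n. ((x t - (m + s * (sqrt \<alpha> * u t))) / (s * v))\<^sup>2)"
proof -
  have "((x t - m) / s - sqrt \<alpha> * u t)\<^sup>2 = v\<^sup>2 * ((x t - (m + s * (sqrt \<alpha> * u t))) / (s * v))\<^sup>2" for t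
  proof -
    have "(x t - m) / s - sqrt \<alpha> * u t = v * ((x t - (m + s * (sqrt \<alpha> * u t))) / (s * v))"
      using s v(1) by (simp add: field_simps)
    then show ?thesis by (simp only: power_mult_distrib)
  qed
  then show ?thesis unfolding sqdist_def v(2) by (simp add: sum_distrib_left)
qed

text \<open>In standard coordinates source and codeword form a pair of unit variances and
  correlation sqrt \<alpha>, whose density is symmetric. The ratio is therefore also that of the
  codeword given the source, and integrates to 1 over \<open>u\<close>.\<close>

lemma r_sym: "r x u = gratio n (\<lambda>t. 0 + 1 * (sqrt \<alpha> * ((x t - m) / s))) (1 * v) 0 1 u"
proof -
  have *: "a\<^sup>2 / 2 - (a - sqrt \<alpha> * b)\<^sup>2 / (2 * (1 - \<alpha>)) = b\<^sup>2 / 2 - (b - sqrt \<alpha> * a)\<^sup>2 / (2 * (1 - \<alpha>))" for a b :: real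
    using \<alpha> by (simp add: field_simps power2_diff power_mult_distrib)
  show ?thesis
    unfolding gratio_eq[OF zero_less_one v(1)] r_eq v(2) sqdist_def
    using * by (simp add: sum_divide_distrib flip: sum_subtractf)
qed

lemma measurable_S [measurable]: "(\<lambda>z. S (snd z) (fst z)) \<in> borel_measurable (seq_space n \<Otimes>\<^sub>M seq_space n)"
  unfolding sqdist_def by measurable

lemma measurable_r [measurable]: "(\<lambda>z. r (fst z) (snd z)) \<in> borel_measurable (seq_space n \<Otimes>\<^sub>M seq_space n)"
  unfolding r_eq by measurable

lemma integral_r_N: 
  assumes "f \<in> borel_measurable (seq_space n)"
  shows "(\<integral>\<^sup>+x. ennreal (r x u) * f x \<partial>N) = (\<integral>\<^sup>+x. f x \<partial>gprod n (\<lambda>t. m + s * (sqrt \<alpha> * u t)) (s * v))"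
  unfolding r_def by (rule nn_integral_gratio[OF s sv assms])

lemma integral_r_V: "(\<integral>\<^sup>+u. ennreal (r x u) \<partial>V) = 1"
  unfolding r_sym
  using nn_integral_gratio[where s = 1 and s' = "1 * v" and f = "\<lambda>_. 1" and n = n and m' = "\<lambda>t. 0 + 1 * (sqrt \<alpha> * ((x t - m) / s))" and m = 0]
    prob_space.emeasure_space_1[OF prob_space_gprod[of "1 * v" n]] v(1) by simp

lemma integral_r_S: "has_bochner_integral N (\<lambda>x. r x u * S u x) (real n * (1 - \<alpha>))"
proof (rule has_bochner_integral_nn_integral)
  have "(\<integral>\<^sup>+x. ennreal (r x u * S u x) \<partial>N) = (\<integral>\<^sup>+x. ennreal (r x u) * ennreal (S u x) \<partial>N)"
    using r_pos by (simp add: ennreal_mult less_imp_le)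
  also have "\<dots> = (\<integral>\<^sup>+x. ennreal (S u x) \<partial>gprod n (\<lambda>t. m + s * (sqrt \<alpha> * u t)) (s * v))"
    by (rule integral_r_N) measurable
  also have "\<dots> = ennreal ((1 - \<alpha>) * real n)"
    using has_bochner_integral_mult_right[OF gprod_sq[OF sv, of n "\<lambda>t. m + s * (sqrt \<alpha> * u t)"], of "1 - \<alpha>"]
    by (subst nn_integral_eq_integral) (auto simp: S_eq[symmetric] has_bochner_integral_iff)
  finally show "(\<integral>\<^sup>+x. ennreal (r x u * S u x) \<partial>N) = ennreal (real n * (1 - \<alpha>))"
    by (simp add: mult.commute)
qed (use \<alpha> r_pos in \<open>auto simp: less_imp_le r_def\<close>)

lemma dev_integral:
  assumes "s' > 0"
  shows "(\<integral>\<^sup>+x. ennreal (((\<Sum>t<n. ((x t - m' t) / s')\<^sup>2) - real n)\<^sup>2 / (real n * \<epsilon>)\<^sup>2) \<partial>gprod n m' s') = ennreal (2 / (real n * \<epsilon>\<^sup>2))"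
proof -
  have "has_bochner_integral (gprod n m' s') (\<lambda>x. ((\<Sum>t<n. ((x t - m' t) / s')\<^sup>2) - real n)\<^sup>2 / (real n * \<epsilon>)\<^sup>2) (2 * real n / (real n * \<epsilon>)\<^sup>2)"
    by (intro has_bochner_integral_divide_zero gprod_sq_dev assms)
  moreover have "2 * real n / (real n * \<epsilon>)\<^sup>2 = 2 / (real n * \<epsilon>\<^sup>2)"
    using n by (simp add: power2_eq_square)
  ultimately show ?thesis
    by (subst nn_integral_eq_integral) (auto simp: has_bochner_integral_iff)
qed

text \<open>Chebyshev's inequality in pointwise form: off the typical set one of the two squared
  deviations is at least 1 and dominates the indicator.\<close>

lemma r_le:
  "r x u \<le> r1 x u + (r x u * ((E x - real n)\<^sup>2 / (real n * \<epsilon>)\<^sup>2) + r x u * ((S u x / (1 - \<alpha>) - real n)\<^sup>2 / (real n * \<epsilon>)\<^sup>2))"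
proof -
  have ne: "0 < real n * \<epsilon>" using n \<epsilon> by simp
  have *: "1 \<le> a\<^sup>2 / (real n * \<epsilon>)\<^sup>2" if "real n * \<epsilon> \<le> \<bar>a\<bar>" for a
    using power_mono[OF that, of 2] ne n by (subst pos_le_divide_eq) (auto simp del: power_mult_distrib)
  have p: "0 \<le> a\<^sup>2 / (real n * \<epsilon>)\<^sup>2" for a by simp
  consider "r1 x u = r x u" | "real n * \<epsilon> \<le> \<bar>E x - real n\<bar>" | "real n * \<epsilon> \<le> \<bar>S u x / (1 - \<alpha>) - real n\<bar>"
  proof (cases "E x \<le> real n * (1 + \<epsilon>) \<and> (1 - \<alpha>) * real n * (1 - \<epsilon>) \<le> S u x")
    case True
    then show thesis using that(1) by (simp add: r1_def)
  next
    case False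
    then consider "E x > real n * (1 + \<epsilon>)" | "S u x < (1 - \<alpha>) * real n * (1 - \<epsilon>)" by linarith
    then show thesis
    proof cases
      case 1
      then show thesis using that(2) by (simp add: algebra_simps)
    next
      case 2
      then have "S u x / (1 - \<alpha>) < real n * (1 - \<epsilon>)" using \<alpha> by (simp add: field_simps)
      then show thesis using that(3) by (simp add: algebra_simps)
    qed
  qed
  moreover have "0 \<le> r1 x u" using r_pos[of x u] by (simp add: r1_def)
  ultimately show ?thesis
  proof cases
    case 1
    then show ?thesis using r_pos[of x u] p by (simp add: less_imp_le add_nonneg_nonneg)
  next
    case 2
    have "r x u * 1 \<le> r x u * ((E x - real n)\<^sup>2 / (real n * \<epsilon>)\<^sup>2)"
      using r_pos[of x u] *[OF 2] by (intro mult_left_mono) auto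
    moreover have "0 \<le> r x u * ((S u x / (1 - \<alpha>) - real n)\<^sup>2 / (real n * \<epsilon>)\<^sup>2)"
      using r_pos[of x u] p by (intro mult_nonneg_nonneg) auto
    ultimately show ?thesis using \<open>0 \<le> r1 x u\<close> by linarith
  next
    case 3
    have "r x u * 1 \<le> r x u * ((S u x / (1 - \<alpha>) - real n)\<^sup>2 / (real n * \<epsilon>)\<^sup>2)"
      using r_pos[of x u] *[OF 3] by (intro mult_left_mono) auto
    moreover have "0 \<le> r x u * ((E x - real n)\<^sup>2 / (real n * \<epsilon>)\<^sup>2)"
      using r_pos[of x u] p by (intro mult_nonneg_nonneg) auto
    ultimately show ?thesis using \<open>0 \<le> r1 x u\<close> by linarith
  qed
qed

sublocale soft_covering N V r r1 \<tau> p
proof (intro soft_covering.intro soft_covering_axioms.intro prob_space_gprod s)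
  have [measurable_cong]: "sets (N \<Otimes>\<^sub>M V) = sets (seq_space n \<Otimes>\<^sub>M seq_space n)"
    by (intro sets_pair_measure_cong) auto
  show [measurable]: "case_prod r \<in> borel_measurable (N \<Otimes>\<^sub>M V)"
    by (simp add: case_prod_beta' cong: measurable_cong_sets)
  have [measurable]: "(\<lambda>z. r1 (fst z) (snd z)) \<in> borel_measurable (seq_space n \<Otimes>\<^sub>M seq_space n)"
    unfolding r1_def by measurable
  then show "case_prod r1 \<in> borel_measurable (N \<Otimes>\<^sub>M V)"
    by (simp add: case_prod_beta' cong: measurable_cong_sets)
  show "0 \<le> r1 x u" for x u using r_pos[of x u] by (simp add: r1_def)
  show "r1 x u \<le> r x u" for x u using r_pos[of x u] by (simp add: r1_def)
  show "r1 x u \<le> \<tau>" for x u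
  proof (cases "E x \<le> real n * (1 + \<epsilon>) \<and> (1 - \<alpha>) * real n * (1 - \<epsilon>) \<le> S u x")
    case True
    then have "real n * (1 - \<epsilon>) / 2 \<le> S u x / (2 * (1 - \<alpha>))"
      using \<alpha> by (simp add: field_simps)
    moreover have "real n * (1 + \<epsilon>) / 2 - real n * (1 - \<epsilon>) / 2 = real n * \<epsilon>"
      by (simp add: field_simps)
    ultimately have "E x / 2 - S u x / (2 * (1 - \<alpha>)) \<le> real n * \<epsilon>"
      using True by linarith
    then show ?thesis using True v unfolding \<tau>_def r1_def r_eq by simp
  next
    case False
    then have "r1 x u = 0" unfolding r1_def by auto
    then show ?thesis using v by (simp add: \<tau>_def)
  qed
  show "(\<integral>\<^sup>+u. ennreal (r x u) \<partial>V) = 1" for x by (rule integral_r_V)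
  show "(\<integral>\<^sup>+x. ennreal (r x u) \<partial>N) = 1" for u
    using integral_r_N[of "\<lambda>_. 1" u] prob_space.emeasure_space_1[OF prob_space_gprod[OF sv]] by simp
  interpret N: prob_space N by (rule prob_space_gprod[OF s])
  interpret V: prob_space V by (rule prob_space_gprod) simp
  interpret P: pair_prob_space N V ..
  let ?a = "\<lambda>x. (E x - real n)\<^sup>2 / (real n * \<epsilon>)\<^sup>2"
  let ?b = "\<lambda>u x. (S u x / (1 - \<alpha>) - real n)\<^sup>2 / (real n * \<epsilon>)\<^sup>2"
  have [measurable]: "(\<lambda>u. r x u) \<in> borel_measurable (seq_space n)" for x
    unfolding r_sym by measurable
  have [measurable]: "(\<lambda>u. S u x) \<in> borel_measurable (seq_space n)" for x
    unfolding sqdist_def by measurable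
  have [measurable]: "(\<lambda>u. r1 x u) \<in> borel_measurable (seq_space n)" for x
    unfolding r1_def by measurable
  have 1: "(\<integral>\<^sup>+x. \<integral>\<^sup>+u. ennreal (r x u) * ennreal (?a x) \<partial>V \<partial>N) = ennreal (2 / (real n * \<epsilon>\<^sup>2))"
  proof -
    have "(\<integral>\<^sup>+u. ennreal (r x u) * ennreal (?a x) \<partial>V) = ennreal (?a x)" for x
      by (subst nn_integral_multc) (simp_all add: integral_r_V)
    then show ?thesis using dev_integral[OF s, of "\<lambda>_. m"] by simp
  qed
  \<comment> \<open>The noise energy has a simple law only for a fixed codeword, so the order of
    integration is exchanged; the source energy \<open>?a\<close> does not depend on the codeword
    and needs no exchange.\<close>
  have 2: "(\<integral>\<^sup>+x. \<integral>\<^sup>+u. ennreal (r x u) * ennreal (?b u x) \<partial>V \<partial>N) = ennreal (2 / (real n * \<epsilon>\<^sup>2))"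
  proof -
    have "(\<integral>\<^sup>+x. \<integral>\<^sup>+u. ennreal (r x u) * ennreal (?b u x) \<partial>V \<partial>N)
      = (\<integral>\<^sup>+u. \<integral>\<^sup>+x. ennreal (r x u) * ennreal (?b u x) \<partial>N \<partial>V)"
      by (rule P.Fubini'[symmetric]) (simp add: case_prod_beta' cong: measurable_cong_sets)
    also have "\<dots> = (\<integral>\<^sup>+u. ennreal (2 / (real n * \<epsilon>\<^sup>2)) \<partial>V)"
    proof (intro nn_integral_cong)
      fix u
      have "S u x / (1 - \<alpha>) = (\<Sum>t<n. ((x t - (m + s * (sqrt \<alpha> * u t))) / (s * v))\<^sup>2)" for x
        using \<alpha> by (simp add: S_eq)
      then show "(\<integral>\<^sup>+x. ennreal (r x u) * ennreal (?b u x) \<partial>N) = ennreal (2 / (real n * \<epsilon>\<^sup>2))"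
        using dev_integral[OF sv, of "\<lambda>t. m + s * (sqrt \<alpha> * u t)"] by (subst integral_r_N) auto
    qed
    finally show ?thesis using V.emeasure_space_1 by simp
  qed
  have "1 = (\<integral>\<^sup>+x. \<integral>\<^sup>+u. ennreal (r x u) \<partial>V \<partial>N)"
    using N.emeasure_space_1 by (simp add: integral_r_V)
  also have "\<dots> \<le> (\<integral>\<^sup>+x. \<integral>\<^sup>+u. ennreal (r1 x u) + (ennreal (r x u) * ennreal (?a x) + ennreal (r x u) * ennreal (?b u x)) \<partial>V \<partial>N)"
  proof (intro nn_integral_mono)
    fix x u
    have "ennreal (r x u) \<le> ennreal (r1 x u + (r x u * ?a x + r x u * ?b u x))"
      by (intro ennreal_leI r_le)
    also have "\<dots> = ennreal (r1 x u) + (ennreal (r x u) * ennreal (?a x) + ennreal (r x u) * ennreal (?b u x))"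
      using r_pos[of x u] \<open>\<And>x u. 0 \<le> r1 x u\<close>[of x u]
      by (simp add: ennreal_plus ennreal_mult add_nonneg_nonneg mult_nonneg_nonneg less_imp_le del: times_divide_eq_right)
    finally show "ennreal (r x u) \<le> \<dots>" .
  qed
  also have "\<dots> = (\<integral>\<^sup>+x. (\<integral>\<^sup>+u. ennreal (r1 x u) \<partial>V) + ((\<integral>\<^sup>+u. ennreal (r x u) * ennreal (?a x) \<partial>V) + (\<integral>\<^sup>+u. ennreal (r x u) * ennreal (?b u x) \<partial>V)) \<partial>N)"
    by (simp add: nn_integral_add)
  also have "\<dots> = (\<integral>\<^sup>+x. \<integral>\<^sup>+u. ennreal (r1 x u) \<partial>V \<partial>N) + ((\<integral>\<^sup>+x. \<integral>\<^sup>+u. ennreal (r x u) * ennreal (?a x) \<partial>V \<partial>N) + (\<integral>\<^sup>+x. \<integral>\<^sup>+u. ennreal (r x u) * ennreal (?b u x) \<partial>V \<partial>N))"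
  proof -
    have [measurable]: "(\<lambda>x. \<integral>\<^sup>+u. g (x, u) \<partial>V) \<in> borel_measurable N"
      if "g \<in> borel_measurable (seq_space n \<Otimes>\<^sub>M seq_space n)" for g
      using that by (intro V.borel_measurable_nn_integral) (simp add: case_prod_beta' cong: measurable_cong_sets)
    note m = this[of "\<lambda>z. ennreal (r1 (fst z) (snd z))"] this[of "\<lambda>z. ennreal (r (fst z) (snd z)) * ennreal (?a (fst z))"]
      this[of "\<lambda>z. ennreal (r (fst z) (snd z)) * ennreal (?b (snd z) (fst z))"]
    have [measurable]: "(\<lambda>x. \<integral>\<^sup>+u. ennreal (r1 x u) \<partial>V) \<in> borel_measurable N"
      "(\<lambda>x. \<integral>\<^sup>+u. ennreal (r x u) * ennreal (?a x) \<partial>V) \<in> borel_measurable N"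
      "(\<lambda>x. \<integral>\<^sup>+u. ennreal (r x u) * ennreal (?b u x) \<partial>V) \<in> borel_measurable N"
      using m by simp_all
    show ?thesis by (simp add: nn_integral_add)
  qed
  also have "\<dots> = (\<integral>\<^sup>+x. \<integral>\<^sup>+u. ennreal (r1 x u) \<partial>V \<partial>N) + ennreal p"
    unfolding 1 2 using n \<epsilon> by (simp add: p_def flip: ennreal_plus)
  finally show "ennreal (1 - p) \<le> (\<integral>\<^sup>+x. \<integral>\<^sup>+u. ennreal (r1 x u) \<partial>V \<partial>N)"
    using n \<epsilon> by (simp add: p_def ennreal_minus[symmetric] ennreal_minus_le_iff add.commute)
qed (rule zero_less_one)

text \<open>The channel accounts for n (1 - \<alpha>). The correction has total mass
  \<open>defect J u\<close> but unbounded cost; cutting squared norms at level n T costs a multiple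
  of T times the defect, and the tails are paid by second moments of the squared norms over
  T.\<close>

lemma exact_quantizer:
  fixes J :: "'j set" and u :: "'j \<Rightarrow> nat \<Rightarrow> real"
  assumes J: "finite J" "J \<noteq> {}" and u: "\<And>i. i \<in> J \<Longrightarrow> u i \<in> space V" and T: "T > 0"
  obtains f :: "'j \<Rightarrow> (nat \<Rightarrow> real) \<Rightarrow> real" where
    "\<And>i. i \<in> J \<Longrightarrow> f i \<in> borel_measurable (seq_space n)"
    "\<And>i x. 0 \<le> f i x"
    "\<And>x. (\<Sum>i\<in>J. f i x) = 1"
    "\<And>i. i \<in> J \<Longrightarrow> (\<integral>\<^sup>+x. ennreal (f i x) \<partial>N) = ennreal (1 / real (card J))"
    "(\<Sum>i\<in>J. \<integral>\<^sup>+x. ennreal (f i x * S (u i) x) \<partial>N)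
       \<le> ennreal (real n * (1 - \<alpha>) + 4 * real n * T * defect J u + 6 * real n / T
            + 2 / (real n * T) * ((\<Sum>i\<in>J. (\<Sum>t<n. (u i t)\<^sup>2)\<^sup>2) / real (card J)))"
proof -
  obtain f e where f: 
    "\<And>i. i \<in> J \<Longrightarrow> f i \<in> borel_measurable N"
    "\<And>i x. 0 \<le> f i x"
    "\<And>x. (\<Sum>i\<in>J. f i x) = 1"
    "\<And>i. i \<in> J \<Longrightarrow> (\<integral>\<^sup>+x. ennreal (f i x) \<partial>N) = ennreal (1 / real (card J))"
    "\<And>i x. f i x \<le> (r x (u i) + e i * max 0 (1 - Q J u x)) / real (card J)"
    "\<And>i. 0 \<le> e i" "(\<Sum>i\<in>J. e i) = real (card J)" "\<And>i. i \<in> J \<Longrightarrow> e i * defect J u \<le> 1"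
    by (rule exact_partition[of J u, OF J u]) (assumption, rule that)
  define w where "w x = max 0 (1 - Q J u x)" for x
  let ?q = "real (card J)" and ?d = "defect J u" and ?n = "real n"
  let ?u = "\<lambda>i. \<Sum>t<n. (u i t)\<^sup>2"
  have q: "?q > 0" using J by (simp add: card_gt_0_iff)
  have nT: "?n * T > 0" using n T by simp
  have d: "?d \<ge> 0" by (rule defect_nonneg[of J u, OF J u])
  have am: "a \<le> ?n * T + a\<^sup>2 / (?n * T)" for a
    using abs_le_add_square_divide[OF nT, of a] by linarith
  \<comment> \<open>An integrable majorant of \<open>f i x * S (u i) x\<close>: the distance is at
    most twice the two squared norms, and \<open>w x * E x\<close> is truncated at level
    \<open>n * T\<close>, the tail losing its factor \<open>w x\<close>, which is at most 1.\<close>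
  define B where "B i x = (r x (u i) * S (u i) x + e i * (2 * (?n * T * w x + (E x)\<^sup>2 / (?n * T)) + 2 * ?u i * w x)) / ?q" for i x
  define b where "b i = (?n * (1 - \<alpha>) + e i * (2 * (?n * T * ?d + (?n\<^sup>2 + 2 * ?n) / (?n * T)) + 2 * ?u i * ?d)) / ?q" for i
  have int_w: "has_bochner_integral N w ?d"
    using integrable_defect[of J u, OF J u] unfolding has_bochner_integral_iff defect_def w_def by blast
  have B: "has_bochner_integral N (B i) (b i)" for i
    unfolding B_def b_def
    by (intro has_bochner_integral_add has_bochner_integral_mult_right has_bochner_integral_divide_zero
      integral_r_S int_w gprod_sq2 s)
  have S_le: "S (u i) x \<le> 2 * E x + 2 * ?u i" for i x
  proof -
    have "((x t - m) / s - sqrt \<alpha> * u i t)\<^sup>2 \<le> 2 * ((x t - m) / s)\<^sup>2 + 2 * (u i t)\<^sup>2" for t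
    proof -
      note square_diff_le[of "(x t - m) / s" "sqrt \<alpha> * u i t"]
      moreover have "(sqrt \<alpha> * u i t)\<^sup>2 \<le> (u i t)\<^sup>2"
        using \<alpha> by (simp add: power_mult_distrib mult_left_le_one_le)
      ultimately show ?thesis by linarith
    qed
    then show ?thesis unfolding sqdist_def sum_distrib_left sum.distrib[symmetric] by (intro sum_mono)
  qed
  have f_le: "f i x * S (u i) x \<le> B i x" for i x
  proof -
    have w: "0 \<le> w x" "w x \<le> 1" using Q_nonneg[of J u x, OF J u] by (auto simp: w_def)
    have wE: "w x * E x \<le> ?n * T * w x + (E x)\<^sup>2 / (?n * T)"
    proof -
      have "w x * E x \<le> w x * (?n * T + (E x)\<^sup>2 / (?n * T))"
        using w(1) by (intro mult_left_mono am)
      also have "\<dots> = ?n * T * w x + w x * ((E x)\<^sup>2 / (?n * T))" by (simp add: algebra_simps)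
      also have "w x * ((E x)\<^sup>2 / (?n * T)) \<le> (E x)\<^sup>2 / (?n * T)"
        using w nT by (intro mult_left_le_one_le) auto
      finally show ?thesis by simp
    qed
    have "f i x * S (u i) x \<le> (r x (u i) + e i * w x) / ?q * S (u i) x"
      by (intro mult_right_mono f(5)[folded w_def]) auto
    also have "\<dots> = (r x (u i) * S (u i) x + e i * (w x * S (u i) x)) / ?q"
      by (simp add: algebra_simps)
    also have "\<dots> \<le> (r x (u i) * S (u i) x + e i * (w x * (2 * E x + 2 * ?u i))) / ?q"
      using w f(6) q by (intro divide_right_mono add_left_mono mult_left_mono S_le) auto
    also have "\<dots> = (r x (u i) * S (u i) x + e i * (2 * (w x * E x) + 2 * ?u i * w x)) / ?q"
      by (simp add: algebra_simps)
    also have "\<dots> \<le> B i x"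
      unfolding B_def using f(6) q wE by (intro divide_right_mono add_left_mono mult_left_mono add_right_mono) auto
    finally show ?thesis .
  qed
  have fS0: "0 \<le> f i x * S (u i) x" for i x using f(2) by simp
  have b0: "0 \<le> b i" for i
  proof -
    have "0 \<le> (\<integral>x. B i x \<partial>N)"
      by (intro Bochner_Integration.integral_nonneg order_trans[OF fS0 f_le])
    then show ?thesis using B[of i] by (simp add: has_bochner_integral_iff)
  qed
  have "(\<Sum>i\<in>J. \<integral>\<^sup>+x. ennreal (f i x * S (u i) x) \<partial>N) \<le> (\<Sum>i\<in>J. \<integral>\<^sup>+x. ennreal (B i x) \<partial>N)"
    by (intro sum_mono nn_integral_mono ennreal_leI f_le)
  also have "\<dots> = (\<Sum>i\<in>J. ennreal (b i))"
    using B order_trans[OF fS0 f_le]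
    by (intro sum.cong refl, subst nn_integral_eq_integral) (auto simp: has_bochner_integral_iff)
  also have "\<dots> = ennreal (\<Sum>i\<in>J. b i)" using b0 by (simp add: sum_ennreal)
  also have "(\<Sum>i\<in>J. b i) \<le> ?n * (1 - \<alpha>) + 4 * ?n * T * ?d + 6 * ?n / T + 2 / (?n * T) * ((\<Sum>i\<in>J. (?u i)\<^sup>2) / ?q)"
  proof -
    have eq: "(\<Sum>i\<in>J. b i) = ?n * (1 - \<alpha>) + (2 * (?n * T * ?d + (?n\<^sup>2 + 2 * ?n) / (?n * T))) * ((\<Sum>i\<in>J. e i) / ?q)
       + (\<Sum>i\<in>J. 2 * (e i * ?d * ?u i)) / ?q"
    proof -
      have "b i = ?n * (1 - \<alpha>) / ?q + 2 * (?n * T * ?d + (?n\<^sup>2 + 2 * ?n) / (?n * T)) * (e i / ?q) + 2 * (e i * ?d * ?u i) / ?q" for i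
      proof -
        have "(A + c * (2 * C + 2 * U * D)) / q = A / q + 2 * C * (c / q) + 2 * (c * D * U) / q" for A c C U D q :: real
          by (simp add: add_divide_distrib algebra_simps)
        then show ?thesis unfolding b_def .
      qed
      then show ?thesis using q by (simp only: sum.distrib sum_distrib_left[symmetric] sum_divide_distrib[symmetric]) simp
    qed
    \<comment> \<open>The correction could fall mainly on codewords of large norm. As
      \<open>e i * defect J u\<close> is at most 1, the tail term can drop this weight and becomes
      the plain sum of fourth powers.\<close>
    have "(\<Sum>i\<in>J. 2 * (e i * ?d * ?u i)) \<le> (\<Sum>i\<in>J. 2 * (?n * T * (e i * ?d) + (?u i)\<^sup>2 / (?n * T)))"
    proof (intro sum_mono mult_left_mono)
      fix i assume i: "i \<in> J"
      have ed: "0 \<le> e i * ?d" "e i * ?d \<le> 1" using f(6) f(8)[OF i] d by auto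
      have "e i * ?d * ?u i \<le> e i * ?d * (?n * T + (?u i)\<^sup>2 / (?n * T))"
        using ed(1) by (intro mult_left_mono am)
      also have "\<dots> = ?n * T * (e i * ?d) + e i * ?d * ((?u i)\<^sup>2 / (?n * T))" by (simp add: algebra_simps)
      also have "e i * ?d * ((?u i)\<^sup>2 / (?n * T)) \<le> (?u i)\<^sup>2 / (?n * T)"
        using ed nT by (intro mult_left_le_one_le) auto
      finally show "e i * ?d * ?u i \<le> ?n * T * (e i * ?d) + (?u i)\<^sup>2 / (?n * T)" by simp
    qed simp
    also have "\<dots> = 2 * (?n * T * (?q * ?d) + (\<Sum>i\<in>J. (?u i)\<^sup>2) / (?n * T))"
      by (simp add: sum.distrib f(7) flip: sum_distrib_left sum_divide_distrib sum_distrib_right)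
    finally have le: "(\<Sum>i\<in>J. 2 * (e i * ?d * ?u i)) \<le> 2 * (?n * T * (?q * ?d) + (\<Sum>i\<in>J. (?u i)\<^sup>2) / (?n * T))" .
    have "(\<Sum>i\<in>J. b i) \<le> ?n * (1 - \<alpha>) + (2 * (?n * T * ?d + (?n\<^sup>2 + 2 * ?n) / (?n * T))) * (?q / ?q)
       + 2 * (?n * T * (?q * ?d) + (\<Sum>i\<in>J. (?u i)\<^sup>2) / (?n * T)) / ?q"
      unfolding eq f(7) using q by (intro add_left_mono divide_right_mono le) auto
    also have "\<dots> = ?n * (1 - \<alpha>) + 4 * ?n * T * ?d + 2 * (?n + 2) / T + 2 / (?n * T) * ((\<Sum>i\<in>J. (?u i)\<^sup>2) / ?q)"
    proof -
      have 1: "(?n\<^sup>2 + 2 * ?n) / (?n * T) = (?n + 2) / T"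
        using n T by (simp add: field_simps power2_eq_square)
      have 2: "2 * (a * (?q * ?d) + b / (?n * T)) / ?q = 2 * a * ?d + 2 / (?n * T) * (b / ?q)" for a b
        using q by (simp add: add_divide_distrib distrib_left)
      have 3: "?q / ?q = 1" using q by simp
      show ?thesis unfolding 1 2 3 by (simp add: distrib_left)
    qed
    finally have "(\<Sum>i\<in>J. b i) \<le> ?n * (1 - \<alpha>) + 4 * ?n * T * ?d + 2 * (?n + 2) / T + 2 / (?n * T) * ((\<Sum>i\<in>J. (?u i)\<^sup>2) / ?q)" .
    moreover have "2 * (?n + 2) / T \<le> 6 * ?n / T"
      using n T by (intro divide_right_mono) auto
    ultimately show ?thesis by linarith
  qed
  finally have cost: "(\<Sum>i\<in>J. \<integral>\<^sup>+x. ennreal (f i x * S (u i) x) \<partial>N)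
    \<le> ennreal (?n * (1 - \<alpha>) + 4 * ?n * T * ?d + 6 * ?n / T + 2 / (?n * T) * ((\<Sum>i\<in>J. (?u i)\<^sup>2) / ?q))"
    by (simp add: ennreal_leI)
  show thesis
    using that[of f] f(1-4) cost by simp
qed

end

section \<open>Construction of a code\<close>

definition norm2 :: "nat \<Rightarrow> (nat \<Rightarrow> real) \<Rightarrow> real" where
  "norm2 n u = (\<Sum>t<n. (u t)\<^sup>2)"

abbreviation covering_defect ::
    "nat \<Rightarrow> real \<Rightarrow> real \<Rightarrow> real \<Rightarrow> 'j set \<Rightarrow> ('j \<Rightarrow> nat \<Rightarrow> real) \<Rightarrow> real" where
  "covering_defect n m s \<alpha> \<equiv> soft_covering.defect (gprod n (\<lambda>_. m) s) (gaussian_channel.r n m s \<alpha>)"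

text \<open>One codebook has to cover the source within every seed (on average), cover the output as
  a whole, and have bounded fourth moments. All three are put into one energy for the greedy choice;
  the source kernel acts only between codewords of the same seed.\<close>

lemma exists_codebook:
  fixes M L n :: nat and mX sX mY sY \<alpha> \<beta> \<epsilon> \<theta> \<eta> :: real
  assumes n: "n \<ge> 1" and sizes: "M \<ge> 1" "L \<ge> 1" and s: "sX > 0" "sY > 0"
    and \<alpha>: "0 < \<alpha>" "\<alpha> < 1" and \<beta>: "0 < \<beta>" "\<beta> < 1" and \<epsilon>: "\<epsilon> > 0" and \<theta>: "\<theta> > 0" and \<eta>: "\<eta> > 0"
    and \<tau>X: "gaussian_channel.\<tau> n \<alpha> \<epsilon> \<le> \<eta> * real M"
    and \<tau>Y: "gaussian_channel.\<tau> n \<beta> \<epsilon> \<le> \<eta> * (real L * real M)"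
  obtains u :: "nat \<times> nat \<Rightarrow> nat \<Rightarrow> real" where
    "\<And>i. i \<in> {..<L} \<times> {..<M} \<Longrightarrow> u i \<in> space (seq_space n)"
    "(\<Sum>k<L. covering_defect n mX sX \<alpha> {..<M} (\<lambda>j. u (k, j)))
       \<le> real L * (4 / (real n * \<epsilon>\<^sup>2) + \<theta> + 5 * \<eta> / \<theta>)"
    "covering_defect n mY sY \<beta> ({..<L} \<times> {..<M}) u \<le> 4 / (real n * \<epsilon>\<^sup>2) + \<theta> + 5 * \<eta> / \<theta>"
    "(\<Sum>k<L. \<Sum>j<M. (norm2 n (u (k, j)))\<^sup>2) \<le> real L * real M * (5 * (real n)\<^sup>2)"
proof -
  interpret X: gaussian_channel n mX sX \<alpha> \<epsilon> by unfold_locales (use n s \<alpha> \<epsilon> in auto)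
  interpret Y: gaussian_channel n mY sY \<beta> \<epsilon> by unfold_locales (use n s \<beta> \<epsilon> in auto)
  let ?I = "{..<L} \<times> {..<M}" and ?q = "real L * real M"
  have pos: "real L > 0" "real M > 0" "?q > 0" "real n > 0" using sizes n by auto
  \<comment> \<open>The weights normalise the three parts, so that their means per codeword are at
    most \<eta>, \<eta> and 3 \<eta> over the number of codewords; this is the origin of 5 \<eta>.
    The 3 comes from \<open>n^2 + 2 * n\<close> being at most \<open>3 * n^2\<close>.\<close>
  define wX wY wE where "wX = 1 / (real L * (real M)\<^sup>2)" and "wY = 1 / ?q\<^sup>2" and "wE = \<eta> / (?q * (real n)\<^sup>2)"
  have w: "wX > 0" "wY > 0" "wE > 0" using pos \<eta> by (auto simp: wX_def wY_def wE_def)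
  define d where "d u = wX * X.K u u + wY * Y.K u u + wE * (norm2 n u)\<^sup>2" for u
  define K where "K i i' u v = (if fst i = fst i' then wX * X.K u v else 0) + wY * Y.K u v"
    for i i' :: "nat \<times> nat" and u v
  have u4: "has_bochner_integral X.V (\<lambda>u. (norm2 n u)\<^sup>2) ((real n)\<^sup>2 + 2 * real n)"
    using gprod_sq2[of 1 n "\<lambda>_. 0"] by (simp add: norm2_def)
  have dint: "integrable X.V d"
    unfolding d_def using X.K_diag(1) Y.K_diag(1) u4 by (auto simp: has_bochner_integral_iff)
  have dval: "(\<integral>u. d u \<partial>X.V) \<le> 5 * \<eta> / ?q"
  proof -
    have "(\<integral>u. d u \<partial>X.V) = wX * (\<integral>u. X.K u u \<partial>X.V) + wY * (\<integral>u. Y.K u u \<partial>X.V) + wE * ((real n)\<^sup>2 + 2 * real n)"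
      unfolding d_def using X.K_diag(1) Y.K_diag(1) u4 by (simp add: has_bochner_integral_iff)
    also have "\<dots> \<le> wX * (\<eta> * real M) + wY * (\<eta> * ?q) + wE * (3 * (real n)\<^sup>2)"
    proof (intro add_mono mult_left_mono)
      have "real n * 1 \<le> real n * real n" using n by (intro mult_left_mono) auto
      then show "(real n)\<^sup>2 + 2 * real n \<le> 3 * (real n)\<^sup>2" by (simp add: power2_eq_square)
    qed (use X.K_diag(2) Y.K_diag(2) \<tau>X \<tau>Y w in auto)
    also have "\<dots> = 5 * \<eta> / ?q"
      using pos by (simp add: wX_def wY_def wE_def field_simps power2_eq_square)
    finally show ?thesis .
  qed
  have "\<exists>u. (\<forall>i\<in>?I. u i \<in> space X.V) \<and>
     (\<Sum>i\<in>?I. d (u i)) + (\<Sum>i\<in>?I. \<Sum>i'\<in>?I - {i}. K i i' (u i) (u i')) \<le> (\<Sum>i\<in>?I. \<integral>u. d u \<partial>X.V)"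
  proof (rule X.V.exists_low_energy[where d = "\<lambda>_. d" and K = K])
    show "has_bochner_integral X.V (K i i' u) 0" if "u \<in> space X.V" for i i' u
      using has_bochner_integral_add[OF has_bochner_integral_mult_right[OF X.K_integral[OF that], of wX]
          has_bochner_integral_mult_right[OF Y.K_integral[OF that], of wY]]
        has_bochner_integral_mult_right[OF Y.K_integral[OF that], of wY]
      by (cases "fst i = fst i'") (simp_all add: K_def[abs_def])
    show "K i i' u v = K i' i v u" for i i' u v
      using X.K_sym[of u v] Y.K_sym[of u v] by (simp add: K_def)
  qed (use dint in auto)
  then obtain u where u0: "\<forall>i\<in>?I. u i \<in> space X.V"
    and le: "(\<Sum>i\<in>?I. d (u i)) + (\<Sum>i\<in>?I. \<Sum>i'\<in>?I - {i}. K i i' (u i) (u i')) \<le> (\<Sum>i\<in>?I. \<integral>u. d u \<partial>X.V)"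
    by (elim exE conjE) (rule that)
  have u: "u i \<in> space X.V" if "i \<in> ?I" for i by (rule bspec[OF u0 that])
  have uk: "u (k, j) \<in> space X.V" if "k < L" "j \<in> {..<M}" for k j using u[of "(k, j)"] that by auto
  define aX where "aX k = (\<Sum>j<M. \<Sum>j'<M. X.K (u (k, j)) (u (k, j')))" for k
  define aY where "aY = (\<Sum>i\<in>?I. \<Sum>i'\<in>?I. Y.K (u i) (u i'))"
  define e where "e = (\<Sum>i\<in>?I. (norm2 n (u i))\<^sup>2)"
  have "wX * (\<Sum>k<L. aX k) + wY * aY + wE * e \<le> 5 * \<eta>"
  proof -
    have "(\<Sum>i\<in>?I. d (u i)) + (\<Sum>i\<in>?I. \<Sum>i'\<in>?I - {i}. K i i' (u i) (u i'))
       = (\<Sum>i\<in>?I. wE * (norm2 n (u i))\<^sup>2 + (\<Sum>i'\<in>?I. K i i' (u i) (u i')))"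
      unfolding sum.distrib[symmetric]
    proof (intro sum.cong refl)
      fix i assume "i \<in> ?I"
      then have "(\<Sum>i'\<in>?I. K i i' (u i) (u i')) = K i i (u i) (u i) + (\<Sum>i'\<in>?I - {i}. K i i' (u i) (u i'))"
        by (intro sum.remove) auto
      then show "d (u i) + (\<Sum>i'\<in>?I - {i}. K i i' (u i) (u i')) = wE * (norm2 n (u i))\<^sup>2 + (\<Sum>i'\<in>?I. K i i' (u i) (u i'))"
        by (simp add: d_def K_def)
    qed
    also have "\<dots> = wE * e + (\<Sum>i\<in>?I. \<Sum>i'\<in>?I. if fst i = fst i' then wX * X.K (u i) (u i') else 0) + wY * aY"
      by (simp add: e_def aY_def K_def sum.distrib sum_distrib_left)
    also have "(\<Sum>i\<in>?I. \<Sum>i'\<in>?I. if fst i = fst i' then wX * X.K (u i) (u i') else 0) = wX * (\<Sum>k<L. aX k)"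
    proof -
      have "(\<Sum>k'<L. \<Sum>j'<M. if k = k' then wX * X.K (u (k, j)) (u (k', j')) else 0) = wX * (\<Sum>j'<M. X.K (u (k, j)) (u (k, j')))"
        if "k < L" for k j
      proof -
        have "(\<Sum>k'<L. \<Sum>j'<M. if k = k' then wX * X.K (u (k, j)) (u (k', j')) else 0)
          = (\<Sum>k'<L. if k = k' then wX * (\<Sum>j'<M. X.K (u (k, j)) (u (k, j'))) else 0)"
          by (intro sum.cong) (auto simp: sum_distrib_left)
        then show ?thesis using that by simp
      qed
      then show ?thesis by (simp add: sum.cartesian_product' aX_def sum_distrib_left)
    qed
    finally have "wX * (\<Sum>k<L. aX k) + wY * aY + wE * e \<le> (\<Sum>i\<in>?I. \<integral>u. d u \<partial>X.V)" using le by simp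
    also have "\<dots> \<le> (\<Sum>i\<in>?I. 5 * \<eta> / ?q)" by (intro sum_mono dval)
    also have "\<dots> = 5 * \<eta>" using pos by simp
    finally show ?thesis .
  qed
  moreover have aX0: "0 \<le> aX k" if "k < L" for k
  proof -
    have "has_bochner_integral X.N (\<lambda>x. (\<Sum>j<M. X.c x (u (k, j)))\<^sup>2) (aX k)"
      unfolding aX_def using sizes by (intro X.square_sum_c uk[OF that]) (auto simp: lessThan_empty_iff)
    then show ?thesis
      using Bochner_Integration.integral_nonneg[of X.N "\<lambda>x. (\<Sum>j<M. X.c x (u (k, j)))\<^sup>2"]
      by (simp add: has_bochner_integral_iff)
  qed
  then have "0 \<le> wX * (\<Sum>k<L. aX k)" using w by (intro mult_nonneg_nonneg sum_nonneg) auto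
  moreover have "0 \<le> wY * aY"
  proof -
    have "has_bochner_integral Y.N (\<lambda>x. (\<Sum>i\<in>?I. Y.c x (u i))\<^sup>2) aY"
      unfolding aY_def using sizes by (intro Y.square_sum_c u) (auto simp: lessThan_empty_iff)
    then show ?thesis
      using Bochner_Integration.integral_nonneg[of Y.N "\<lambda>x. (\<Sum>i\<in>?I. Y.c x (u i))\<^sup>2"] w
      by (simp add: has_bochner_integral_iff)
  qed
  moreover have "0 \<le> wE * e" using w unfolding e_def by (intro mult_nonneg_nonneg sum_nonneg) auto
  \<comment> \<open>All three parts are nonnegative, the first two as squared norms, so the bound on
    the sum holds for each of them.\<close>
  ultimately have b: "wX * (\<Sum>k<L. aX k) \<le> 5 * \<eta>" "wY * aY \<le> 5 * \<eta>" "wE * e \<le> 5 * \<eta>" by linarith+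
  show thesis
  proof (rule that[of u])
    show "u i \<in> space (seq_space n)" if "i \<in> ?I" for i using u[OF that] by simp
    have "(\<Sum>k<L. X.defect {..<M} (\<lambda>j. u (k, j))) \<le> (\<Sum>k<L. X.p + \<theta> + aX k / (real M)\<^sup>2 / \<theta>)"
    proof (intro sum_mono)
      fix k assume "k \<in> {..<L}"
      then show "X.defect {..<M} (\<lambda>j. u (k, j)) \<le> X.p + \<theta> + aX k / (real M)\<^sup>2 / \<theta>"
        using X.defect_le[of "{..<M}" "\<lambda>j. u (k, j)" \<theta>] uk[of k] sizes \<theta> by (simp add: aX_def lessThan_empty_iff)
    qed
    also have "\<dots> = real L * (X.p + \<theta> + (wX * (\<Sum>k<L. aX k)) / \<theta>)"
      using pos by (simp add: sum.distrib wX_def distrib_left flip: sum_divide_distrib)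
    also have "\<dots> \<le> real L * (X.p + \<theta> + 5 * \<eta> / \<theta>)"
      using b \<theta> by (intro mult_left_mono add_left_mono divide_right_mono) auto
    finally show "(\<Sum>k<L. X.defect {..<M} (\<lambda>j. u (k, j))) \<le> real L * (4 / (real n * \<epsilon>\<^sup>2) + \<theta> + 5 * \<eta> / \<theta>)"
      unfolding X.p_def .
    have "Y.defect ?I u \<le> Y.p + \<theta> + aY / (real (card ?I))\<^sup>2 / \<theta>"
      unfolding aY_def using sizes by (intro Y.defect_le u \<theta>) (auto simp: lessThan_empty_iff)
    also have "aY / (real (card ?I))\<^sup>2 / \<theta> = wY * aY / \<theta>" by (simp add: wY_def)
    also have "Y.p + \<theta> + wY * aY / \<theta> \<le> Y.p + \<theta> + 5 * \<eta> / \<theta>"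
      using b \<theta> by (intro add_left_mono divide_right_mono) auto
    finally show "Y.defect ?I u \<le> 4 / (real n * \<epsilon>\<^sup>2) + \<theta> + 5 * \<eta> / \<theta>" unfolding Y.p_def .
    have "e \<le> ?q * (5 * (real n)\<^sup>2)"
      using b(3) pos \<eta> by (simp add: wE_def field_simps)
    then show "(\<Sum>k<L. \<Sum>j<M. (norm2 n (u (k, j)))\<^sup>2) \<le> ?q * (5 * (real n)\<^sup>2)"
      by (simp add: e_def sum.cartesian_product')
  qed
qed

text \<open>The encoder is the partition of the source for the given seed, and the decoder draws
  from the matching piece of the output partition. In \<kappa>, 16 = 6 + 2 * 5: the 6 is the energy
  tail in \<open>exact_quantizer\<close>, the 5 the fourth-moment bound of the codebook.\<close>

lemma exists_good_code:
  fixes M L n :: nat and mX sX mY sY \<alpha> \<beta> \<epsilon> \<theta> \<eta> T D \<delta> \<kappa> R Rc :: real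
  assumes n: "n \<ge> 1" and sizes: "M \<ge> 1" "L \<ge> 1" and s: "sX > 0" "sY > 0"
    and \<alpha>: "0 < \<alpha>" "\<alpha> \<le> \<beta>" "\<beta> < 1" and \<epsilon>: "\<epsilon> > 0" and \<theta>: "\<theta> > 0" and \<eta>: "\<eta> > 0" and T: "T > 0"
    and \<tau>X: "gaussian_channel.\<tau> n \<alpha> \<epsilon> \<le> \<eta> * real M"
    and \<tau>Y: "gaussian_channel.\<tau> n \<beta> \<epsilon> \<le> \<eta> * (real L * real M)"
    and M: "real M \<le> exp (R * real n)" and L: "real L \<le> exp (Rc * real n)"
    and \<delta>: "1 - exp (- 2 * R) - \<alpha> \<le> \<delta>" "1 - exp (- 2 * (R + Rc)) - \<beta> \<le> \<delta>" "0 \<le> \<delta>"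
    and D: "D = 4 / (real n * \<epsilon>\<^sup>2) + \<theta> + 5 * \<eta> / \<theta>" and \<kappa>: "\<kappa> = 4 * T * D + 16 / T"
  shows "\<exists>enc dec. gaussian_code n M L enc dec mX sX mY sY \<and>
    real n * (sqrt (\<alpha> * \<beta>) - (3 * \<kappa> + 2 * \<delta>) * sqrt (\<beta> / \<alpha>)) \<le> gaussian_code.corr n M L enc dec mX sX mY sY"
proof -
  interpret X: gaussian_channel n mX sX \<alpha> \<epsilon> by unfold_locales (use n s \<alpha> \<epsilon> in auto)
  interpret Y: gaussian_channel n mY sY \<beta> \<epsilon> by unfold_locales (use n s \<alpha> \<epsilon> in auto)
  let ?I = "{..<L} \<times> {..<M}" and ?q = "real L * real M" and ?n = "real n"
  have pos: "real L > 0" "real M > 0" "?q > 0" "?n > 0" using sizes n by auto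
  have ne: "?I \<noteq> {}" "{..<M} \<noteq> {}" using sizes by (auto simp: lessThan_empty_iff)
  obtain u where u: "\<And>i. i \<in> ?I \<Longrightarrow> u i \<in> space (seq_space n)"
    and dX: "(\<Sum>k<L. X.defect {..<M} (\<lambda>j. u (k, j))) \<le> real L * D"
    and dY: "Y.defect ?I u \<le> D"
    and u4: "(\<Sum>k<L. \<Sum>j<M. (norm2 n (u (k, j)))\<^sup>2) \<le> ?q * (5 * ?n\<^sup>2)"
  proof -
    have 1: "\<alpha> < 1" "0 < \<beta>" using \<alpha> by auto
    show thesis
      by (rule exists_codebook[OF n sizes s \<alpha>(1) 1 \<alpha>(3) \<epsilon> \<theta> \<eta> \<tau>X \<tau>Y, of mX mY, folded D]) (rule that)
  qed
  define PX where "PX k f \<longleftrightarrow> (\<forall>j<M. f j \<in> borel_measurable (seq_space n)) \<and> (\<forall>j x. 0 \<le> f j x) \<and> (\<forall>x. (\<Sum>j<M. f j x) = 1) \<and>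
      (\<forall>j<M. (\<integral>\<^sup>+x. ennreal (f j x) \<partial>X.N) = ennreal (1 / real M)) \<and>
      (\<Sum>j<M. \<integral>\<^sup>+x. ennreal (f j x * X.S (u (k, j)) x) \<partial>X.N)
       \<le> ennreal (?n * (1 - \<alpha>) + 4 * ?n * T * X.defect {..<M} (\<lambda>j. u (k, j)) + 6 * ?n / T
            + 2 / (?n * T) * ((\<Sum>j<M. (norm2 n (u (k, j)))\<^sup>2) / real M))" for k and f :: "nat \<Rightarrow> (nat \<Rightarrow> real) \<Rightarrow> real"
  have "\<exists>f. PX k f" if k: "k < L" for k
  proof -
    have uk: "u (k, j) \<in> space X.V" if "j \<in> {..<M}" for j using u[of "(k, j)"] k that by auto
    obtain f where "\<And>j. j \<in> {..<M} \<Longrightarrow> f j \<in> borel_measurable (seq_space n)"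
      "\<And>j x. 0 \<le> f j x" "\<And>x. (\<Sum>j<M. f j x) = 1"
      "\<And>j. j \<in> {..<M} \<Longrightarrow> (\<integral>\<^sup>+x. ennreal (f j x) \<partial>X.N) = ennreal (1 / real (card {..<M}))"
      "(\<Sum>j<M. \<integral>\<^sup>+x. ennreal (f j x * X.S (u (k, j)) x) \<partial>X.N)
       \<le> ennreal (?n * (1 - \<alpha>) + 4 * ?n * T * X.defect {..<M} (\<lambda>j. u (k, j)) + 6 * ?n / T
            + 2 / (?n * T) * ((\<Sum>j<M. (\<Sum>t<n. (u (k, j) t)\<^sup>2)\<^sup>2) / real (card {..<M})))"
      by (rule X.exact_quantizer[of "{..<M}" "\<lambda>j. u (k, j)" T, OF finite_lessThan ne(2) uk T]) (assumption, rule that)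
    then have "PX k f" unfolding PX_def norm2_def card_lessThan by (intro conjI allI impI) simp_all
    then show ?thesis by blast
  qed
  then obtain fX where "\<And>k. k < L \<Longrightarrow> PX k (fX k)" by metis
  then have fX: "\<And>k j. k < L \<Longrightarrow> j < M \<Longrightarrow> fX k j \<in> borel_measurable (seq_space n)"
    "\<And>k j x. k < L \<Longrightarrow> 0 \<le> fX k j x" "\<And>k x. k < L \<Longrightarrow> (\<Sum>j<M. fX k j x) = 1"
    "\<And>k j. k < L \<Longrightarrow> j < M \<Longrightarrow> (\<integral>\<^sup>+x. ennreal (fX k j x) \<partial>X.N) = ennreal (1 / real M)"
    "\<And>k. k < L \<Longrightarrow> (\<Sum>j<M. \<integral>\<^sup>+x. ennreal (fX k j x * X.S (u (k, j)) x) \<partial>X.N)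
       \<le> ennreal (?n * (1 - \<alpha>) + 4 * ?n * T * X.defect {..<M} (\<lambda>j. u (k, j)) + 6 * ?n / T
            + 2 / (?n * T) * ((\<Sum>j<M. (norm2 n (u (k, j)))\<^sup>2) / real M))"
    unfolding PX_def by blast+
  obtain fY where fY: "\<And>i. i \<in> ?I \<Longrightarrow> fY i \<in> borel_measurable (seq_space n)"
    "\<And>i x. 0 \<le> fY i x" "\<And>x. (\<Sum>i\<in>?I. fY i x) = 1"
    "\<And>i. i \<in> ?I \<Longrightarrow> (\<integral>\<^sup>+x. ennreal (fY i x) \<partial>Y.N) = ennreal (1 / real (card ?I))"
    "(\<Sum>i\<in>?I. \<integral>\<^sup>+x. ennreal (fY i x * Y.S (u i) x) \<partial>Y.N)
       \<le> ennreal (?n * (1 - \<beta>) + 4 * ?n * T * Y.defect ?I u + 6 * ?n / T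
            + 2 / (?n * T) * ((\<Sum>i\<in>?I. (\<Sum>t<n. (u i t)\<^sup>2)\<^sup>2) / real (card ?I)))"
  proof -
    have u': "u i \<in> space Y.V" if "i \<in> ?I" for i using u[OF that] by simp
    show thesis
      by (rule Y.exact_quantizer[of ?I u T, OF finite_cartesian_product[OF finite_lessThan finite_lessThan] ne(1) u' T])
        (assumption, rule that)
  qed
  define enc where "enc k x j = fX k j x" for k x j
  \<comment> \<open>The factor \<open>?q\<close> normalises a piece of mass \<open>1 / ?q\<close>.
    Pairs of seed and message also have probability \<open>1 / ?q\<close>, because the source pieces
    all have weight \<open>1 / M\<close>, so the pieces reassemble exactly.\<close>
  define dec where "dec j k = density Y.N (\<lambda>y. ennreal (?q * fY (k, j) y))" for j k
  have emeasure_dec: "emeasure (dec j k) A = ennreal ?q * (\<integral>\<^sup>+y. ennreal (fY (k, j) y) * indicator A y \<partial>Y.N)"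
    if [simp]: "k < L" "j < M" and [measurable]: "A \<in> sets (seq_space n)" for j k A
  proof -
    have [measurable]: "fY (k, j) \<in> borel_measurable (seq_space n)" using fY(1)[of "(k, j)"] by simp
    have "emeasure (dec j k) A = (\<integral>\<^sup>+y. ennreal (?q * fY (k, j) y) * indicator A y \<partial>Y.N)"
      unfolding dec_def by (subst emeasure_density) auto
    also have "\<dots> = (\<integral>\<^sup>+y. ennreal ?q * (ennreal (fY (k, j) y) * indicator A y) \<partial>Y.N)"
      using fY(2) pos by (intro nn_integral_cong) (simp add: ennreal_mult mult.assoc)
    also have "\<dots> = ennreal ?q * (\<integral>\<^sup>+y. ennreal (fY (k, j) y) * indicator A y \<partial>Y.N)"
      by (rule nn_integral_cmult) measurable
    finally show ?thesis .
  qed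
  have code: "gaussian_code n M L enc dec mX sX mY sY"
  proof
    show "valid_code n M L enc dec"
      unfolding valid_code_def
    proof (intro conjI allI impI)
      fix j k assume jk: "j < M" "k < L"
      show "prob_space (dec j k)"
      proof
        have "emeasure (dec j k) (space (seq_space n)) = ennreal ?q * (\<integral>\<^sup>+y. ennreal (fY (k, j) y) \<partial>Y.N)"
          unfolding emeasure_dec[OF jk(2,1) sets.top]
          by (intro arg_cong2[where f = times] refl nn_integral_cong) auto
        also have "\<dots> = 1" using fY(4)[of "(k, j)"] jk pos by (simp flip: ennreal_mult')
        finally show "emeasure (dec j k) (space (dec j k)) = 1" by (simp add: dec_def)
      qed
      show "sets (dec j k) = sets (seq_space n)" by (simp add: dec_def)
    qed (use n sizes fX in \<open>auto simp: enc_def\<close>)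
    fix A assume A [measurable]: "A \<in> sets (seq_space n)"
    have "code_output (gaussian mX sX) n M L enc dec A
      = (\<Sum>i\<in>?I. \<integral>\<^sup>+y. ennreal (fY i y) * indicator A y \<partial>Y.N)"
      unfolding code_output_def iid_gaussian sum.cartesian_product
    proof (intro sum.cong refl)
      fix i assume i: "i \<in> ?I"
      obtain k j where kj: "i = (k, j)" by (cases i)
      have "ennreal (1 / real L) * ennreal (1 / real M) * ennreal ?q = 1"
        using pos by (simp flip: ennreal_mult')
      then show "(case i of (k, j) \<Rightarrow> ennreal (1 / real L) * (\<integral>\<^sup>+x. ennreal (enc k x j) \<partial>X.N) * emeasure (dec j k) A)
        = (\<integral>\<^sup>+y. ennreal (fY i y) * indicator A y \<partial>Y.N)"
        using i A unfolding kj enc_def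
        by (simp add: emeasure_dec fX(4) flip: mult.assoc)
    qed
    also have "\<dots> = (\<integral>\<^sup>+y. (\<Sum>i\<in>?I. ennreal (fY i y) * indicator A y) \<partial>Y.N)"
    proof (intro nn_integral_sum[symmetric])
      fix i assume "i \<in> ?I"
      from fY(1)[OF this] have [measurable]: "fY i \<in> borel_measurable (seq_space n)" .
      show "(\<lambda>y. ennreal (fY i y) * indicator A y) \<in> borel_measurable Y.N" by measurable
    qed
    also have "\<dots> = (\<integral>\<^sup>+y. indicator A y \<partial>Y.N)"
      by (intro nn_integral_cong) (simp add: sum_ennreal fY(2,3) flip: sum_distrib_right)
    finally show "code_output (gaussian mX sX) n M L enc dec A = emeasure (iid n (gaussian mY sY)) A"
      by (simp add: iid_gaussian)
  qed (use s in auto)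
  interpret C: gaussian_code n M L enc dec mX sX mY sY by (rule code)
  have D0: "D \<ge> 0" unfolding D using pos \<theta> \<eta> \<epsilon> by simp
  have \<kappa>0: "\<kappa> \<ge> 0" unfolding \<kappa> using D0 T by simp
  have "real n * (sqrt (\<alpha> * \<beta>) - (3 * \<kappa> + 2 * \<delta>) * sqrt (\<beta> / \<alpha>)) \<le> C.corr"
  proof (rule C.corr_ge[where u = u, OF M L \<alpha>(1,2) \<delta>(1,2) _ \<kappa>0])
    show "0 \<le> \<delta> + \<kappa>" using \<delta> \<kappa>0 by simp
    have nonneg: "0 \<le> X.defect {..<M} (\<lambda>j. u (k, j))" if "k < L" for k
      by (rule X.defect_nonneg[of "{..<M}" "\<lambda>j. u (k, j)"]) (use u that ne in auto)
    have "(\<Sum>j<M. \<integral>x. X.S (u (k, j)) x \<partial>C.\<nu>X k j) \<le> ?n * (1 - \<alpha>) + 4 * ?n * T * X.defect {..<M} (\<lambda>j. u (k, j)) + 6 * ?n / T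
            + 2 / (?n * T) * ((\<Sum>j<M. (norm2 n (u (k, j)))\<^sup>2) / real M)" if k: "k < L" for k
    proof -
      interpret G: gaussian_splitting n mX sX "{..<M}" "C.\<nu>X k" by (rule C.splitting_X[OF k])
      have "ennreal (\<Sum>j<M. \<integral>x. X.S (u (k, j)) x \<partial>C.\<nu>X k j) = (\<Sum>j<M. \<integral>\<^sup>+x. ennreal (X.S (u (k, j)) x) \<partial>C.\<nu>X k j)"
        using G.integral_sqdist(1) by (subst sum_ennreal[symmetric]) (auto simp: nn_integral_eq_integral)
      also have "\<dots> = (\<Sum>j<M. \<integral>\<^sup>+x. ennreal (fX k j x * X.S (u (k, j)) x) \<partial>X.N)"
        using fX(1,2) k unfolding C.\<nu>X_def enc_def
        by (intro sum.cong refl, subst nn_integral_density) (auto simp: ennreal_mult)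
      also have "\<dots> \<le> ennreal (?n * (1 - \<alpha>) + 4 * ?n * T * X.defect {..<M} (\<lambda>j. u (k, j)) + 6 * ?n / T
            + 2 / (?n * T) * ((\<Sum>j<M. (norm2 n (u (k, j)))\<^sup>2) / real M))" by (rule fX(5)[OF k])
      finally show ?thesis
        using pos T \<alpha> nonneg[OF k] by (subst (asm) ennreal_le_iff) (auto intro!: add_nonneg_nonneg mult_nonneg_nonneg divide_nonneg_nonneg sum_nonneg)
    qed
    then have "(\<Sum>k<L. \<Sum>j<M. \<integral>x. X.S (u (k, j)) x \<partial>C.\<nu>X k j)
      \<le> (\<Sum>k<L. ?n * (1 - \<alpha>) + 4 * ?n * T * X.defect {..<M} (\<lambda>j. u (k, j)) + 6 * ?n / T
            + 2 / (?n * T) * ((\<Sum>j<M. (norm2 n (u (k, j)))\<^sup>2) / real M))"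
      by (intro sum_mono) auto
    also have "\<dots> = real L * (?n * (1 - \<alpha>)) + 4 * ?n * T * (\<Sum>k<L. X.defect {..<M} (\<lambda>j. u (k, j))) + real L * (6 * ?n / T)
        + 2 / (?n * T) * ((\<Sum>k<L. \<Sum>j<M. (norm2 n (u (k, j)))\<^sup>2) / real M)"
      by (simp add: sum.distrib flip: sum_distrib_left sum_divide_distrib)
    also have "\<dots> \<le> real L * (?n * (1 - \<alpha>)) + 4 * ?n * T * (real L * D) + real L * (6 * ?n / T)
        + 2 / (?n * T) * (?q * (5 * ?n\<^sup>2) / real M)"
      using pos T by (intro add_mono order_refl mult_left_mono divide_right_mono dX u4) auto
    also have "\<dots> = real L * (?n * (1 - \<alpha> + \<kappa>))"
      using pos T by (simp add: \<kappa> field_simps power2_eq_square)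
    finally show "(\<Sum>k<L. \<Sum>j<M. \<integral>x. X.S (u (k, j)) x \<partial>C.\<nu>X k j) \<le> real L * (?n * (1 - \<alpha> + \<kappa>))" .
    have "ennreal (\<Sum>i\<in>?I. \<integral>y. Y.S (u i) y \<partial>C.\<nu>Y i) = (\<Sum>i\<in>?I. \<integral>\<^sup>+y. ennreal (Y.S (u i) y) \<partial>C.\<nu>Y i)"
      using C.Y.integral_sqdist(1) by (subst sum_ennreal[symmetric]) (auto simp: nn_integral_eq_integral)
    also have "\<dots> = (\<Sum>i\<in>?I. \<integral>\<^sup>+y. ennreal (fY i y * Y.S (u i) y) \<partial>Y.N)"
    proof (intro sum.cong refl)
      fix i assume i: "i \<in> ?I"
      obtain k j where kj: "i = (k, j)" by (cases i)
      have kj': "k < L" "j < M" using i kj by auto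
      have [measurable]: "fY (k, j) \<in> borel_measurable (seq_space n)" using fY(1)[OF i] kj by simp
      have "ennreal (C.wX k j) = ennreal (1 / real M)"
        using C.wX_eq[OF kj'] fX(4)[OF kj'] by (simp add: enc_def)
      then have "C.wX k j = 1 / real M"
        using gaussian_splitting.mass_nonneg[OF C.splitting_X[OF kj'(1)]] by (subst (asm) ennreal_inj) auto
      then have pkj: "C.p k j = 1 / ?q" by (simp add: C.p_def)
      have "(\<integral>\<^sup>+y. ennreal (Y.S (u i) y) \<partial>C.\<nu>Y i) = (\<integral>\<^sup>+y. ennreal (C.p k j) * ennreal (Y.S (u i) y) \<partial>dec j k)"
        unfolding C.\<nu>Y_def kj by (simp, subst nn_integral_density) (auto simp: dec_def)
      also have "\<dots> = (\<integral>\<^sup>+y. ennreal (?q * fY (k, j) y) * (ennreal (C.p k j) * ennreal (Y.S (u i) y)) \<partial>Y.N)"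
        unfolding dec_def by (subst nn_integral_density) auto
      also have "\<dots> = (\<integral>\<^sup>+y. ennreal (fY i y * Y.S (u i) y) \<partial>Y.N)"
        using pos fY(2) unfolding pkj kj by (intro nn_integral_cong) (simp add: ennreal_mult'[symmetric])
      finally show "(\<integral>\<^sup>+y. ennreal (Y.S (u i) y) \<partial>C.\<nu>Y i) = (\<integral>\<^sup>+y. ennreal (fY i y * Y.S (u i) y) \<partial>Y.N)" .
    qed
    also have "\<dots> \<le> ennreal (?n * (1 - \<beta>) + 4 * ?n * T * Y.defect ?I u + 6 * ?n / T
            + 2 / (?n * T) * ((\<Sum>i\<in>?I. (\<Sum>t<n. (u i t)\<^sup>2)\<^sup>2) / real (card ?I)))" by (rule fY(5))
    also have "\<dots> \<le> ennreal (?n * (1 - \<beta> + \<kappa>))"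
    proof (rule ennreal_leI)
      have "(\<Sum>i\<in>?I. (\<Sum>t<n. (u i t)\<^sup>2)\<^sup>2) / real (card ?I) \<le> ?q * (5 * ?n\<^sup>2) / ?q"
        using divide_right_mono[OF u4, of ?q] pos by (simp add: norm2_def sum.cartesian_product')
      then have "?n * (1 - \<beta>) + 4 * ?n * T * Y.defect ?I u + 6 * ?n / T
            + 2 / (?n * T) * ((\<Sum>i\<in>?I. (\<Sum>t<n. (u i t)\<^sup>2)\<^sup>2) / real (card ?I))
         \<le> ?n * (1 - \<beta>) + 4 * ?n * T * D + 6 * ?n / T + 2 / (?n * T) * (?q * (5 * ?n\<^sup>2) / ?q)"
        using pos T by (intro add_mono order_refl mult_left_mono dY) auto
      also have "\<dots> = ?n * (1 - \<beta> + \<kappa>)" using pos T by (simp add: \<kappa> field_simps power2_eq_square)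
      finally show "?n * (1 - \<beta>) + 4 * ?n * T * Y.defect ?I u + 6 * ?n / T
            + 2 / (?n * T) * ((\<Sum>i\<in>?I. (\<Sum>t<n. (u i t)\<^sup>2)\<^sup>2) / real (card ?I)) \<le> ?n * (1 - \<beta> + \<kappa>)" .
    qed
    finally show "(\<Sum>i\<in>?I. \<integral>y. Y.S (u i) y \<partial>C.\<nu>Y i) \<le> ?n * (1 - \<beta> + \<kappa>)"
      using pos \<kappa>0 \<alpha> by (subst (asm) ennreal_le_iff) auto
  qed
  then show ?thesis using code by blast
qed

section \<open>The distortion-rate function\<close>

text \<open>This is the exponential of n times mutual information plus \<epsilon>, the form that is
  compared with the rates.\<close>

lemma (in gaussian_channel) \<tau>_eq: "\<tau> = exp (real n * (\<epsilon> - ln (1 - \<alpha>) / 2))"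
proof -
  have "v = exp (ln (1 - \<alpha>) / 2)"
    using \<alpha> by (simp add: ln_sqrt[symmetric])
  then have "1 / v = exp (- ln (1 - \<alpha>) / 2)"
    by (simp add: exp_minus field_simps)
  then show ?thesis
    by (simp add: \<tau>_def exp_of_nat_mult[symmetric] exp_add[symmetric] algebra_simps)
qed

lemma exists_code_near_optimum:
  fixes R Rc mX sX mY sY e :: real
  assumes s: "sX > 0" "sY > 0" and R: "R > 0" "Rc \<ge> 0" and e: "e > 0"
  shows "\<exists>n M L enc dec. gaussian_code n M L enc dec mX sX mY sY \<and> ln (real M) / real n \<le> R \<and> ln (real L) / real n \<le> Rc \<and>
    real n * (xi R Rc - e) \<le> gaussian_code.corr n M L enc dec mX sX mY sY"
proof -
  define a b where "a = 1 - exp (- 2 * R)" and "b = 1 - exp (- 2 * (R + Rc))"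
  have ab: "0 < a" "a \<le> b" "b < 1" using R by (auto simp: a_def b_def)
  \<comment> \<open>The correlation per coordinate promised by \<open>exists_good_code\<close> when
    both parameters are lowered by \<open>t\<close>: then \<delta> = t and \<kappa> \<le> t, so 3
    \<kappa> + 2 \<delta> is at most 5 t.\<close>
  define h where "h t = sqrt ((a - t) * (b - t)) - 5 * t * sqrt ((b - t) / (a - t))" for t
  have "(h \<longlongrightarrow> sqrt ((a - 0) * (b - 0)) - 5 * 0 * sqrt ((b - 0) / (a - 0))) (at_right 0)"
    unfolding h_def using ab by (intro tendsto_intros) auto
  then have "(h \<longlongrightarrow> xi R Rc) (at_right 0)" by (simp add: xi_def a_def b_def)
  then have "eventually (\<lambda>t. xi R Rc - e < h t) (at_right 0)"
    using e by (intro order_tendstoD) auto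
  moreover have "eventually (\<lambda>t. t < a) (at_right 0)"
    using ab(1) by (intro order_tendstoD[OF tendsto_ident_at]) 
  moreover have "eventually (\<lambda>t. 0 < t) (at_right (0::real))"
    by (rule eventually_at_right_less)
  ultimately have "eventually (\<lambda>t. xi R Rc - e < h t \<and> t < a \<and> 0 < t) (at_right 0)"
    by eventually_elim simp
  then obtain t where t: "xi R Rc - e < h t" "t < a" "0 < t"
    using eventually_happens'[of "at_right (0::real)"] by auto
  define \<alpha> \<beta> where "\<alpha> = a - t" and "\<beta> = b - t"
  have \<alpha>\<beta>: "0 < \<alpha>" "\<alpha> \<le> \<beta>" "\<beta> < 1" "\<alpha> < 1" using ab t by (auto simp: \<alpha>_def \<beta>_def)
  have cap: "0 < R + ln (1 - \<alpha>) / 2" "0 < R + Rc + ln (1 - \<beta>) / 2"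
  proof -
    have "ln (exp (- 2 * R)) < ln (1 - \<alpha>)" "ln (exp (- 2 * (R + Rc))) < ln (1 - \<beta>)"
      using \<alpha>\<beta> t by (subst ln_less_cancel_iff; simp add: \<alpha>_def \<beta>_def a_def b_def)+
    then show "0 < R + ln (1 - \<alpha>) / 2" "0 < R + Rc + ln (1 - \<beta>) / 2" by auto
  qed
  \<comment> \<open>Half of the smaller rate surplus: the other half leaves a factor exp (- n
    \<epsilon>) between \<tau> and the number of codewords.\<close>
  define \<epsilon> where "\<epsilon> = min (R + ln (1 - \<alpha>) / 2) (R + Rc + ln (1 - \<beta>) / 2) / 2"
  have \<epsilon>: "\<epsilon> > 0" "\<epsilon> - ln (1 - \<alpha>) / 2 \<le> R - \<epsilon>" "\<epsilon> - ln (1 - \<beta>) / 2 \<le> R + Rc - \<epsilon>"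
    using cap by (auto simp: \<epsilon>_def min_def field_simps)
  \<comment> \<open>Then 16 / T = t / 2 and 5 \<eta> / \<theta> = \<theta>; once \<open>D\<close> is
    at most 3 \<theta>, the term 4 T D is at most 3 t / 8, and \<kappa> stays below t.\<close>
  define T \<theta> \<eta> where "T = 32 / t" and "\<theta> = t / (32 * T)" and "\<eta> = \<theta>\<^sup>2 / 5"
  have T: "T > 0" and \<theta>: "\<theta> > 0" and \<eta>: "\<eta> > 0" using t by (auto simp: T_def \<theta>_def \<eta>_def)
  \<comment> \<open>The first term yields exp (- n \<epsilon>) \<le> \<eta> / 4, where 4 absorbs the
    rounding of \<open>M\<close> and \<open>L\<close> by a factor 2 each; the second makes the
    atypical mass at most \<theta>.\<close>
  obtain n where n: "4 / (\<eta> * \<epsilon>) + 4 / (\<epsilon>\<^sup>2 * \<theta>) + 1 < real n" using reals_Archimedean2 by blast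
  have pos: "0 < 4 / (\<eta> * \<epsilon>)" "0 < 4 / (\<epsilon>\<^sup>2 * \<theta>)" using \<eta> \<theta> \<epsilon> by auto
  have "1 < real n" using n pos by linarith
  moreover have "4 / (\<eta> * \<epsilon>) < real n" "4 / (\<epsilon>\<^sup>2 * \<theta>) < real n" using n pos by linarith+
  ultimately have n1: "n \<ge> 1" "4 / (\<eta> * \<epsilon>) < real n" "4 / (\<epsilon>\<^sup>2 * \<theta>) < real n" by auto
  have dec: "exp (- (real n * \<epsilon>)) \<le> \<eta> / 4"
  proof -
    have "4 / \<eta> \<le> real n * \<epsilon>" using n1(2) \<eta> \<epsilon> by (simp add: field_simps)
    also have "\<dots> \<le> exp (real n * \<epsilon>)" using exp_ge_add_one_self[of "real n * \<epsilon>"] by linarith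
    finally show ?thesis using \<eta> by (simp add: exp_minus field_simps)
  qed
  define M L where "M = nat \<lfloor>exp (R * real n)\<rfloor>" and "L = nat \<lfloor>exp (Rc * real n)\<rfloor>"
  have floor: "real (nat \<lfloor>x\<rfloor>) \<le> x" "x / 2 \<le> real (nat \<lfloor>x\<rfloor>)" "1 \<le> nat \<lfloor>x\<rfloor>" if "1 \<le> x" for x :: real
  proof -
    have "1 \<le> \<lfloor>x\<rfloor>" using that by simp
    moreover from this have "real (nat \<lfloor>x\<rfloor>) = of_int \<lfloor>x\<rfloor>" by simp
    ultimately show "real (nat \<lfloor>x\<rfloor>) \<le> x" "x / 2 \<le> real (nat \<lfloor>x\<rfloor>)" "1 \<le> nat \<lfloor>x\<rfloor>"
      using floor_correct[of x] by linarith+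
  qed
  have ge1: "1 \<le> exp (R * real n)" "1 \<le> exp (Rc * real n)" using R by auto
  note M = floor[OF ge1(1), folded M_def] and L = floor[OF ge1(2), folded L_def]
  define D where "D = 4 / (real n * \<epsilon>\<^sup>2) + \<theta> + 5 * \<eta> / \<theta>"
  define \<kappa> where "\<kappa> = 4 * T * D + 16 / T"
  have \<tau>X: "gaussian_channel.\<tau> n \<alpha> \<epsilon> \<le> \<eta> * real M"
  proof -
    have "gaussian_channel n sX \<alpha> \<epsilon>" by unfold_locales (use n1 s \<alpha>\<beta> \<epsilon> in auto)
    then have "gaussian_channel.\<tau> n \<alpha> \<epsilon> = exp (real n * (\<epsilon> - ln (1 - \<alpha>) / 2))"
      by (rule gaussian_channel.\<tau>_eq)
    also have "\<dots> \<le> exp (real n * (R - \<epsilon>))" using \<epsilon>(2) by (simp add: mult_left_mono)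
    also have "\<dots> = exp (- (real n * \<epsilon>)) * exp (R * real n)" by (simp add: exp_add[symmetric] algebra_simps)
    also have "\<dots> \<le> \<eta> / 4 * (2 * real M)" using dec M(2) \<eta> by (intro mult_mono) auto
    also have "\<dots> \<le> \<eta> * real M" using \<eta> by simp
    finally show ?thesis .
  qed
  have \<tau>Y: "gaussian_channel.\<tau> n \<beta> \<epsilon> \<le> \<eta> * (real L * real M)"
  proof -
    have "gaussian_channel n sX \<beta> \<epsilon>" by unfold_locales (use n1 s \<alpha>\<beta> \<epsilon> in auto)
    then have "gaussian_channel.\<tau> n \<beta> \<epsilon> = exp (real n * (\<epsilon> - ln (1 - \<beta>) / 2))"
      by (rule gaussian_channel.\<tau>_eq)
    also have "\<dots> \<le> exp (real n * (R + Rc - \<epsilon>))" using \<epsilon>(3) by (simp add: mult_left_mono)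
    also have "\<dots> = exp (- (real n * \<epsilon>)) * (exp (Rc * real n) * exp (R * real n))" by (simp add: exp_add[symmetric] algebra_simps)
    also have "\<dots> \<le> \<eta> / 4 * ((2 * real L) * (2 * real M))" using dec M(2) L(2) \<eta> by (intro mult_mono) auto
    also have "\<dots> = \<eta> * (real L * real M)" by simp
    finally show ?thesis .
  qed
  have "\<kappa> \<le> t"
  proof -
    have "4 / (real n * \<epsilon>\<^sup>2) \<le> \<theta>" using n1 \<epsilon> \<theta> by (simp add: field_simps)
    moreover have "5 * \<eta> / \<theta> = \<theta>" using \<theta> by (simp add: \<eta>_def power2_eq_square)
    ultimately have "D \<le> 3 * \<theta>" unfolding D_def by linarith
    then have "4 * T * D \<le> 4 * T * (3 * \<theta>)" using T by (intro mult_left_mono) auto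
    also have "\<dots> = 3 * t / 8" using T by (simp add: \<theta>_def)
    finally show ?thesis using t unfolding \<kappa>_def by (simp add: T_def)
  qed
  have \<delta>: "1 - exp (- 2 * R) - \<alpha> \<le> t" "1 - exp (- 2 * (R + Rc)) - \<beta> \<le> t" "0 \<le> t"
    using t by (simp_all add: \<alpha>_def \<beta>_def a_def b_def)
  obtain enc dec where code: "gaussian_code n M L enc dec mX sX mY sY"
    and corr: "real n * (sqrt (\<alpha> * \<beta>) - (3 * \<kappa> + 2 * t) * sqrt (\<beta> / \<alpha>)) \<le> gaussian_code.corr n M L enc dec mX sX mY sY"
    using exists_good_code[OF n1(1) M(3) L(3) s \<alpha>\<beta>(1-3) \<epsilon>(1) \<theta> \<eta> T \<tau>X \<tau>Y M(1) L(1) \<delta> D_def \<kappa>_def, of mX mY]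
    by (elim exE conjE) (rule that)
  have "xi R Rc - e \<le> sqrt (\<alpha> * \<beta>) - (5 * t) * sqrt (\<beta> / \<alpha>)"
    using t(1) by (simp add: h_def \<alpha>_def \<beta>_def)
  also have "\<dots> \<le> sqrt (\<alpha> * \<beta>) - (3 * \<kappa> + 2 * t) * sqrt (\<beta> / \<alpha>)"
    using \<open>\<kappa> \<le> t\<close> \<alpha>\<beta> by (intro diff_left_mono mult_right_mono) auto
  finally have "real n * (xi R Rc - e) \<le> gaussian_code.corr n M L enc dec mX sX mY sY"
    by (intro order_trans[OF mult_left_mono corr]) auto
  moreover have "ln (real M) / real n \<le> R" "ln (real L) / real n \<le> Rc"
    using ln_mono[OF M(1)] ln_mono[OF L(1)] M(3) L(3) n1(1) by (auto simp: field_simps)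
  ultimately show ?thesis using code by blast
qed

text \<open>With a single message the only centroid of the source is its mean. This treats R = 0,
  where \<open>xi\<close> is 0 and no positive \<alpha> lies below the limit.\<close>

lemma exists_code_rate_zero:
  fixes mX sX mY sY :: real
  assumes s: "sX > 0" "sY > 0"
  shows "\<exists>enc dec. gaussian_code 1 1 1 enc dec mX sX mY sY \<and> gaussian_code.corr 1 1 1 enc dec mX sX mY sY = 0"
proof -
  define enc where "enc = (\<lambda>(k :: nat) (x :: nat \<Rightarrow> real) (j :: nat). 1 :: real)"
  define dec where "dec = (\<lambda>(j :: nat) (k :: nat). gprod 1 (\<lambda>_. mY) sY)"
  have code: "gaussian_code 1 1 1 enc dec mX sX mY sY"
  proof
    show "valid_code 1 1 1 enc dec"
      unfolding valid_code_def enc_def dec_def using s by (auto intro: prob_space_gprod)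
    fix A assume "A \<in> sets (seq_space 1)"
    show "code_output (gaussian mX sX) 1 1 1 enc dec A = emeasure (iid 1 (gaussian mY sY)) A"
      using prob_space.emeasure_space_1[OF prob_space_gprod[OF s(1)], of 1 "\<lambda>_. mX"]
      by (simp add: code_output_def enc_def dec_def iid_gaussian)
  qed (use s in auto)
  interpret C: gaussian_code 1 1 1 enc dec mX sX mY sY by (rule code)
  have "C.aX 0 0 0 = 0"
  proof -
    interpret X: gaussian_splitting 1 mX sX "{..<1}" "C.\<nu>X 0" by (rule C.splitting_X) simp
    show ?thesis unfolding X.centroid_def using X.sum_moment[of 0] by simp
  qed
  then have "C.corr = 0" unfolding C.corr_def by simp
  then show ?thesis using code by blast
qed

theorem theorem2:
  fixes \<mu>X \<mu>Xh \<sigma>X \<sigma>Xh R Rc :: real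
  assumes "\<sigma>X > 0" "\<sigma>Xh > 0" "R \<ge> 0" "Rc \<ge> 0"
  shows "DRF (\<lambda>x xh. (x - xh)\<^sup>2) R Rc (gaussian \<mu>X \<sigma>X) (gaussian \<mu>Xh \<sigma>Xh)
         = (\<mu>X - \<mu>Xh)\<^sup>2 + \<sigma>X\<^sup>2 + \<sigma>Xh\<^sup>2 - 2 * \<sigma>X * \<sigma>Xh * xi R Rc"
proof -
  define B where "B = (\<mu>X - \<mu>Xh)\<^sup>2 + \<sigma>X\<^sup>2 + \<sigma>Xh\<^sup>2"
  define c where "c = 2 * \<sigma>X * \<sigma>Xh"
  let ?ach = "\<lambda>D. achievable (\<lambda>x xh. (x - xh)\<^sup>2) D R Rc (gaussian \<mu>X \<sigma>X) (gaussian \<mu>Xh \<sigma>Xh)"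
  have c: "c > 0" using assms by (simp add: c_def)
  have "xi R Rc < 1"
  proof -
    have "(1 - exp (-2*R)) * (1 - exp (-2*(R+Rc))) \<le> (1 - exp (-2*R)) * 1"
      using assms by (intro mult_left_mono) auto
    also have "\<dots> < 1" by simp
    finally show ?thesis by (simp add: xi_def)
  qed
  \<comment> \<open>\<open>ennreal\<close> maps negative reals to 0, so a comparison of distortions
    carries over to real numbers only if the smaller one is positive. Strictness comes from
    \<open>xi R Rc < 1\<close>.\<close>
  have pos: "0 < B - c * xi R Rc"
  proof -
    have "c * xi R Rc < c * 1" using \<open>xi R Rc < 1\<close> c by (intro mult_strict_left_mono)
    moreover have "c \<le> \<sigma>X\<^sup>2 + \<sigma>Xh\<^sup>2" unfolding c_def by (rule sum_squares_bound)
    moreover have "0 \<le> (\<mu>X - \<mu>Xh)\<^sup>2" by simp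
    ultimately show ?thesis unfolding B_def by linarith
  qed
  have lower: "B - c * xi R Rc \<le> D" if "?ach D" for D
  proof -
    obtain n M L enc dec where valid: "valid_code n M L enc dec"
      and rates: "ln (real M) / real n \<le> R" "ln (real L) / real n \<le> Rc"
      and dist: "code_distortion (\<lambda>x xh. (x - xh)\<^sup>2) (gaussian \<mu>X \<sigma>X) n M L enc dec \<le> ennreal (real n * D)"
      and out: "\<forall>A\<in>sets (seq_space n). code_output (gaussian \<mu>X \<sigma>X) n M L enc dec A = emeasure (iid n (gaussian \<mu>Xh \<sigma>Xh)) A"
      using \<open>?ach D\<close> unfolding achievable_def by blast
    interpret gaussian_code n M L enc dec \<mu>X \<sigma>X \<mu>Xh \<sigma>Xh
      by unfold_locales (use valid assms out in auto)
    have n: "real n > 0" "real M > 0" "real L > 0" using nML by auto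
    have "ln (real M) \<le> R * real n" "ln (real L) \<le> Rc * real n"
      using rates n by (simp_all add: field_simps)
    then have "real M \<le> exp (R * real n)" "real L \<le> exp (Rc * real n)"
      using n by (metis exp_le_cancel_iff exp_ln)+
    then have "corr \<le> real n * xi R Rc" unfolding xi_def by (rule corr_le)
    then have "c * corr \<le> c * (real n * xi R Rc)" using c by (intro mult_left_mono) auto
    then have le: "real n * (B - c * xi R Rc) \<le> real n * B - c * corr" by (simp add: algebra_simps)
    then have "0 < real n * B - c * corr" using pos n by (meson less_le_trans mult_pos_pos)
    moreover have "ennreal (real n * B - c * corr) \<le> ennreal (real n * D)"
      using dist unfolding code_distortion_eq B_def c_def .
    ultimately have "real n * B - c * corr \<le> real n * D"
      by (simp add: ennreal_le_iff2)
    then have "real n * (B - c * xi R Rc) \<le> real n * D" using le by linarith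
    then show ?thesis using n by simp
  qed
  have upper: "\<exists>D. ?ach D \<and> D \<le> B - c * xi R Rc + e" if e: "e > 0" for e
  proof -
    have "\<exists>n M L enc dec. gaussian_code n M L enc dec \<mu>X \<sigma>X \<mu>Xh \<sigma>Xh \<and> ln (real M) / real n \<le> R \<and> ln (real L) / real n \<le> Rc \<and>
      real n * (xi R Rc - e / c) \<le> gaussian_code.corr n M L enc dec \<mu>X \<sigma>X \<mu>Xh \<sigma>Xh"
    proof (cases "R = 0")
      case True
      then have "xi R Rc - e / c \<le> 0" using e c by (simp add: xi_def)
      moreover obtain enc dec where "gaussian_code 1 1 1 enc dec \<mu>X \<sigma>X \<mu>Xh \<sigma>Xh"
        "gaussian_code.corr 1 1 1 enc dec \<mu>X \<sigma>X \<mu>Xh \<sigma>Xh = 0"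
        using exists_code_rate_zero[OF assms(1,2)] by blast
      ultimately show ?thesis
        using assms
        by (intro exI[of _ 1] exI[of _ enc] exI[of _ dec] conjI) (simp_all del: One_nat_def)
    next
      case False
      then show ?thesis using assms e c by (intro exists_code_near_optimum) auto
    qed
    then obtain n M L enc dec where code: "gaussian_code n M L enc dec \<mu>X \<sigma>X \<mu>Xh \<sigma>Xh"
      and rates: "ln (real M) / real n \<le> R" "ln (real L) / real n \<le> Rc"
      and corr: "real n * (xi R Rc - e / c) \<le> gaussian_code.corr n M L enc dec \<mu>X \<sigma>X \<mu>Xh \<sigma>Xh"
      by blast
    interpret gaussian_code n M L enc dec \<mu>X \<sigma>X \<mu>Xh \<sigma>Xh by (rule code)
    have n: "real n > 0" using nML by auto
    define D where "D = B - c * (corr / real n)"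
    have "real n * D = real n * B - c * corr" using n by (simp add: D_def field_simps)
    then have "?ach D"
      unfolding achievable_def using valid rates output_law code_distortion_eq
      by (intro exI[of _ n] exI[of _ M] exI[of _ L] exI[of _ enc] exI[of _ dec]) (simp add: B_def c_def)
    moreover have "D \<le> B - c * xi R Rc + e"
    proof -
      have "xi R Rc - e / c \<le> corr / real n" using corr n by (simp add: field_simps)
      then have "c * (xi R Rc - e / c) \<le> c * (corr / real n)" using c by (intro mult_left_mono) auto
      moreover have "c * (xi R Rc - e / c) = c * xi R Rc - e" using c by (simp add: field_simps)
      ultimately show ?thesis unfolding D_def by linarith
    qed
    ultimately show ?thesis by blast
  qed
  have "Inf {D. ?ach D} = B - c * xi R Rc"
  proof (rule cInf_eq_non_empty)
    show "{D. ?ach D} \<noteq> {}" using upper[of 1] by auto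
    show "B - c * xi R Rc \<le> D" if "D \<in> {D. ?ach D}" for D using lower that by simp
    show "y \<le> B - c * xi R Rc" if "\<And>D. D \<in> {D. ?ach D} \<Longrightarrow> y \<le> D" for y
    proof (rule field_le_epsilon)
      fix e :: real assume "0 < e"
      then obtain D where "?ach D" "D \<le> B - c * xi R Rc + e" using upper by blast
      then show "y \<le> B - c * xi R Rc + e" using that[of D] by simp
    qed
  qed
  then show ?thesis by (simp add: DRF_def B_def c_def)
qed

end
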